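(* There exists a polynomial $\alpha_{av}\in\mathbb{N}[t]$ such that for every $m\in C^\infty(G)$ with compact support modulo $Z(G)$, every $x\in G^{rss}$ and every $i\in\mathbb{N}$, $$|\mathcal{A}_i(m)(x)|\le \alpha_{av}\big(i+ov_{G^{rss}}(x)\big)\,\Omega(|m|)(x).$$
   Context: $F$ is a non-Archimedean local field of arbitrary characteristic, $O_F$ its ring of integers, $\mathrm{val}$ the normalized valuation. $G=\mathrm{GL}_n(F)$, $Z(G)$ its center, $G^{ad}=G/Z(G)$. For $x\in G$, $ov_G(x)=\max\big(\max_{i,j}(-\mathrm{val}(x_{ij})),\mathrm{val}(\det x)\big)$, $G_i=\{x: ov_G(x)\le i\}$, $(G^{ad})_i$ its image in $G^{ad}$. $\Delta(x)$ is the discriminant of the characteristic polynomial, $G^{rss}=\{\Delta\ne0\}$, $ov_{G^{rss}}(x)=\max(ov_G(x),\mathrm{val}\Delta(x))$. Measures: $\mu_G$ Haar on $G$ with $\mu_G(\mathrm{GL}_n(O_F))=1$; $\mu_{Z(G)}$ Haar on $Z(G)\cong F^\times$ with $O_F^\times$ of measure 1; $\mu_{G^{ad}}$ the quotient measure. For $x\in G^{rss}$, $\mu_{G_x}$ is the Haar measure on the centralizer torus $G_x$ giving its maximal compact subgroup measure 1, and $\mu_{G\cdot x}$ the invariant measure on $G\cdot x\cong G/G_x$ corresponding to $\mu_G,\mu_{G_x}$. For $f$ smooth and compactly supported mod center, $\Omega(f)(x)=\int_{G\cdot x}f\,d\mu_{G\cdot x}$, and $\mathcal{A}_i(f)(x)=\int_{(G^{ad})_i}f(gxg^{-1})\,d\mu_{G^{ad}}(g)$.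 *)

theory Defs
  imports "HOL-Analysis.Analysis" "Jordan_Normal_Form.Char_Poly" "Subresultants.Resultant_Prelim"
begin

text \<open>v is the normalized valuation on the nonzero elements (its value at 0 is irrelevant,
 we read "val 0 = infinity" through the helper vge).\<close>

definition vge :: "('a::field \<Rightarrow> int) \<Rightarrow> 'a \<Rightarrow> int \<Rightarrow> bool" where
  "vge v x k \<longleftrightarrow> x = 0 \<or> v x \<ge> k"

definition nonarch_local_field :: "('a::field \<Rightarrow> int) \<Rightarrow> bool" where
  "nonarch_local_field v \<longleftrightarrow>
     (\<forall>x y. x \<noteq> 0 \<longrightarrow> y \<noteq> 0 \<longrightarrow> v (x * y) = v x + v y) \<and>
     (\<forall>x y. x \<noteq> 0 \<longrightarrow> y \<noteq> 0 \<longrightarrow> x + y \<noteq> 0 \<longrightarrow> v (x + y) \<ge> min (v x) (v y)) \<and>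
     (\<exists>p. p \<noteq> 0 \<and> v p = 1) \<and>
     \<comment> \<open>finite residue field: O_F has finitely many classes modulo the maximal ideal\<close>
     (\<exists>R. finite R \<and> (\<forall>x. vge v x 0 \<longrightarrow> (\<exists>r\<in>R. vge v r 0 \<and> vge v (x - r) 1))) \<and>
     \<comment> \<open>completeness\<close>
     (\<forall>s::nat \<Rightarrow> 'a. (\<forall>k. \<exists>N. \<forall>p\<ge>N. \<forall>q\<ge>N. vge v (s p - s q) k) \<longrightarrow>
        (\<exists>l. \<forall>k. \<exists>N. \<forall>p\<ge>N. vge v (s p - l) k))"

definition GL :: "nat \<Rightarrow> 'a::field mat set" where
  "GL n = {g \<in> carrier_mat n n. det g \<noteq> 0}"

definition GL_O :: "('a::field \<Rightarrow> int) \<Rightarrow> nat \<Rightarrow> 'a mat set" where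
  "GL_O v n = {g \<in> GL n. (\<forall>i<n. \<forall>j<n. vge v (g $$ (i,j)) 0) \<and> v (det g) = 0}"

definition ginv :: "nat \<Rightarrow> 'a::field mat \<Rightarrow> 'a mat" where
  "ginv n g = (SOME h. h \<in> carrier_mat n n \<and> g * h = 1\<^sub>m n \<and> h * g = 1\<^sub>m n)"

definition conj_by :: "nat \<Rightarrow> 'a::field mat \<Rightarrow> 'a mat \<Rightarrow> 'a mat" where
  "conj_by n g x = g * x * ginv n g"

definition Zc :: "nat \<Rightarrow> 'a::field mat set" where
  "Zc n = {c \<cdot>\<^sub>m 1\<^sub>m n | c. c \<noteq> 0}"

definition Zc_O :: "('a::field \<Rightarrow> int) \<Rightarrow> nat \<Rightarrow> 'a mat set" where
  "Zc_O v n = {c \<cdot>\<^sub>m 1\<^sub>m n | c. c \<noteq> 0 \<and> v c = 0}"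

definition ov_G :: "('a::field \<Rightarrow> int) \<Rightarrow> nat \<Rightarrow> 'a mat \<Rightarrow> int" where
  "ov_G v n x = Max ({- v (x $$ (i,j)) | i j. i < n \<and> j < n \<and> x $$ (i,j) \<noteq> 0} \<union> {v (det x)})"

text \<open>G_i and the preimage in G of (G^ad)_i, namely Z(G) G_i.\<close>
definition G_le :: "('a::field \<Rightarrow> int) \<Rightarrow> nat \<Rightarrow> nat \<Rightarrow> 'a mat set" where
  "G_le v n i = {x \<in> GL n. ov_G v n x \<le> int i}"

definition ZG_le :: "('a::field \<Rightarrow> int) \<Rightarrow> nat \<Rightarrow> nat \<Rightarrow> 'a mat set" where
  "ZG_le v n i = {z * h | z h. z \<in> Zc n \<and> h \<in> G_le v n i}"

text \<open>Discriminant of a monic polynomial p of degree d: (-1)^(d(d-1)/2) Res(p, p').\<close>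
definition disc :: "'a::idom poly \<Rightarrow> 'a" where
  "disc p = (-1) ^ (degree p * (degree p - 1) div 2) * resultant p (pderiv p)"

definition Delta :: "'a::field mat \<Rightarrow> 'a" where
  "Delta x = disc (char_poly x)"

definition G_rss :: "nat \<Rightarrow> 'a::field mat set" where
  "G_rss n = {x \<in> GL n. Delta x \<noteq> 0}"

definition ov_rss :: "('a::field \<Rightarrow> int) \<Rightarrow> nat \<Rightarrow> 'a mat \<Rightarrow> int" where
  "ov_rss v n x = max (ov_G v n x) (v (Delta x))"

definition GLtop :: "('a::field \<Rightarrow> int) \<Rightarrow> nat \<Rightarrow> 'a mat topology" where
  "GLtop v n = topology (\<lambda>U. U \<subseteq> GL n \<and>
     (\<forall>x\<in>U. \<exists>k::int. \<forall>y\<in>GL n. (\<forall>i<n. \<forall>j<n. vge v (y $$ (i,j) - x $$ (i,j)) k) \<longrightarrow> y \<in> U))"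

definition borel_sets_in :: "('a::field \<Rightarrow> int) \<Rightarrow> nat \<Rightarrow> 'a mat set \<Rightarrow> 'a mat set set" where
  "borel_sets_in v n S = sigma_sets S {U \<inter> S | U. openin (GLtop v n) U}"

definition haar_on :: "('a::field \<Rightarrow> int) \<Rightarrow> nat \<Rightarrow> 'a mat set \<Rightarrow> 'a mat set \<Rightarrow> 'a mat measure \<Rightarrow> bool" where
  "haar_on v n H K M \<longleftrightarrow> space M = H \<and> sets M = borel_sets_in v n H \<and>
     (\<forall>g\<in>H. \<forall>A\<in>sets M. emeasure M ((\<lambda>h. g * h) ` A) = emeasure M A) \<and>
     emeasure M K = 1"

definition centralizer :: "nat \<Rightarrow> 'a::field mat \<Rightarrow> 'a mat set" where
  "centralizer n x = {g \<in> GL n. g * x = x * g}"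

definition compact_subgroup :: "('a::field \<Rightarrow> int) \<Rightarrow> nat \<Rightarrow> 'a mat set \<Rightarrow> 'a mat set \<Rightarrow> bool" where
  "compact_subgroup v n H K \<longleftrightarrow> K \<subseteq> H \<and> 1\<^sub>m n \<in> K \<and> (\<forall>a\<in>K. \<forall>b\<in>K. a * b \<in> K) \<and>
     (\<forall>a\<in>K. \<exists>b\<in>K. a * b = 1\<^sub>m n) \<and> compactin (GLtop v n) K"

definition max_compact_subgroup :: "('a::field \<Rightarrow> int) \<Rightarrow> nat \<Rightarrow> 'a mat set \<Rightarrow> 'a mat set \<Rightarrow> bool" where
  "max_compact_subgroup v n H K \<longleftrightarrow> compact_subgroup v n H K \<and>
     (\<forall>K'. compact_subgroup v n H K' \<longrightarrow> K' \<subseteq> K)"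

definition is_mu_G :: "('a::field \<Rightarrow> int) \<Rightarrow> nat \<Rightarrow> 'a mat measure \<Rightarrow> bool" where
  "is_mu_G v n M \<longleftrightarrow> haar_on v n (GL n) (GL_O v n) M"

definition is_mu_Z :: "('a::field \<Rightarrow> int) \<Rightarrow> nat \<Rightarrow> 'a mat measure \<Rightarrow> bool" where
  "is_mu_Z v n M \<longleftrightarrow> haar_on v n (Zc n) (Zc_O v n) M"

definition is_mu_Gx :: "('a::field \<Rightarrow> int) \<Rightarrow> nat \<Rightarrow> 'a mat \<Rightarrow> 'a mat measure \<Rightarrow> bool" where
  "is_mu_Gx v n x M \<longleftrightarrow> space M = centralizer n x \<and> sets M = borel_sets_in v n (centralizer n x) \<and>
     (\<forall>g\<in>centralizer n x. \<forall>A\<in>sets M. emeasure M ((\<lambda>h. g * h) ` A) = emeasure M A) \<and>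
     (\<forall>K. max_compact_subgroup v n (centralizer n x) K \<longrightarrow> emeasure M K = 1)"

text \<open>A Borel weight w on G with fibre integrals equal to 1 over the closed subgroup H
  (measure MH): \<integral>_H w(g h) dMH(h) = 1 for all g.  For such w and any left H-invariant
  nonnegative f, the integral of f over G/H against the quotient measure (mu_G/MH) equals
  \<integral>_G f w d mu_G.\<close>
definition fibre_weight :: "nat \<Rightarrow> 'a::field mat measure \<Rightarrow> 'a mat measure \<Rightarrow> ('a mat \<Rightarrow> real) \<Rightarrow> bool" where
  "fibre_weight n MG MH w \<longleftrightarrow> w \<in> borel_measurable MG \<and> (\<forall>g\<in>GL n. w g \<ge> 0) \<and>
     (\<forall>g\<in>GL n. (\<integral>\<^sup>+ h. ennreal (w (g * h)) \<partial>MH) = 1)"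

text \<open>Orbital integral Omega(f)(x) = \<integral>_{G/G_x} f(g x g^-1), computed with a fibre weight for G_x.\<close>
definition orbital_integral :: "nat \<Rightarrow> 'a::field mat measure \<Rightarrow> ('a mat \<Rightarrow> real) \<Rightarrow> ('a mat \<Rightarrow> real) \<Rightarrow> 'a mat \<Rightarrow> ennreal" where
  "orbital_integral n MG w f x = (\<integral>\<^sup>+ g. ennreal (w g) * ennreal (f (conj_by n g x)) \<partial>MG)"

text \<open>A_i(f)(x) = \<integral>_{(G^ad)_i} f(g x g^-1) d mu_{G^ad}, computed with a fibre weight for Z(G).\<close>
definition avg_op :: "('a::field \<Rightarrow> int) \<Rightarrow> nat \<Rightarrow> 'a mat measure \<Rightarrow> ('a mat \<Rightarrow> real) \<Rightarrow> nat \<Rightarrow> ('a mat \<Rightarrow> complex) \<Rightarrow> 'a mat \<Rightarrow> complex" where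
  "avg_op v n MG u i f x = (\<integral> g. complex_of_real (indicator (ZG_le v n i) g * u g) * f (conj_by n g x) \<partial>MG)"

definition smooth_cpt_mod_center :: "('a::field \<Rightarrow> int) \<Rightarrow> nat \<Rightarrow> ('a mat \<Rightarrow> complex) \<Rightarrow> bool" where
  "smooth_cpt_mod_center v n f \<longleftrightarrow>
     (\<forall>y\<in>GL n. \<exists>U. openin (GLtop v n) U \<and> y \<in> U \<and> (\<forall>y'\<in>U. f y' = f y)) \<and>
     (\<exists>C. compactin (GLtop v n) C \<and> (\<forall>g\<in>GL n. f g \<noteq> 0 \<longrightarrow> g \<in> {z * c | z c. z \<in> Zc n \<and> c \<in> C}))"

end

theory Submission
  imports "HOL-Algebra.Algebraic_Closure_Type" Defs "Subresultants.Subresultant_Gcd"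
begin

text \<open>
  Write T for the centralizer of x. Inserting the fibre integral of the weight w for T, exchanging the
  integrals and using that G is unimodular, the average of |m| over the image of G_i becomes the
  integral of w(g) |m(g x g^-1)| times the volume, modulo the centre Z, of the set of all h in T with
  g h^-1 in Z G_i. The eigenvalues of x being distinct, T is simultaneously diagonalizable over the
  algebraic closure, to which v extends. The class of an element of T modulo the maximal compact subgroup
  K_x is determined by the valuations of its n eigenvalues, which are multiples of 1/n!. Any two
  elements h of the set above differ, up to Z, by an element of T all of whose eigenvalues have valuation at
  most (n+1) i in absolute value. So the set meets at most (1 + 2 n! (n+1) i)^n cosets of Z K_x, each of
  volume 1.
\<close>

section \<open>Haar measures on groups with a filtration by open subgroups\<close>

text \<open>Everything about the measures is derived from their axioms: left invariant Borel
  measures, each with one subgroup of volume 1. The locale below isolates what makes this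
  elementary: finitely many cosets of each \<open>K m\<close> cover \<open>K 0\<close>, countably
  many cosets of \<open>K 0\<close> cover the group. Second countability makes open sets of a
  product measurable, so multiplication is jointly measurable and Fubini applies; counting cosets
  gives uniqueness of Haar measure. The modular function is then a homomorphism, trivial on
  \<open>K 0\<close> and on the centre; unipotents can be contracted into \<open>K 0\<close>, and
  the n coordinate dilations are conjugate with scalar product, so their common value q has q^n = 1.
  The torus measure is normalised only through \<open>max_compact_subgroup\<close>, so the elements
  with unit eigenvalues must be shown to form a compact group containing every compact subgroup;
  completeness of the field enters there. The constants come from Cramer's rule: inverses of
  elements of G_i have entries of valuation at least -n i, hence quotients at least -(n+1) i. The
  factor n! clears the denominators of the eigenvalue valuations, which are at most n.\<close>

locale filtered_group = Group.group G for G :: "('g,'b) monoid_scheme" (structure) +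
  fixes K :: "nat \<Rightarrow> 'g set"
  assumes K_sub: "subgroup (K m) G"
    and K_anti: "m \<le> l \<Longrightarrow> K l \<subseteq> K m"
    and K_conj: "g \<in> carrier G \<Longrightarrow> \<exists>l. \<forall>k\<in>K l. g \<otimes> k \<otimes> inv g \<in> K m"
    and K_fin: "\<exists>R. finite R \<and> R \<subseteq> carrier G \<and> (\<forall>k\<in>K 0. \<exists>r\<in>R. inv r \<otimes> k \<in> K m)"
    and K_count: "\<exists>D. countable D \<and> D \<subseteq> carrier G \<and> (\<forall>g\<in>carrier G. \<exists>d\<in>D. inv d \<otimes> g \<in> K 0)"
begin

section \<open>Left cosets of the filtration as basic open sets\<close>

definition nb :: "nat \<Rightarrow> 'g \<Rightarrow> 'g set" where
  "nb m g = {y \<in> carrier G. inv g \<otimes> y \<in> K m}"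

definition gopen :: "'g set \<Rightarrow> bool" where
  "gopen U \<longleftrightarrow> U \<subseteq> carrier G \<and> (\<forall>x\<in>U. \<exists>m. nb m x \<subseteq> U)"

text \<open>Only left invariance is required; normalisation is stated separately where it matters.
  Restricting the ambient topology to \<open>H\<close> lets one predicate cover G, its centre and
  the torus.\<close>

definition haar :: "'g set \<Rightarrow> 'g measure \<Rightarrow> bool" where
  "haar H M \<longleftrightarrow> subgroup H G \<and> space M = H \<and> sets M = sigma_sets H {U \<inter> H | U. gopen U} \<and>
     (\<forall>g\<in>H. \<forall>A\<in>sets M. emeasure M ((\<lambda>h. g \<otimes> h) ` A) = emeasure M A)"

lemma K_carrier: "K m \<subseteq> carrier G"
  using K_sub subgroup.subset by blast

lemma inv_mult_cancel:
  assumes "a \<in> carrier G" "b \<in> carrier G" "c \<in> carrier G"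
  shows "inv a \<otimes> c = (inv a \<otimes> b) \<otimes> (inv b \<otimes> c)"
proof -
  have "(inv a \<otimes> b) \<otimes> (inv b \<otimes> c) = inv a \<otimes> ((b \<otimes> inv b) \<otimes> c)"
    using assms by (simp only: m_assoc m_closed inv_closed)
  thus ?thesis using assms by simp
qed

lemma inv_mult_cancel_left: "a \<in> carrier G \<Longrightarrow> c \<in> carrier G \<Longrightarrow> inv a \<otimes> (a \<otimes> c) = c"
  by (metis inv_closed l_inv l_one m_assoc)

lemma mult_inv_cancel_left: "a \<in> carrier G \<Longrightarrow> c \<in> carrier G \<Longrightarrow> a \<otimes> (inv a \<otimes> c) = c"
  by (metis inv_closed r_inv l_one m_assoc)

lemma K_mem: "k \<in> K m \<Longrightarrow> k \<in> carrier G"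
  using K_carrier by blast

lemma nb_carrier: "nb m g \<subseteq> carrier G"
  by (auto simp: nb_def)

lemma nb_self: "g \<in> carrier G \<Longrightarrow> g \<in> nb m g"
  using subgroup.one_closed[OF K_sub] by (simp add: nb_def)

lemma nb_sym: "g \<in> carrier G \<Longrightarrow> y \<in> nb m g \<Longrightarrow> g \<in> nb m y"
  using subgroup.m_inv_closed[OF K_sub, of "inv g \<otimes> y"] by (auto simp: nb_def inv_mult_group)

lemma nb_trans: "g \<in> carrier G \<Longrightarrow> y \<in> nb m g \<Longrightarrow> z \<in> nb m y \<Longrightarrow> z \<in> nb m g"
  using subgroup.m_closed[OF K_sub, of "inv g \<otimes> y" _ "inv y \<otimes> z"] inv_mult_cancel[of g y z]
  by (auto simp: nb_def)

text \<open>Lying in the same coset is an equivalence relation, so every point of a coset is a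
  centre of it; all covering arguments rest on this ultrametric property.\<close>

lemma nb_eq: "g \<in> carrier G \<Longrightarrow> y \<in> nb m g \<Longrightarrow> nb m y = nb m g"
  using nb_sym[of g y m] nb_trans[of g y m] nb_trans[of y g m] nb_carrier[of m g] by blast

lemma nb_anti: "m \<le> l \<Longrightarrow> nb l g \<subseteq> nb m g"
  using K_anti by (auto simp: nb_def)

lemma nb_open: "g \<in> carrier G \<Longrightarrow> gopen (nb m g)"
  unfolding gopen_def using nb_eq nb_carrier by blast

lemma nb_one: "nb m \<one> = K m"
  using K_mem by (auto simp: nb_def)

lemma nb_iff: "g \<in> carrier G \<Longrightarrow> y \<in> nb m g \<longleftrightarrow> (\<exists>k\<in>K m. y = g \<otimes> k)"
proof
  assume g: "g \<in> carrier G" and y: "y \<in> nb m g"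
  then have "inv g \<otimes> y \<in> K m" "y = g \<otimes> (inv g \<otimes> y)"
    by (auto simp: nb_def m_assoc[symmetric])
  thus "\<exists>k\<in>K m. y = g \<otimes> k" by blast
next
  assume g: "g \<in> carrier G" and "\<exists>k\<in>K m. y = g \<otimes> k"
  then show "y \<in> nb m g" using K_mem by (auto simp: nb_def m_assoc[symmetric])
qed

lemma nb_image: "g \<in> carrier G \<Longrightarrow> nb m g = (\<lambda>h. g \<otimes> h) ` K m"
  by (simp add: set_eq_iff image_iff nb_iff)

text \<open>Thicken each point of \<open>W\<close> to a full coset in G: since cosets can be
  recentred, the union is open, and it meets \<open>H\<close> exactly in \<open>W\<close>.\<close>

lemma open_in_sets:
  assumes H: "H \<subseteq> carrier G" and W: "W \<subseteq> H" "\<And>x. x \<in> W \<Longrightarrow> \<exists>m. nb m x \<inter> H \<subseteq> W"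
  shows "W \<in> sigma_sets H {U \<inter> H | U. gopen U}"
proof -
  obtain m where m: "\<And>x. x \<in> W \<Longrightarrow> nb (m x) x \<inter> H \<subseteq> W" using W(2) by metis
  let ?U = "\<Union>x\<in>W. nb (m x) x"
  have "\<exists>l. nb l y \<subseteq> ?U" if y: "y \<in> ?U" for y
  proof -
    obtain x where x: "x \<in> W" "y \<in> nb (m x) x" using y by blast
    then have "nb (m x) y \<subseteq> ?U" using nb_eq[of x y "m x"] W(1) H by blast
    then show ?thesis by (rule exI)
  qed
  then have "gopen ?U" using nb_carrier unfolding gopen_def by blast
  moreover have "x \<in> nb (m x) x" if "x \<in> W" for x using nb_self[of x "m x"] that W(1) H by blast
  then have "?U \<inter> H = W" using m W(1) by blast
  ultimately show ?thesis by (intro sigma_sets.Basic) auto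
qed

text \<open>Products of countably many representatives modulo \<open>K 0\<close> with finitely many
  representatives of \<open>K 0\<close> modulo \<open>K m\<close> represent all cosets of
  \<open>K m\<close>.\<close>

lemma countable_cover_nb: "\<exists>D. countable D \<and> D \<subseteq> carrier G \<and> (\<forall>g\<in>carrier G. \<exists>d\<in>D. g \<in> nb m d)"
proof -
  obtain D where D: "countable D" "D \<subseteq> carrier G" "\<forall>g\<in>carrier G. \<exists>d\<in>D. inv d \<otimes> g \<in> K 0"
    using K_count by blast
  obtain R where R: "finite R" "R \<subseteq> carrier G" "\<forall>k\<in>K 0. \<exists>r\<in>R. inv r \<otimes> k \<in> K m"
    using K_fin[of m] by blast
  let ?D = "(\<lambda>(d,r). d \<otimes> r) ` (D \<times> R)"
  have "\<exists>d\<in>?D. g \<in> nb m d" if g: "g \<in> carrier G" for g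
  proof -
    obtain d where d: "d \<in> D" "inv d \<otimes> g \<in> K 0" using D g by blast
    obtain r where r: "r \<in> R" "inv r \<otimes> (inv d \<otimes> g) \<in> K m" using R d by blast
    have "g \<in> nb m (d \<otimes> r)" using d r g D R
      by (auto simp: nb_def inv_mult_group m_assoc subset_iff)
    thus ?thesis using d r by force
  qed
  moreover have "countable ?D" using D R by (auto intro: countable_finite)
  moreover have "?D \<subseteq> carrier G" using D R by auto
  ultimately show ?thesis by blast
qed

text \<open>Centres taken from G may lie outside \<open>H\<close>; each coset that meets
  \<open>H\<close> is recentred at a point of \<open>H\<close>, which does not change the
  coset.\<close>

lemma countable_cover:
  assumes H: "H \<subseteq> carrier G"
  shows "\<exists>D. \<forall>m. countable (D m) \<and> D m \<subseteq> H \<and> (\<forall>g\<in>H. \<exists>d\<in>D m. g \<in> nb m d)"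
proof -
  have "\<exists>E. countable E \<and> E \<subseteq> H \<and> (\<forall>g\<in>H. \<exists>d\<in>E. g \<in> nb m d)" for m
  proof -
    obtain D where D: "countable D" "D \<subseteq> carrier G" "\<forall>g\<in>carrier G. \<exists>d\<in>D. g \<in> nb m d"
      using countable_cover_nb by blast
    let ?D = "{d \<in> D. nb m d \<inter> H \<noteq> {}}"
    let ?E = "(\<lambda>d. SOME h. h \<in> nb m d \<inter> H) ` ?D"
    have s: "(SOME h. h \<in> nb m d \<inter> H) \<in> nb m d \<inter> H" if "d \<in> ?D" for d
      using that some_in_eq[of "nb m d \<inter> H"] by auto
    have "\<exists>e\<in>?E. g \<in> nb m e" if g: "g \<in> H" for g
    proof -
      obtain d where d: "d \<in> D" "g \<in> nb m d" using D(3) H g by blast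
      then have dD: "d \<in> ?D" using g by blast
      then show ?thesis using s[OF dD] nb_eq[of d "SOME h. h \<in> nb m d \<inter> H" m] d D(2) by blast
    qed
    moreover have "countable ?E" using D by auto
    moreover have "?E \<subseteq> H" using s by blast
    ultimately show ?thesis by blast
  qed
  then have "\<forall>m. \<exists>E. countable E \<and> E \<subseteq> H \<and> (\<forall>g\<in>H. \<exists>d\<in>E. g \<in> nb m d)" ..
  from choice[OF this] show ?thesis .
qed

section \<open>Borel measurability, translation invariance and sigma-finiteness\<close>

lemma haarD:
  assumes "haar H M"
  shows "subgroup H G" "space M = H" "sets M = sigma_sets H {U \<inter> H | U. gopen U}" "H \<subseteq> carrier G"
    "\<And>g A. g \<in> H \<Longrightarrow> A \<in> sets M \<Longrightarrow> emeasure M ((\<lambda>h. g \<otimes> h) ` A) = emeasure M A"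
  using assms subgroup.subset unfolding haar_def by blast+

lemma open_sets_haar:
  assumes "haar H M" "W \<subseteq> H" "\<And>x. x \<in> W \<Longrightarrow> \<exists>m. nb m x \<inter> H \<subseteq> W"
  shows "W \<in> sets M"
  using open_in_sets[of H W] haarD[OF assms(1)] assms(2,3) by simp

lemma nb_sets_haar:
  assumes "haar H M" "g \<in> carrier G"
  shows "nb m g \<inter> H \<in> sets M"
  using assms(1)
proof (rule open_sets_haar)
  show "\<exists>l. nb l x \<inter> H \<subseteq> nb m g \<inter> H" if "x \<in> nb m g \<inter> H" for x
    using that nb_eq[OF assms(2), of x m] by blast
qed simp

text \<open>By second countability an open subset of the product is a countable union of rectangles
  of cosets. This is what makes multiplication jointly measurable, as Fubini demands.\<close>

lemma open_sets_product:
  assumes M1: "haar H1 M1" and M2: "haar H2 M2" and W: "W \<subseteq> H1 \<times> H2"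
    and op: "\<And>x y. (x,y) \<in> W \<Longrightarrow> \<exists>m. (nb m x \<inter> H1) \<times> (nb m y \<inter> H2) \<subseteq> W"
  shows "W \<in> sets (M1 \<Otimes>\<^sub>M M2)"
proof -
  note h1 = haarD[OF M1] and h2 = haarD[OF M2]
  obtain D1 where D1': "\<forall>m. countable (D1 m) \<and> D1 m \<subseteq> H1 \<and> (\<forall>g\<in>H1. \<exists>d\<in>D1 m. g \<in> nb m d)"
    by (rule exE[OF countable_cover[OF h1(4)]])
  have D1: "countable (D1 m)" "D1 m \<subseteq> H1" "g \<in> H1 \<Longrightarrow> \<exists>d\<in>D1 m. g \<in> nb m d" for m g
    using D1' by blast+
  obtain D2 where D2': "\<forall>m. countable (D2 m) \<and> D2 m \<subseteq> H2 \<and> (\<forall>g\<in>H2. \<exists>d\<in>D2 m. g \<in> nb m d)"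
    by (rule exE[OF countable_cover[OF h2(4)]])
  have D2: "countable (D2 m)" "D2 m \<subseteq> H2" "g \<in> H2 \<Longrightarrow> \<exists>d\<in>D2 m. g \<in> nb m d" for m g
    using D2' by blast+
  let ?r = "\<lambda>m d e. (nb m d \<inter> H1) \<times> (nb m e \<inter> H2)"
  let ?I = "{(m,d,e). d \<in> D1 m \<and> e \<in> D2 m \<and> ?r m d e \<subseteq> W}"
  have "?I \<subseteq> (SIGMA m:UNIV. D1 m \<times> D2 m)" by auto
  moreover have "countable (SIGMA m:(UNIV::nat set). D1 m \<times> D2 m)" using D1 D2 by auto
  ultimately have cI: "countable ?I" by (rule countable_subset)
  have "W = (\<Union>i\<in>?I. ?r (fst i) (fst (snd i)) (snd (snd i)))"
  proof
    show "W \<subseteq> (\<Union>i\<in>?I. ?r (fst i) (fst (snd i)) (snd (snd i)))"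
    proof
      fix p assume p: "p \<in> W"
      obtain x y where xy: "p = (x,y)" "x \<in> H1" "y \<in> H2" using p W by blast
      obtain m where m: "?r m x y \<subseteq> W" using op p xy by blast
      obtain d e where de: "d \<in> D1 m" "x \<in> nb m d" "e \<in> D2 m" "y \<in> nb m e"
        using D1(3) D2(3) xy by blast
      have "nb m x = nb m d" "nb m y = nb m e" using de nb_eq D1(2) D2(2) h1(4) h2(4) by blast+
      then have "(m,d,e) \<in> ?I" using de m by simp
      moreover have "p \<in> ?r m d e" using xy de by simp
      ultimately have "p \<in> ?r (fst (m,d,e)) (fst (snd (m,d,e))) (snd (snd (m,d,e)))" "(m,d,e) \<in> ?I" by auto
      then show "p \<in> (\<Union>i\<in>?I. ?r (fst i) (fst (snd i)) (snd (snd i)))" by blast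
    qed
  qed auto
  also have "\<dots> \<in> sets (M1 \<Otimes>\<^sub>M M2)"
  proof (rule sets.countable_UN''[OF cI])
    fix i assume i: "i \<in> ?I"
    obtain m d e where ie: "i = (m,d,e)" by (cases i)
    have "d \<in> carrier G" "e \<in> carrier G" using i ie D1(2) D2(2) h1(4) h2(4) by blast+
    then show "?r (fst i) (fst (snd i)) (snd (snd i)) \<in> sets (M1 \<Otimes>\<^sub>M M2)"
      using ie nb_sets_haar[OF M1, of d m] nb_sets_haar[OF M2, of e m] by auto
  qed
  finally show ?thesis .
qed

lemma measurable_pair_continuous:
  assumes M1: "haar H1 M1" and M2: "haar H2 M2" and M3: "haar H3 M3"
    and f: "\<And>x y. x \<in> H1 \<Longrightarrow> y \<in> H2 \<Longrightarrow> f x y \<in> H3"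
    and c: "\<And>x y m. x \<in> H1 \<Longrightarrow> y \<in> H2 \<Longrightarrow> 
      \<exists>l. \<forall>a\<in>nb l x \<inter> H1. \<forall>b\<in>nb l y \<inter> H2. f a b \<in> nb m (f x y)"
  shows "(\<lambda>p. f (fst p) (snd p)) \<in> measurable (M1 \<Otimes>\<^sub>M M2) M3"
proof -
  note h1 = haarD[OF M1] and h2 = haarD[OF M2] and h3 = haarD[OF M3]
  show ?thesis
  proof (rule measurable_sigma_sets[OF h3(3)])
    show "{U \<inter> H3 | U. gopen U} \<subseteq> Pow H3" by auto
    show "(\<lambda>p. f (fst p) (snd p)) \<in> space (M1 \<Otimes>\<^sub>M M2) \<rightarrow> H3"
      using f by (auto simp: space_pair_measure h1 h2)
    fix y assume "y \<in> {U \<inter> H3 | U. gopen U}"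
    then obtain U where U: "y = U \<inter> H3" "gopen U" by blast
    have "{p \<in> H1 \<times> H2. f (fst p) (snd p) \<in> U} \<in> sets (M1 \<Otimes>\<^sub>M M2)" (is "?W \<in> _")
    proof (rule open_sets_product[OF M1 M2])
      fix a b assume ab: "(a,b) \<in> ?W"
      then obtain m where "nb m (f a b) \<subseteq> U" using U(2) unfolding gopen_def by auto
      then show "\<exists>m. (nb m a \<inter> H1) \<times> (nb m b \<inter> H2) \<subseteq> ?W" using c[of a b m] ab by fastforce
    qed auto
    moreover have "(\<lambda>p. f (fst p) (snd p)) -` y \<inter> space (M1 \<Otimes>\<^sub>M M2) = ?W"
      using f U by (auto simp: space_pair_measure h1 h2)
    ultimately show "(\<lambda>p. f (fst p) (snd p)) -` y \<inter> space (M1 \<Otimes>\<^sub>M M2) \<in> sets (M1 \<Otimes>\<^sub>M M2)" by simp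
  qed
qed

lemma measurable_continuous:
  assumes M1: "haar H1 M1" and M3: "haar H3 M3"
    and f: "\<And>x. x \<in> H1 \<Longrightarrow> f x \<in> H3"
    and c: "\<And>x m. x \<in> H1 \<Longrightarrow> \<exists>l. \<forall>a\<in>nb l x \<inter> H1. f a \<in> nb m (f x)"
  shows "f \<in> measurable M1 M3"
proof -
  note h1 = haarD[OF M1] and h3 = haarD[OF M3]
  show ?thesis
  proof (rule measurable_sigma_sets[OF h3(3)])
    show "{U \<inter> H3 | U. gopen U} \<subseteq> Pow H3" by auto
    show "f \<in> space M1 \<rightarrow> H3" using f by (auto simp: h1)
    fix y assume "y \<in> {U \<inter> H3 | U. gopen U}"
    then obtain U where U: "y = U \<inter> H3" "gopen U" by blast
    have "{p \<in> H1. f p \<in> U} \<in> sets M1" (is "?W \<in> _")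
    proof (rule open_sets_haar[OF M1])
      fix a assume ab: "a \<in> ?W"
      then obtain m where "nb m (f a) \<subseteq> U" using U(2) unfolding gopen_def by auto
      then show "\<exists>m. nb m a \<inter> H1 \<subseteq> ?W" using c[of a m] ab by fastforce
    qed auto
    moreover have "f -` y \<inter> space M1 = ?W" using f U by (auto simp: h1)
    ultimately show "f -` y \<inter> space M1 \<in> sets M1" by simp
  qed
qed

text \<open>From x k y k' = x y (y^-1 k y) k': \<open>K_conj\<close> chooses \<open>l\<close> so
  that conjugation by the inverse of \<open>y\<close> carries \<open>K l\<close> into
  \<open>K m\<close>.\<close>

lemma mult_continuous:
  assumes x: "x \<in> carrier G" and y: "y \<in> carrier G"
  shows "\<exists>l. \<forall>a\<in>nb l x. \<forall>b\<in>nb l y. a \<otimes> b \<in> nb m (x \<otimes> y)"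
proof -
  obtain l where l: "\<forall>k\<in>K l. inv y \<otimes> k \<otimes> inv (inv y) \<in> K m" using K_conj y by blast
  have "a \<otimes> b \<in> nb m (x \<otimes> y)" if a: "a \<in> nb (max l m) x" and b: "b \<in> nb (max l m) y" for a b
  proof -
    have "a \<in> nb l x" "b \<in> nb m y" using a b nb_anti[of l "max l m" x] nb_anti[of m "max l m" y] by auto
    then obtain k k' where k: "k \<in> K l" "a = x \<otimes> k" "k' \<in> K m" "b = y \<otimes> k'"
      using nb_iff[OF x, of a l] nb_iff[OF y, of b m] by blast
    have kc: "k \<in> carrier G" "k' \<in> carrier G" using k K_carrier by blast+
    have "a \<otimes> b = (x \<otimes> y) \<otimes> ((inv y \<otimes> k \<otimes> y) \<otimes> k')"
    proof -
      have "(x \<otimes> y) \<otimes> ((inv y \<otimes> k \<otimes> y) \<otimes> k') = x \<otimes> ((y \<otimes> inv y) \<otimes> (k \<otimes> (y \<otimes> k')))"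
        using x y kc by (simp only: m_assoc m_closed inv_closed)
      thus ?thesis using x y kc k by (simp add: m_assoc)
    qed
    moreover have "(inv y \<otimes> k \<otimes> y) \<otimes> k' \<in> K m" using l k y subgroup.m_closed[OF K_sub] by simp
    ultimately show ?thesis using nb_iff[OF m_closed[OF x y], of "a \<otimes> b" m] by blast
  qed
  thus ?thesis by blast
qed

text \<open>The inverse of y k is y^-1 (y k^-1 y^-1), so it suffices that conjugation by
  \<open>y\<close> maps \<open>K l\<close> into \<open>K m\<close>.\<close>

lemma inv_continuous:
  assumes y: "y \<in> carrier G"
  shows "\<exists>l. \<forall>b\<in>nb l y. inv b \<in> nb m (inv y)"
proof -
  obtain l where l: "\<forall>k\<in>K l. y \<otimes> k \<otimes> inv y \<in> K m" using K_conj y by blast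
  have "inv b \<in> nb m (inv y)" if b: "b \<in> nb l y" for b
  proof -
    obtain k where k: "k \<in> K l" "b = y \<otimes> k" using nb_iff[OF y, of b l] b by blast
    have kc: "k \<in> carrier G" using k K_carrier by blast
    have "inv (inv y) \<otimes> inv b = y \<otimes> inv k \<otimes> inv y" using k kc y by (simp add: inv_mult_group m_assoc)
    moreover have "inv k \<in> K l" using k subgroup.m_inv_closed[OF K_sub] by blast
    ultimately show ?thesis using l y k kc by (simp add: nb_def)
  qed
  thus ?thesis by blast
qed

lemma measurable_left_mult:
  assumes M: "haar H M" and MG: "haar (carrier G) MG" and g: "g \<in> carrier G"
  shows "(\<lambda>h. g \<otimes> h) \<in> measurable M MG"
proof (rule measurable_continuous[OF M MG])
  show "g \<otimes> x \<in> carrier G" if "x \<in> H" for x using m_closed[OF g] haarD(4)[OF M] that by blast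
  fix x m assume x: "x \<in> H"
  then have xG: "x \<in> carrier G" using haarD(4)[OF M] by blast
  obtain l where l: "\<forall>a\<in>nb l g. \<forall>b\<in>nb l x. a \<otimes> b \<in> nb m (g \<otimes> x)"
    using mult_continuous[OF g xG, of m] ..
  then have "\<forall>a\<in>nb l x \<inter> H. g \<otimes> a \<in> nb m (g \<otimes> x)" using nb_self[OF g, of l] by blast
  then show "\<exists>l. \<forall>a\<in>nb l x \<inter> H. g \<otimes> a \<in> nb m (g \<otimes> x)" by (rule exI[of _ l])
qed

lemma measurable_right_mult:
  assumes MG: "haar (carrier G) MG" and g: "g \<in> carrier G"
  shows "(\<lambda>h. h \<otimes> g) \<in> measurable MG MG"
proof (rule measurable_continuous[OF MG MG])
  show "x \<otimes> g \<in> carrier G" if "x \<in> carrier G" for x using m_closed[OF that g] .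
  fix x m assume x: "x \<in> carrier G"
  obtain l where l: "\<forall>a\<in>nb l x. \<forall>b\<in>nb l g. a \<otimes> b \<in> nb m (x \<otimes> g)"
    using mult_continuous[OF x g, of m] ..
  then have "\<forall>a\<in>nb l x \<inter> carrier G. a \<otimes> g \<in> nb m (x \<otimes> g)" using nb_self[OF g, of l] by blast
  then show "\<exists>l. \<forall>a\<in>nb l x \<inter> carrier G. a \<otimes> g \<in> nb m (x \<otimes> g)" by (rule exI[of _ l])
qed

lemma measurable_left_mult_sub:
  assumes M: "haar H M" and g: "g \<in> H"
  shows "(\<lambda>h. g \<otimes> h) \<in> measurable M M"
proof (rule measurable_continuous[OF M M])
  note h = haarD[OF M]
  show "g \<otimes> x \<in> H" if "x \<in> H" for x using subgroup.m_closed[OF h(1) g that] .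
  fix x m assume x: "x \<in> H"
  have gG: "g \<in> carrier G" and xG: "x \<in> carrier G" using g x h(4) by blast+
  obtain l where l: "\<forall>a\<in>nb l g. \<forall>b\<in>nb l x. a \<otimes> b \<in> nb m (g \<otimes> x)"
    using mult_continuous[OF gG xG, of m] ..
  then have "\<forall>a\<in>nb l x \<inter> H. g \<otimes> a \<in> nb m (g \<otimes> x)" using nb_self[OF gG, of l] by blast
  then show "\<exists>l. \<forall>a\<in>nb l x \<inter> H. g \<otimes> a \<in> nb m (g \<otimes> x)" by (rule exI[of _ l])
qed

text \<open>The preimage of \<open>A\<close> under left translation by g is the translate of
  \<open>A\<close> by g^-1; so the image measure is the measure itself, and change of variables
  applies.\<close>

lemma nn_integral_left_mult:
  assumes M: "haar H M" and g: "g \<in> H" and f: "f \<in> borel_measurable M"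
  shows "(\<integral>\<^sup>+h. f (g \<otimes> h) \<partial>M) = (\<integral>\<^sup>+h. f h \<partial>M)"
proof -
  note h = haarD[OF M]
  have gG: "g \<in> carrier G" using g h(4) by blast
  have me: "(\<lambda>h. g \<otimes> h) \<in> measurable M M" using measurable_left_mult_sub[OF M g] .
  have ig: "inv g \<in> H" using subgroup.m_inv_closed[OF h(1) g] .
  have d: "distr M M (\<lambda>h. g \<otimes> h) = M"
  proof (rule measure_eqI)
    fix A assume "A \<in> sets (distr M M ((\<otimes>) g))"
    then have A: "A \<in> sets M" by simp
    have AH: "A \<subseteq> H" using sets.sets_into_space[OF A] h(2) by simp
    have "(\<lambda>h. g \<otimes> h) -` A \<inter> space M = (\<lambda>h. inv g \<otimes> h) ` A"
    proof
      show "(\<lambda>h. g \<otimes> h) -` A \<inter> space M \<subseteq> (\<lambda>h. inv g \<otimes> h) ` A"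
      proof
        fix y assume "y \<in> (\<lambda>h. g \<otimes> h) -` A \<inter> space M"
        then have "g \<otimes> y \<in> A" "y \<in> carrier G" using h(2,4) by auto
        then have "g \<otimes> y \<in> A" "y = inv g \<otimes> (g \<otimes> y)" using inv_mult_cancel_left[OF gG, of y] by simp_all
        then show "y \<in> (\<lambda>h. inv g \<otimes> h) ` A" by blast
      qed
      show "(\<lambda>h. inv g \<otimes> h) ` A \<subseteq> (\<lambda>h. g \<otimes> h) -` A \<inter> space M"
      proof
        fix y assume "y \<in> (\<lambda>h. inv g \<otimes> h) ` A"
        then obtain a where a: "a \<in> A" "y = inv g \<otimes> a" by blast
        then have "a \<in> H" "a \<in> carrier G" using AH h(4) by blast+
        then have "g \<otimes> y = a" "y \<in> H"
          using a(2) mult_inv_cancel_left[OF gG, of a] subgroup.m_closed[OF h(1) ig, of a] by simp_all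
        then show "y \<in> (\<lambda>h. g \<otimes> h) -` A \<inter> space M" using a h(2) by simp
      qed
    qed
    then show "emeasure (distr M M ((\<otimes>) g)) A = emeasure M A"
      using emeasure_distr[OF me A] h(5)[OF ig A] by simp
  qed simp
  show ?thesis using nn_integral_distr[OF me, of f] f unfolding d by simp
qed

text \<open>Countably many translates of \<open>K m \<inter> H\<close> cover \<open>H\<close>, and
  left invariance gives each of them the volume of \<open>K m \<inter> H\<close>, at most that of
  \<open>C\<close>.\<close>

lemma sigma_finite_haar:
  assumes M: "haar H M" and C: "C \<in> sets M" "emeasure M C < \<infinity>" and m: "K m \<inter> H \<subseteq> C"
  shows "sigma_finite_measure M"
proof
  note h = haarD[OF M]
  obtain D where D': "\<forall>m. countable (D m) \<and> D m \<subseteq> H \<and> (\<forall>g\<in>H. \<exists>d\<in>D m. g \<in> nb m d)"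
    by (rule exE[OF countable_cover[OF h(4)]])
  have D: "countable (D m)" "D m \<subseteq> H" "g \<in> H \<Longrightarrow> \<exists>d\<in>D m. g \<in> nb m d" for m g
    using D' by blast+
  let ?A = "(\<lambda>d. nb m d \<inter> H) ` D m"
  have KH: "K m \<inter> H \<in> sets M" using nb_sets_haar[OF M, of \<one> m] nb_one by simp
  have "emeasure M (nb m d \<inter> H) < \<infinity>" if d: "d \<in> D m" for d
  proof -
    have dH: "d \<in> H" and dG: "d \<in> carrier G" using d D(2) h(4) by blast+
    have "nb m d \<inter> H = (\<lambda>h. d \<otimes> h) ` (K m \<inter> H)"
    proof
      show "nb m d \<inter> H \<subseteq> (\<lambda>h. d \<otimes> h) ` (K m \<inter> H)"
      proof
        fix y assume y: "y \<in> nb m d \<inter> H"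
        then have "inv d \<otimes> y \<in> K m \<inter> H"
          using subgroup.m_closed[OF h(1) subgroup.m_inv_closed[OF h(1) dH], of y] by (simp add: nb_def)
        moreover have "y = d \<otimes> (inv d \<otimes> y)" using mult_inv_cancel_left[OF dG, of y] y nb_carrier[of m d] by auto
        ultimately show "y \<in> (\<lambda>h. d \<otimes> h) ` (K m \<inter> H)" by blast
      qed
      show "(\<lambda>h. d \<otimes> h) ` (K m \<inter> H) \<subseteq> nb m d \<inter> H"
      proof
        fix y assume "y \<in> (\<lambda>h. d \<otimes> h) ` (K m \<inter> H)"
        then obtain k where k: "k \<in> K m" "k \<in> H" "y = d \<otimes> k" by blast
        then show "y \<in> nb m d \<inter> H" using nb_iff[OF dG, of y m] subgroup.m_closed[OF h(1) dH k(2)] by blast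
      qed
    qed
    then have "emeasure M (nb m d \<inter> H) = emeasure M (K m \<inter> H)" using h(5)[OF dH KH] by simp
    also have "\<dots> \<le> emeasure M C" using emeasure_mono[OF m C(1)] .
    finally show ?thesis using C(2) by (rule le_less_trans)
  qed
  then have "\<forall>a\<in>?A. emeasure M a \<noteq> \<infinity>" by fastforce
  moreover have "countable ?A" using D(1) by auto
  moreover have "?A \<subseteq> sets M" using D(2) h(4) nb_sets_haar[OF M] by blast
  moreover have "\<Union> ?A = space M" using D(3)[of _ m] h(2) by blast
  ultimately show "\<exists>A. countable A \<and> A \<subseteq> sets M \<and> \<Union> A = space M \<and> (\<forall>a\<in>A. emeasure M a \<noteq> \<infinity>)"
    by blast
qed

lemma measurable_mult:
  assumes M: "haar H M" and f: "f \<in> measurable N M" and g: "g \<in> measurable N M"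
  shows "(\<lambda>x. f x \<otimes> g x) \<in> measurable N M"
proof -
  note h = haarD[OF M]
  have "(\<lambda>p. fst p \<otimes> snd p) \<in> measurable (M \<Otimes>\<^sub>M M) M"
  proof (rule measurable_pair_continuous[OF M M M])
    show "x \<otimes> y \<in> H" if "x \<in> H" "y \<in> H" for x y using subgroup.m_closed[OF h(1) that] .
    fix x y m assume "x \<in> H" "y \<in> H"
    then have "x \<in> carrier G" "y \<in> carrier G" using h(4) by blast+
    from mult_continuous[OF this, of m]
    show "\<exists>l. \<forall>a\<in>nb l x \<inter> H. \<forall>b\<in>nb l y \<inter> H. a \<otimes> b \<in> nb m (x \<otimes> y)" by blast
  qed
  from measurable_compose[OF measurable_Pair[OF f g] this] show ?thesis by simp
qed

lemma measurable_inv: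
  assumes M: "haar H M" and f: "f \<in> measurable N M"
  shows "(\<lambda>x. inv (f x)) \<in> measurable N M"
proof -
  note h = haarD[OF M]
  have "m_inv G \<in> measurable M M"
  proof (rule measurable_continuous[OF M M])
    show "inv x \<in> H" if "x \<in> H" for x using subgroup.m_inv_closed[OF h(1) that] .
    fix x m assume "x \<in> H"
    then have "x \<in> carrier G" using h(4) by blast
    from inv_continuous[OF this, of m]
    show "\<exists>l. \<forall>a\<in>nb l x \<inter> H. inv a \<in> nb m (inv x)" by blast
  qed
  from measurable_compose[OF f this] show ?thesis .
qed

lemma measurable_inclusion:
  assumes M1: "haar H1 M1" and M3: "haar H3 M3" and sub: "H1 \<subseteq> H3"
  shows "(\<lambda>x. x) \<in> measurable M1 M3"
proof (rule measurable_continuous[OF M1 M3])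
  fix x m assume "x \<in> H1"
  show "\<exists>l. \<forall>a\<in>nb l x \<inter> H1. a \<in> nb m x" by blast
qed (use sub in blast)

section \<open>Uniqueness of Haar measure by counting cosets\<close>

lemma index_K:
  shows "finite (nb m ` K 0)" "card (nb m ` K 0) > 0"
    and "haar (carrier G) M \<Longrightarrow> emeasure M (K 0) = of_nat (card (nb m ` K 0)) * emeasure M (K m)"
proof -
  obtain R where R: "finite R" "R \<subseteq> carrier G" "\<forall>k\<in>K 0. \<exists>r\<in>R. inv r \<otimes> k \<in> K m"
    using K_fin[of m] by blast
  have "nb m ` K 0 \<subseteq> nb m ` R"
  proof
    fix Y assume "Y \<in> nb m ` K 0"
    then obtain k where k: "k \<in> K 0" "Y = nb m k" by blast
    then obtain r where r: "r \<in> R" "inv r \<otimes> k \<in> K m" using R(3) by blast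
    have "k \<in> nb m r" using r K_mem[OF k(1)] by (simp add: nb_def)
    then have "Y = nb m r" using nb_eq[of r k m] r R(2) k by blast
    then show "Y \<in> nb m ` R" using r by blast
  qed
  then show fin: "finite (nb m ` K 0)" using R(1) by (meson finite_imageI finite_subset)
  have "K 0 \<noteq> {}" using subgroup.one_closed[OF K_sub[of 0]] by blast
  then show "card (nb m ` K 0) > 0" using fin by (simp add: card_gt_0_iff)
  assume M: "haar (carrier G) M"
  note h = haarD[OF M]
  have KM: "K m \<in> sets M" using nb_sets_haar[OF M, of \<one> m] nb_one[of m] K_carrier[of m] by (simp add: Int_absorb2)
  \<comment> \<open>Every coset inside \<open>K 0\<close> is a left translate of \<open>K m\<close>,
    so all the disjoint pieces have the same volume.\<close>
  have each: "nb m k \<in> sets M \<and> emeasure M (nb m k) = emeasure M (K m)" if k: "k \<in> K 0" for k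
    using nb_sets_haar[OF M K_mem[OF k], of m] nb_carrier[of m k] h(5)[OF K_mem[OF k] KM] nb_image[OF K_mem[OF k], of m]
    by (simp add: Int_absorb2)
  have U: "(\<Union>Y\<in>nb m ` K 0. Y) = K 0"
  proof
    show "(\<Union>Y\<in>nb m ` K 0. Y) \<subseteq> K 0"
    proof
      fix y assume "y \<in> (\<Union>Y\<in>nb m ` K 0. Y)"
      then obtain k where k: "k \<in> K 0" "y \<in> nb m k" by blast
      then have "y \<in> nb 0 k" using nb_anti[of 0 m k] by auto
      moreover have "nb 0 k = nb 0 \<one>" using nb_eq[of \<one> k 0] k(1) nb_one[of 0] by simp
      ultimately show "y \<in> K 0" using nb_one[of 0] by simp
    qed
    show "K 0 \<subseteq> (\<Union>Y\<in>nb m ` K 0. Y)" 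
    proof
      fix k assume k: "k \<in> K 0"
      then show "k \<in> (\<Union>Y\<in>nb m ` K 0. Y)" using nb_self[OF K_mem[OF k], of m] by blast
    qed
  qed
  have "(\<Sum>Y\<in>nb m ` K 0. emeasure M Y) = emeasure M (\<Union>Y\<in>nb m ` K 0. Y)"
  proof (rule sum_emeasure[OF _ _ fin])
    show "(\<lambda>Y. Y) ` (nb m ` K 0) \<subseteq> sets M" using each by blast
    show "disjoint_family_on (\<lambda>Y. Y) (nb m ` K 0)"
      unfolding disjoint_family_on_def
    proof (intro ballI impI)
      fix V Y assume "V \<in> nb m ` K 0" "Y \<in> nb m ` K 0" and ne: "V \<noteq> Y"
      then obtain a b where ab: "a \<in> K 0" "V = nb m a" "b \<in> K 0" "Y = nb m b" by blast
      show "V \<inter> Y = {}"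
      proof (rule ccontr)
        assume "V \<inter> Y \<noteq> {}"
        then obtain y where "y \<in> nb m a" "y \<in> nb m b" using ab by blast
        then have "nb m a = nb m b" using nb_eq[OF K_mem[OF ab(1)], of y m] nb_eq[OF K_mem[OF ab(3)], of y m] by simp
        then show False using ne ab by simp
      qed
    qed
  qed
  moreover have "(\<Sum>Y\<in>nb m ` K 0. emeasure M Y) = (\<Sum>Y\<in>nb m ` K 0. emeasure M (K m))"
    by (rule sum.cong) (use each in auto)
  ultimately show "emeasure M (K 0) = of_nat (card (nb m ` K 0)) * emeasure M (K m)"
    unfolding U by simp
qed

text \<open>An open set is the union of those cosets inside it that belong to the countable covers,
  so cosets generate the Borel sets. The empty set is added to make the generator stable under
  intersection.\<close>

lemma sigma_sets_nb:
  "sigma_sets (carrier G) {U \<inter> carrier G | U. gopen U} =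
   sigma_sets (carrier G) (insert {} {nb m g | m g. g \<in> carrier G})" (is "?L = sigma_sets _ ?E")
proof (rule sigma_sets_eqI)
  fix A assume "A \<in> {U \<inter> carrier G | U. gopen U}"
  then have A: "gopen A" unfolding gopen_def by (auto simp: Int_absorb2)
  obtain D where D: "\<forall>m. countable (D m) \<and> D m \<subseteq> carrier G \<and> (\<forall>g\<in>carrier G. \<exists>d\<in>D m. g \<in> nb m d)"
    by (rule exE[OF countable_cover[OF subset_refl]])
  let ?B = "{nb m d | m d. d \<in> D m \<and> nb m d \<subseteq> A}"
  have "?B \<subseteq> (\<Union>m. nb m ` D m)" by blast
  moreover have "countable (\<Union>m. nb m ` D m)" using D by simp
  ultimately have "countable ?B" by (rule countable_subset)
  moreover have "b \<in> sigma_sets (carrier G) ?E" if b: "b \<in> ?B" for b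
  proof -
    obtain m d where "b = nb m d" "d \<in> D m" using b by blast
    then have "b \<in> ?E" using D by blast
    then show ?thesis by (rule sigma_sets.Basic)
  qed
  ultimately have "\<Union>?B \<in> sigma_sets (carrier G) ?E" by (rule sigma_sets_UNION)
  moreover have "\<Union>?B = A"
  proof
    show "A \<subseteq> \<Union>?B"
    proof
      fix x assume x: "x \<in> A"
      then have xG: "x \<in> carrier G" using A unfolding gopen_def by blast
      obtain m where m: "nb m x \<subseteq> A" using A x unfolding gopen_def by blast
      have "\<exists>d\<in>D m. x \<in> nb m d" using D xG by blast
      then obtain d where d: "d \<in> D m" "x \<in> nb m d" by blast
      have dG: "d \<in> carrier G" using D d(1) by blast
      have "nb m x = nb m d" using nb_eq[OF dG d(2)] .
      then show "x \<in> \<Union>?B" using d m by blast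
    qed
  qed blast
  ultimately show "A \<in> sigma_sets (carrier G) ?E" by simp
next
  fix A assume A: "A \<in> ?E"
  show "A \<in> ?L"
  proof (cases "A = {}")
    case True then show ?thesis by (simp add: sigma_sets.Empty)
  next
    case False
    then obtain m g where mg: "A = nb m g" "g \<in> carrier G" using A by blast
    then have "A = nb m g \<inter> carrier G" using nb_carrier[of m g] by blast
    then show ?thesis using nb_open[OF mg(2), of m] by (intro sigma_sets.Basic) blast
  qed
qed

text \<open>Cosets are nested or disjoint, so they form an intersection-stable generator, and on
  \<open>K m\<close> both measures are determined by the index of \<open>K m\<close> in
  \<open>K 0\<close>. Finiteness of \<open>c\<close> provides the countable cover by sets of finite
  measure.\<close>

lemma haar_unique:
  assumes M: "haar (carrier G) M" "emeasure M (K 0) = 1"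
    and N: "haar (carrier G) N" "emeasure N (K 0) = c" "c \<noteq> \<infinity>"
  shows "N = scale_measure c M"
proof -
  let ?E = "insert {} {nb m g | m g. g \<in> carrier G}"
  note hM = haarD[OF M(1)] and hN = haarD[OF N(1)]
  have nbM: "emeasure L (nb m g) = emeasure L (K m)" if L: "haar (carrier G) L" and g: "g \<in> carrier G" for m g L
  proof -
    have "K m \<in> sets L" using nb_sets_haar[OF L, of \<one> m] nb_one[of m] K_carrier[of m] by (simp add: Int_absorb2)
    then show ?thesis using haarD(5)[OF L g] nb_image[OF g, of m] by simp
  qed
  have Km: "emeasure N (K m) = c * emeasure M (K m)" for m
  proof -
    let ?q = "of_nat (card (nb m ` K 0)) :: ennreal"
    have "?q * emeasure M (K m) = 1" "?q * emeasure N (K m) = c"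
      using index_K(3)[OF M(1), of m] index_K(3)[OF N(1), of m] M(2) N(2) by simp_all
    then have "?q * (c * emeasure M (K m)) = ?q * emeasure N (K m)"
      by (metis mult.left_commute mult.right_neutral)
    \<comment> \<open>The index is nonzero and finite, so it can be cancelled in
      \<open>ennreal\<close>.\<close>
    moreover have "?q \<noteq> 0" "?q \<noteq> \<infinity>" using index_K(2)[of m] by simp_all
    ultimately show ?thesis by (auto simp: ennreal_mult_cancel_left)
  qed
  obtain D where D: "\<forall>m. countable (D m) \<and> D m \<subseteq> carrier G \<and> (\<forall>g\<in>carrier G. \<exists>d\<in>D m. g \<in> nb m d)"
    by (rule exE[OF countable_cover[OF subset_refl]])
  show ?thesis
  proof (rule measure_eqI_generator_eq_countable)
    show "Int_stable ?E"
    proof (rule Int_stableI)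
      fix V Y assume VY: "V \<in> ?E" "Y \<in> ?E"
      show "V \<inter> Y \<in> ?E"
      proof (cases "V \<inter> Y = {}")
        case False
        then obtain y where y: "y \<in> V" "y \<in> Y" by blast
        obtain m a where a: "V = nb m a" "a \<in> carrier G" using VY y by blast
        obtain l b where b: "Y = nb l b" "b \<in> carrier G" using VY y by blast
        have yG: "y \<in> carrier G" using y a nb_carrier[of m a] by blast
        have V: "V = nb m y" and Y: "Y = nb l y" using y a b nb_eq[of a y m] nb_eq[of b y l] by auto
        show ?thesis
        proof (cases "m \<le> l")
          case True
          then have "V \<inter> Y = nb l y" using V Y nb_anti[of m l y] by blast
          then show ?thesis using yG by blast
        next
          case False
          then have "V \<inter> Y = nb m y" using V Y nb_anti[of l m y] by auto
          then show ?thesis using yG by blast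
        qed
      qed simp
    qed
    show "?E \<subseteq> Pow (carrier G)" using nb_carrier by auto
    show "sets N = sigma_sets (carrier G) ?E" using hN(3) sigma_sets_nb by simp
    show "sets (scale_measure c M) = sigma_sets (carrier G) ?E" using hM(3) sigma_sets_nb by simp
    show "emeasure N V = emeasure (scale_measure c M) V" if V: "V \<in> ?E" for V
    proof (cases "V = {}")
      case False
      then obtain m g where "V = nb m g" "g \<in> carrier G" using V by blast
      then show ?thesis using nbM[OF M(1)] nbM[OF N(1)] Km by simp
    qed simp
    show "nb 0 ` D 0 \<subseteq> ?E" using D by blast
    show "countable (nb 0 ` D 0)" using D by simp
    have "carrier G \<subseteq> \<Union> (nb 0 ` D 0)" using D by blast
    then show "\<Union> (nb 0 ` D 0) = carrier G" using nb_carrier[of 0] by blast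
    show "emeasure N V \<noteq> \<infinity>" if V: "V \<in> nb 0 ` D 0" for V
    proof -
      obtain d where d: "d \<in> D 0" "V = nb 0 d" using V by blast
      have "d \<in> carrier G" using D d(1) by blast
      then show ?thesis using nbM[OF N(1), of d 0] N(2,3) d(2) by simp
    qed
  qed
qed

section \<open>The modular function\<close>

definition modular :: "'g measure \<Rightarrow> 'g \<Rightarrow> ennreal" where
  "modular M h = emeasure M ((\<lambda>g. g \<otimes> h) ` K 0)"

lemma right_image:
  assumes h: "h \<in> carrier G" and A: "A \<subseteq> carrier G"
  shows "(\<lambda>g. g \<otimes> h) ` A = (\<lambda>g. g \<otimes> inv h) -` A \<inter> carrier G"
proof (intro subset_antisym subsetI)
  fix y assume "y \<in> (\<lambda>g. g \<otimes> h) ` A"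
  then obtain a where a: "a \<in> A" "y = a \<otimes> h" by blast
  then have "a \<in> carrier G" using A by blast
  then show "y \<in> (\<lambda>g. g \<otimes> inv h) -` A \<inter> carrier G" using a h by (simp add: m_assoc)
next
  fix y assume "y \<in> (\<lambda>g. g \<otimes> inv h) -` A \<inter> carrier G"
  then have y: "y \<otimes> inv h \<in> A" "y \<in> carrier G" by auto
  then have "y = (y \<otimes> inv h) \<otimes> h" using h by (simp add: m_assoc)
  then show "y \<in> (\<lambda>g. g \<otimes> h) ` A" using y(1) by blast
qed

lemma K0_sets: "haar (carrier G) M \<Longrightarrow> K 0 \<in> sets M"
  using nb_sets_haar[of "carrier G" M \<one> 0] nb_one[of 0] K_carrier[of 0] by (simp add: Int_absorb2)

lemma right_image_sets:
  assumes M: "haar (carrier G) M" and h: "h \<in> carrier G" and A: "A \<in> sets M"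
  shows "(\<lambda>g. g \<otimes> h) ` A \<in> sets M"
proof -
  have "A \<subseteq> carrier G" using sets.sets_into_space[OF A] haarD(2)[OF M] by simp
  from right_image[OF h this] show ?thesis
    using measurable_sets[OF measurable_right_mult[OF M inv_closed[OF h]] A] haarD(2)[OF M] by simp
qed

text \<open>\<open>K 0\<close> is covered by finitely many cosets r K_l; if conjugation by h^-1
  carries \<open>K l\<close> into \<open>K 0\<close>, then r K_l h lies in r h K_0, which has volume
  1. \<open>haar_unique\<close> requires its factor to be finite.\<close>

lemma modular_finite:
  assumes M: "haar (carrier G) M" "emeasure M (K 0) = 1" and h: "h \<in> carrier G"
  shows "modular M h \<noteq> \<infinity>"
proof -
  note hM = haarD[OF M(1)]
  obtain l where l: "\<forall>k\<in>K l. inv h \<otimes> k \<otimes> inv (inv h) \<in> K 0" using K_conj[OF inv_closed[OF h]] by blast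
  obtain R where R: "finite R" "R \<subseteq> carrier G" "\<forall>k\<in>K 0. \<exists>r\<in>R. inv r \<otimes> k \<in> K l"
    using K_fin[of l] by blast
  have rh: "nb 0 (r \<otimes> h) \<in> sets M \<and> emeasure M (nb 0 (r \<otimes> h)) = 1" if r: "r \<in> R" for r
  proof -
    have c: "r \<otimes> h \<in> carrier G" using r R(2) h by blast
    show ?thesis using nb_sets_haar[OF M(1) c, of 0] nb_carrier[of 0 "r \<otimes> h"] hM(5)[OF c K0_sets[OF M(1)]]
      nb_image[OF c, of 0] M(2) by (simp add: Int_absorb2)
  qed
  have sub: "(\<lambda>g. g \<otimes> h) ` K 0 \<subseteq> (\<Union>r\<in>R. nb 0 (r \<otimes> h))"
  proof
    fix y assume "y \<in> (\<lambda>g. g \<otimes> h) ` K 0"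
    then obtain k where k: "k \<in> K 0" "y = k \<otimes> h" by blast
    then obtain r where r: "r \<in> R" "inv r \<otimes> k \<in> K l" using R(3) by blast
    have c: "r \<in> carrier G" "k \<in> carrier G" using r R(2) K_mem[OF k(1)] by blast+
    have "inv (r \<otimes> h) \<otimes> y = inv h \<otimes> (inv r \<otimes> k) \<otimes> inv (inv h)"
      using c h k(2) by (simp add: inv_mult_group m_assoc)
    then have "y \<in> nb 0 (r \<otimes> h)" using l r(2) c h k(2) by (simp add: nb_def)
    then show "y \<in> (\<Union>r\<in>R. nb 0 (r \<otimes> h))" using r(1) by blast
  qed
  have "modular M h \<le> emeasure M (\<Union>r\<in>R. nb 0 (r \<otimes> h))"
    unfolding modular_def using rh R(1) by (intro emeasure_mono sub) blast
  also have "\<dots> \<le> (\<Sum>r\<in>R. emeasure M (nb 0 (r \<otimes> h)))"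
    using rh R(1) by (intro emeasure_subadditive_finite) auto
  also have "\<dots> = (\<Sum>r\<in>R. 1)" by (rule sum.cong) (use rh in auto)
  also have "\<dots> = of_nat (card R)" by simp
  also have "\<dots> < \<infinity>" using of_nat_less_top by simp
  finally show ?thesis by simp
qed

text \<open>Left and right translations commute, so the image of \<open>M\<close> under right
  translation by h^-1 is again left invariant. Uniqueness makes it a multiple of \<open>M\<close>,
  and evaluation on \<open>K 0\<close> identifies the factor.\<close>

lemma emeasure_right_image:
  assumes M: "haar (carrier G) M" "emeasure M (K 0) = 1" and h: "h \<in> carrier G" and A: "A \<in> sets M"
  shows "emeasure M ((\<lambda>g. g \<otimes> h) ` A) = modular M h * emeasure M A"
proof -
  note hM = haarD[OF M(1)]
  have me: "(\<lambda>g. g \<otimes> inv h) \<in> measurable M M" by (rule measurable_right_mult[OF M(1) inv_closed[OF h]])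
  let ?N = "distr M M (\<lambda>g. g \<otimes> inv h)"
  have N: "emeasure ?N B = emeasure M ((\<lambda>g. g \<otimes> h) ` B)" if B: "B \<in> sets M" for B
  proof -
    have "B \<subseteq> carrier G" using sets.sets_into_space[OF B] hM(2) by simp
    from right_image[OF h this] show ?thesis using emeasure_distr[OF me B] hM(2) by simp
  qed
  have "haar (carrier G) ?N"
    unfolding haar_def
  proof (intro conjI ballI)
    show "subgroup (carrier G) G" by (rule hM(1))
    show "space ?N = carrier G" "sets ?N = sigma_sets (carrier G) {U \<inter> carrier G | U. gopen U}" using hM(2,3) by simp_all
    fix g B assume g: "g \<in> carrier G" and "B \<in> sets ?N"
    then have B: "B \<in> sets M" by simp
    have Bc: "B \<subseteq> carrier G" using sets.sets_into_space[OF B] hM(2) by simp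
    have gB: "(\<lambda>h. g \<otimes> h) ` B \<in> sets M"
    proof -
      have "(\<lambda>h. g \<otimes> h) ` B = (\<lambda>h. inv g \<otimes> h) -` B \<inter> space M"
      proof (intro subset_antisym subsetI)
        fix y assume "y \<in> (\<lambda>h. g \<otimes> h) ` B"
        then obtain b where b: "b \<in> B" "y = g \<otimes> b" by blast
        then show "y \<in> (\<lambda>h. inv g \<otimes> h) -` B \<inter> space M"
          using Bc g hM(2) inv_mult_cancel_left[OF g, of b] by auto
      next
        fix y assume "y \<in> (\<lambda>h. inv g \<otimes> h) -` B \<inter> space M"
        then have y: "inv g \<otimes> y \<in> B" "y \<in> carrier G" using hM(2) by auto
        then have "y = g \<otimes> (inv g \<otimes> y)" using mult_inv_cancel_left[OF g, of y] by simp
        then show "y \<in> (\<lambda>h. g \<otimes> h) ` B" using y(1) by blast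
      qed
      then show ?thesis using measurable_sets[OF measurable_left_mult[OF M(1) M(1) inv_closed[OF g]] B] by simp
    qed
    have "(\<lambda>y. y \<otimes> h) ` ((\<lambda>h. g \<otimes> h) ` B) = (\<lambda>y. g \<otimes> y) ` ((\<lambda>y. y \<otimes> h) ` B)"
      unfolding image_image
    proof (rule image_cong)
      fix b assume "b \<in> B"
      then have "b \<in> carrier G" using Bc by blast
      then show "g \<otimes> b \<otimes> h = g \<otimes> (b \<otimes> h)" using g h by (simp add: m_assoc)
    qed simp
    then show "emeasure ?N ((\<lambda>h. g \<otimes> h) ` B) = emeasure ?N B"
      using N[OF gB] N[OF B] hM(5)[OF g right_image_sets[OF M(1) h B]] by simp
  qed
  moreover have "emeasure ?N (K 0) = modular M h" using N[OF K0_sets[OF M(1)]] by (simp add: modular_def)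
  ultimately have "?N = scale_measure (modular M h) M"
    using haar_unique[OF M _ _ modular_finite[OF M h]] by blast
  then show ?thesis using N[OF A] by simp
qed

lemma modular_mult:
  assumes M: "haar (carrier G) M" "emeasure M (K 0) = 1" and g: "g \<in> carrier G" and h: "h \<in> carrier G"
  shows "modular M (g \<otimes> h) = modular M g * modular M h"
proof -
  have "(\<lambda>k. k \<otimes> (g \<otimes> h)) ` K 0 = (\<lambda>y. y \<otimes> h) ` ((\<lambda>k. k \<otimes> g) ` K 0)"
    unfolding image_image
  proof (rule image_cong)
    fix k assume "k \<in> K 0"
    then have "k \<in> carrier G" by (rule K_mem)
    then show "k \<otimes> (g \<otimes> h) = k \<otimes> g \<otimes> h" using g h by (simp add: m_assoc)
  qed simp
  then show ?thesis
    using emeasure_right_image[OF M h right_image_sets[OF M(1) g K0_sets[OF M(1)]]]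
    by (simp add: modular_def mult.commute)
qed

lemma modular_K0:
  assumes M: "haar (carrier G) M" "emeasure M (K 0) = 1" and k: "k \<in> K 0"
  shows "modular M k = 1"
proof -
  have "(\<lambda>g. g \<otimes> k) ` K 0 = K 0"
  proof (intro subset_antisym subsetI)
    fix y assume "y \<in> (\<lambda>g. g \<otimes> k) ` K 0"
    then show "y \<in> K 0" using subgroup.m_closed[OF K_sub[of 0] _ k] by blast
  next
    fix y assume y: "y \<in> K 0"
    have "y = (y \<otimes> inv k) \<otimes> k" using K_mem[OF y] K_mem[OF k] by (simp add: m_assoc)
    moreover have "y \<otimes> inv k \<in> K 0" using subgroup.m_closed[OF K_sub[of 0] y subgroup.m_inv_closed[OF K_sub[of 0] k]] .
    ultimately show "y \<in> (\<lambda>g. g \<otimes> k) ` K 0" by blast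
  qed
  then show ?thesis using M(2) by (simp add: modular_def)
qed

text \<open>Right translation by a central element is left translation, which preserves
  volume.\<close>

lemma modular_central:
  assumes M: "haar (carrier G) M" "emeasure M (K 0) = 1" and z: "z \<in> carrier G"
    and c: "\<And>g. g \<in> carrier G \<Longrightarrow> g \<otimes> z = z \<otimes> g"
  shows "modular M z = 1"
proof -
  have "(\<lambda>g. g \<otimes> z) ` K 0 = (\<lambda>g. z \<otimes> g) ` K 0" using c K_mem by (intro image_cong) auto
  then show ?thesis using haarD(5)[OF M(1) z K0_sets[OF M(1)]] M(2) by (simp add: modular_def)
qed

lemma modular_inv:
  assumes M: "haar (carrier G) M" "emeasure M (K 0) = 1" and g: "g \<in> carrier G"
  shows "modular M g * modular M (inv g) = 1"
  using modular_mult[OF M g inv_closed[OF g]] modular_K0[OF M subgroup.one_closed[OF K_sub]] g by simp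

text \<open>The values commute, so the factors of g and of its inverse cancel; triviality can
  therefore be tested on any conjugate.\<close>

lemma modular_conj:
  assumes M: "haar (carrier G) M" "emeasure M (K 0) = 1" and g: "g \<in> carrier G" and u: "u \<in> carrier G"
  shows "modular M (g \<otimes> u \<otimes> inv g) = modular M u"
proof -
  have "modular M (g \<otimes> u \<otimes> inv g) = modular M u * (modular M g * modular M (inv g))"
    using modular_mult[OF M m_closed[OF g u] inv_closed[OF g]] modular_mult[OF M g u] by (simp add: ac_simps)
  then show ?thesis using modular_inv[OF M g] by simp
qed

lemma nn_integral_right_mult:
  assumes M: "haar (carrier G) M" "emeasure M (K 0) = 1" and g: "g \<in> carrier G"
    and u: "modular M (inv g) = 1" and f: "f \<in> borel_measurable M"
  shows "(\<integral>\<^sup>+h. f (h \<otimes> g) \<partial>M) = (\<integral>\<^sup>+h. f h \<partial>M)"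
proof -
  note h = haarD[OF M(1)]
  have me: "(\<lambda>h. h \<otimes> g) \<in> measurable M M" using measurable_right_mult[OF M(1) g] .
  have d: "distr M M (\<lambda>h. h \<otimes> g) = M"
  proof (rule measure_eqI)
    fix A assume "A \<in> sets (distr M M (\<lambda>h. h \<otimes> g))"
    then have A: "A \<in> sets M" by simp
    have AH: "A \<subseteq> carrier G" using sets.sets_into_space[OF A] h(2) by simp
    have "(\<lambda>h. h \<otimes> g) -` A \<inter> space M = (\<lambda>h. h \<otimes> inv g) ` A"
      using right_image[OF inv_closed[OF g] AH] h(2) g by simp
    then show "emeasure (distr M M (\<lambda>h. h \<otimes> g)) A = emeasure M A"
      using emeasure_distr[OF me A] emeasure_right_image[OF M inv_closed[OF g] A] u by simp
  qed simp
  show ?thesis using nn_integral_distr[OF me, of f] f unfolding d by simp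
qed

text \<open>On the fibre over g the cut-off I is dominated by finitely many translates of the function
  h \<mapsto> \<integral> 1_C (h z) dz, each of which integrates to 1 against U.\<close>

lemma averaging_bound:
  fixes I U W F :: "'g \<Rightarrow> ennreal"
  assumes MG: "haar (carrier G) MG" "sigma_finite_measure MG"
    and MH: "haar H MH" "sigma_finite_measure MH"
    and MZ: "haar Z MZ" "sigma_finite_measure MZ"
    and right: "\<And>h f. h \<in> H \<Longrightarrow> f \<in> borel_measurable MG \<Longrightarrow> (\<integral>\<^sup>+g. f (g \<otimes> h) \<partial>MG) = (\<integral>\<^sup>+g. f g \<partial>MG)"
    and comm: "\<And>a b. a \<in> H \<Longrightarrow> b \<in> H \<Longrightarrow> a \<otimes> b = b \<otimes> a" and ZH: "Z \<subseteq> H"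
    and I: "I \<in> borel_measurable MG" "\<And>g. I g \<le> 1"
    and U: "U \<in> borel_measurable MG" "\<And>g. g \<in> carrier G \<Longrightarrow> (\<integral>\<^sup>+z. U (g \<otimes> z) \<partial>MZ) = 1"
    and W: "W \<in> borel_measurable MG" "\<And>g. g \<in> carrier G \<Longrightarrow> (\<integral>\<^sup>+h. W (g \<otimes> h) \<partial>MH) = 1"
    and F: "F \<in> borel_measurable MG" "\<And>g h. g \<in> carrier G \<Longrightarrow> h \<in> H \<Longrightarrow> F (g \<otimes> h) = F g"
    and C: "C \<in> sets MH" "emeasure MH C = 1"
    and Z0: "Z0 \<in> sets MZ" "emeasure MZ Z0 = 1" "\<And>c z. c \<in> C \<Longrightarrow> z \<in> Z0 \<Longrightarrow> c \<otimes> z \<in> C"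
    and cover: "\<And>g. g \<in> carrier G \<Longrightarrow> \<exists>T. finite T \<and> T \<subseteq> H \<and> card T \<le> N \<and>
       (\<forall>h\<in>H. I (g \<otimes> inv h) \<noteq> 0 \<longrightarrow> (\<exists>t\<in>T. \<exists>z\<in>Z. \<exists>c\<in>C. h = z \<otimes> c \<otimes> t))"
  shows "(\<integral>\<^sup>+g. I g * U g * F g \<partial>MG) \<le> of_nat N * (\<integral>\<^sup>+g. W g * F g \<partial>MG)"
proof -
  note hG = haarD[OF MG(1)] and hH = haarD[OF MH(1)] and hZ = haarD[OF MZ(1)]
  interpret GH: pair_sigma_finite MG MH using MG(2) MH(2) by (simp add: pair_sigma_finite_def)
  interpret ZHp: pair_sigma_finite MZ MH using MZ(2) MH(2) by (simp add: pair_sigma_finite_def)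
  have HG: "h \<in> carrier G" if "h \<in> H" for h using that hH(4) by blast
  have ZinH: "z \<in> H" if "z \<in> Z" for z using that ZH by blast
  have Hm: "a \<otimes> b \<in> H" if "a \<in> H" "b \<in> H" for a b using subgroup.m_closed[OF hH(1) that] .
  have Hi: "inv a \<in> H" if "a \<in> H" for a using subgroup.m_inv_closed[OF hH(1) that] .
  have incHG: "(\<lambda>x. x) \<in> measurable MH MG" by (rule measurable_inclusion[OF MH(1) MG(1) hH(4)])
  have incZH: "(\<lambda>x. x) \<in> measurable MZ MH" by (rule measurable_inclusion[OF MZ(1) MH(1) ZH])
  let ?k = "indicator C :: 'g \<Rightarrow> ennreal"
  have k: "?k \<in> borel_measurable MH" using C(1) by simp
  have gc: "(\<lambda>_. g) \<in> measurable L MG" if "g \<in> carrier G" for g and L :: "'x measure"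
    using that hG(2) by simp
  have hc: "(\<lambda>_. g) \<in> measurable L MH" if "g \<in> H" for g and L :: "'x measure"
    using that hH(2) by simp
  \<comment> \<open>Each translated fibre function has total weight exactly 1: swap the integrals,
    absorb t^-1 z by invariance on \<open>H\<close>, swap back and integrate \<open>U\<close> over a
    coset of \<open>Z\<close>. What remains is the volume of \<open>C\<close>.\<close>
  have inner: "(\<integral>\<^sup>+h. (\<integral>\<^sup>+z. ?k (h \<otimes> inv t \<otimes> z) \<partial>MZ) * U (g \<otimes> inv h) \<partial>MH) = 1"
    if g: "g \<in> carrier G" and t: "t \<in> H" for g t
  proof -
    have it: "inv t \<in> H" using Hi[OF t] .
    have m1: "(\<lambda>p. ?k (snd p \<otimes> inv t \<otimes> fst p)) \<in> borel_measurable (MZ \<Otimes>\<^sub>M MH)"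
      by (rule measurable_compose[OF _ k], intro measurable_mult[OF MH(1)] measurable_snd hc it
        measurable_compose[OF measurable_fst incZH])
    have m2: "(\<lambda>h. U (g \<otimes> inv h)) \<in> borel_measurable MH"
      by (rule measurable_compose[OF _ U(1)], intro measurable_mult[OF MG(1)] gc g measurable_inv[OF MG(1)] incHG)
    have m3: "(\<lambda>p. ?k (snd p) * U (g \<otimes> (inv t \<otimes> fst p) \<otimes> inv (snd p))) \<in> borel_measurable (MZ \<Otimes>\<^sub>M MH)"
    proof (intro borel_measurable_times_ennreal)
      show "(\<lambda>p. ?k (snd p)) \<in> borel_measurable (MZ \<Otimes>\<^sub>M MH)" by (rule measurable_compose[OF measurable_snd k])
      show "(\<lambda>p. U (g \<otimes> (inv t \<otimes> fst p) \<otimes> inv (snd p))) \<in> borel_measurable (MZ \<Otimes>\<^sub>M MH)"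
        by (rule measurable_compose[OF _ U(1)], intro measurable_mult[OF MG(1)] gc g measurable_inv[OF MG(1)]
          HG it measurable_compose[OF measurable_snd incHG]
          measurable_compose[OF measurable_compose[OF measurable_fst incZH] incHG])
    qed
    have m4: "(\<lambda>h. ?k h * U (g \<otimes> s \<otimes> inv h)) \<in> borel_measurable MH" if s: "s \<in> H" for s
      by (intro borel_measurable_times_ennreal k, rule measurable_compose[OF _ U(1)],
        intro measurable_mult[OF MG(1)] gc g measurable_inv[OF MG(1)] incHG HG s)
    have m5: "(\<lambda>z. ?k (h \<otimes> inv t \<otimes> z)) \<in> borel_measurable MZ" if h: "h \<in> H" for h
      by (rule measurable_compose[OF _ k], intro measurable_mult[OF MH(1)] hc Hm h it incZH)
    have m6: "(\<lambda>z. U (g \<otimes> z)) \<in> borel_measurable MZ" if g: "g \<in> carrier G" for g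
      by (rule measurable_compose[OF _ U(1)], intro measurable_mult[OF MG(1)] gc g measurable_compose[OF incZH incHG])
    have "(\<integral>\<^sup>+h. (\<integral>\<^sup>+z. ?k (h \<otimes> inv t \<otimes> z) \<partial>MZ) * U (g \<otimes> inv h) \<partial>MH)
        = (\<integral>\<^sup>+h. (\<integral>\<^sup>+z. ?k (h \<otimes> inv t \<otimes> z) * U (g \<otimes> inv h) \<partial>MZ) \<partial>MH)"
      using nn_integral_multc[OF m5] by (intro nn_integral_cong) (simp add: hH(2))
    also have "\<dots> = (\<integral>\<^sup>+z. (\<integral>\<^sup>+h. ?k (h \<otimes> inv t \<otimes> z) * U (g \<otimes> inv h) \<partial>MH) \<partial>MZ)"
    proof (rule ZHp.Fubini')
      have "(\<lambda>p. ?k (snd p \<otimes> inv t \<otimes> fst p) * U (g \<otimes> inv (snd p))) \<in> borel_measurable (MZ \<Otimes>\<^sub>M MH)"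
        by (intro borel_measurable_times_ennreal m1 measurable_compose[OF measurable_snd m2])
      then show "(\<lambda>(z, h). ?k (h \<otimes> inv t \<otimes> z) * U (g \<otimes> inv h)) \<in> borel_measurable (MZ \<Otimes>\<^sub>M MH)"
        by (simp add: case_prod_unfold)
    qed
    also have "\<dots> = (\<integral>\<^sup>+z. (\<integral>\<^sup>+h. ?k h * U (g \<otimes> (inv t \<otimes> z) \<otimes> inv h) \<partial>MH) \<partial>MZ)"
    proof (rule nn_integral_cong)
      fix z assume "z \<in> space MZ"
      then have z: "z \<in> H" using hZ(2) ZinH by simp
      \<comment> \<open>Commutativity of \<open>H\<close> turns the right factor t^-1 z into a left
        translation by \<open>s\<close>, to which left invariance of \<open>MH\<close>
        applies.\<close>
      define s where "s = inv t \<otimes> z"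
      have s: "s \<in> H" unfolding s_def using Hm it z by blast
      have "(\<integral>\<^sup>+h. ?k (h \<otimes> inv t \<otimes> z) * U (g \<otimes> inv h) \<partial>MH) = (\<integral>\<^sup>+h. ?k (s \<otimes> h) * U (g \<otimes> s \<otimes> inv (s \<otimes> h)) \<partial>MH)"
      proof (rule nn_integral_cong)
        fix h assume "h \<in> space MH"
        then have h: "h \<in> H" using hH(2) by simp
        have "h \<otimes> inv t \<otimes> z = s \<otimes> h"
          using comm[OF h s] HG[OF h] HG[OF it] HG[OF z] unfolding s_def by (simp add: m_assoc)
        moreover have "s \<otimes> inv (s \<otimes> h) = inv h"
        proof -
          have "s \<otimes> inv (s \<otimes> h) = s \<otimes> inv (h \<otimes> s)" using comm[OF h s] by simp
          also have "\<dots> = inv h" using HG[OF h] HG[OF s] mult_inv_cancel_left[of s "inv h"] by (simp add: inv_mult_group)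
          finally show ?thesis .
        qed
        then have "g \<otimes> s \<otimes> inv (s \<otimes> h) = g \<otimes> inv h" using g HG[OF s] HG[OF h] by (simp add: m_assoc)
        ultimately show "?k (h \<otimes> inv t \<otimes> z) * U (g \<otimes> inv h) = ?k (s \<otimes> h) * U (g \<otimes> s \<otimes> inv (s \<otimes> h))" by simp
      qed
      also have "\<dots> = (\<integral>\<^sup>+h. ?k h * U (g \<otimes> s \<otimes> inv h) \<partial>MH)"
        by (rule nn_integral_left_mult[OF MH(1) s m4[OF s]])
      finally show "(\<integral>\<^sup>+h. ?k (h \<otimes> inv t \<otimes> z) * U (g \<otimes> inv h) \<partial>MH) = (\<integral>\<^sup>+h. ?k h * U (g \<otimes> (inv t \<otimes> z) \<otimes> inv h) \<partial>MH)"
        unfolding s_def .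
    qed
    also have "\<dots> = (\<integral>\<^sup>+h. (\<integral>\<^sup>+z. ?k h * U (g \<otimes> (inv t \<otimes> z) \<otimes> inv h) \<partial>MZ) \<partial>MH)"
      by (rule ZHp.Fubini'[symmetric]) (use m3 in \<open>simp add: case_prod_unfold\<close>)
    also have "\<dots> = (\<integral>\<^sup>+h. ?k h \<partial>MH)"
    proof (rule nn_integral_cong)
      fix h assume "h \<in> space MH"
      then have h: "h \<in> H" using hH(2) by simp
      have ih: "inv h \<in> H" using Hi[OF h] .
      \<comment> \<open>Moving z past h^-1 puts the integration variable at the right end, where the
        fibre condition on \<open>U\<close> applies.\<close>
      define g' where "g' = g \<otimes> (inv t \<otimes> inv h)"
      have g': "g' \<in> carrier G" unfolding g'_def using g HG it ih by simp
      have "(\<integral>\<^sup>+z. ?k h * U (g \<otimes> (inv t \<otimes> z) \<otimes> inv h) \<partial>MZ) = (\<integral>\<^sup>+z. ?k h * U (g' \<otimes> z) \<partial>MZ)"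
      proof (rule nn_integral_cong)
        fix z assume "z \<in> space MZ"
        then have z: "z \<in> H" using hZ(2) ZinH by simp
        have "g \<otimes> (inv t \<otimes> z) \<otimes> inv h = g' \<otimes> z"
          using comm[OF z ih] g HG[OF it] HG[OF ih] HG[OF z] unfolding g'_def by (simp add: m_assoc)
        then show "?k h * U (g \<otimes> (inv t \<otimes> z) \<otimes> inv h) = ?k h * U (g' \<otimes> z)" by simp
      qed
      also have "\<dots> = ?k h * (\<integral>\<^sup>+z. U (g' \<otimes> z) \<partial>MZ)" by (rule nn_integral_cmult[OF m6[OF g']])
      finally show "(\<integral>\<^sup>+z. ?k h * U (g \<otimes> (inv t \<otimes> z) \<otimes> inv h) \<partial>MZ) = ?k h" using U(2)[OF g'] by simp
    qed
    also have "\<dots> = 1" using C by simp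
    finally show ?thesis .
  qed
  have fibre: "(\<integral>\<^sup>+h. I (g \<otimes> inv h) * U (g \<otimes> inv h) \<partial>MH) \<le> of_nat N" if g: "g \<in> carrier G" for g
  proof -
    obtain T where T: "finite T" "T \<subseteq> H" "card T \<le> N"
      "\<forall>h\<in>H. I (g \<otimes> inv h) \<noteq> 0 \<longrightarrow> (\<exists>t\<in>T. \<exists>z\<in>Z. \<exists>c\<in>C. h = z \<otimes> c \<otimes> t)" using cover[OF g] by blast
    let ?P = "\<lambda>t h. (\<integral>\<^sup>+z. ?k (h \<otimes> inv t \<otimes> z) \<partial>MZ)"
    have m5: "(\<lambda>z. ?k (h \<otimes> inv t \<otimes> z)) \<in> borel_measurable MZ" if h: "h \<in> H" and t: "t \<in> H" for h t
      by (rule measurable_compose[OF _ k], intro measurable_mult[OF MH(1)] hc Hm h Hi t incZH)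
    have m2: "(\<lambda>h. U (g \<otimes> inv h)) \<in> borel_measurable MH"
      by (rule measurable_compose[OF _ U(1)], intro measurable_mult[OF MG(1)] gc g measurable_inv[OF MG(1)] incHG)
    have mP: "(\<lambda>h. ?P t h * U (g \<otimes> inv h)) \<in> borel_measurable MH" if t: "t \<in> T" for t
    proof -
      have it: "inv t \<in> H" using Hi t T(2) by blast
      have "(\<lambda>p. ?k (fst p \<otimes> inv t \<otimes> snd p)) \<in> borel_measurable (MH \<Otimes>\<^sub>M MZ)"
        by (rule measurable_compose[OF _ k], intro measurable_mult[OF MH(1)] measurable_fst hc it
          measurable_compose[OF measurable_snd incZH])
      then have "(\<lambda>h. ?P t h) \<in> borel_measurable MH"
        by (intro ZHp.M1.borel_measurable_nn_integral) (simp add: case_prod_unfold)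
      then show ?thesis using m2 by (intro borel_measurable_times_ennreal)
    qed
    have "(\<integral>\<^sup>+h. I (g \<otimes> inv h) * U (g \<otimes> inv h) \<partial>MH) \<le> (\<integral>\<^sup>+h. (\<Sum>t\<in>T. ?P t h * U (g \<otimes> inv h)) \<partial>MH)"
    proof (rule nn_integral_mono)
      fix h assume "h \<in> space MH"
      then have h: "h \<in> H" using hH(2) by simp
      show "I (g \<otimes> inv h) * U (g \<otimes> inv h) \<le> (\<Sum>t\<in>T. ?P t h * U (g \<otimes> inv h))"
      proof (cases "I (g \<otimes> inv h) = 0")
        case False
        then obtain t z c where tzc: "t \<in> T" "z \<in> Z" "c \<in> C" "h = z \<otimes> c \<otimes> t" using T(4) h by blast
        have tH: "t \<in> H" using T(2) tzc(1) by blast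
        have cH: "c \<in> H" using sets.sets_into_space[OF C(1)] tzc(3) hH(2) by blast
        have zH: "z \<in> H" using ZinH[OF tzc(2)] .
        have iz: "inv z \<in> Z" using subgroup.m_inv_closed[OF hZ(1) tzc(2)] .
        \<comment> \<open>Shifting the \<open>Z\<close>-variable by z^-1 turns h t^-1 = z c into c
          z', which stays in \<open>C\<close> for z' in \<open>Z0\<close>. Hence the fibre function
          is at least the volume of \<open>Z0\<close>, namely 1, wherever the cut-off is
          nonzero.\<close>
        have "1 = (\<integral>\<^sup>+z'. indicator Z0 z' \<partial>MZ)" using Z0(1,2) by simp
        also have "\<dots> \<le> (\<integral>\<^sup>+z'. ?k (h \<otimes> inv t \<otimes> (inv z \<otimes> z')) \<partial>MZ)"
        proof (rule nn_integral_mono)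
          fix z' assume "z' \<in> space MZ"
          then have z': "z' \<in> H" using hZ(2) ZinH by simp
          have "h \<otimes> inv t = z \<otimes> c" using tzc(4) HG tH cH zH by (simp add: m_assoc)
          then have "h \<otimes> inv t \<otimes> (inv z \<otimes> z') = c \<otimes> z'"
            using comm[OF zH cH] HG tH cH zH z' mult_inv_cancel_left[of z z'] by (simp add: m_assoc)
          then show "indicator Z0 z' \<le> ?k (h \<otimes> inv t \<otimes> (inv z \<otimes> z'))"
            using Z0(3)[OF tzc(3)] by (auto simp: indicator_def)
        qed
        also have "\<dots> = ?P t h" by (rule nn_integral_left_mult[OF MZ(1) iz m5[OF h tH]])
        finally have "I (g \<otimes> inv h) \<le> ?P t h" using I(2)[of "g \<otimes> inv h"] by (rule order_trans[rotated])
        then have "I (g \<otimes> inv h) * U (g \<otimes> inv h) \<le> ?P t h * U (g \<otimes> inv h)" by (rule mult_right_mono) simp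
        also have "\<dots> \<le> (\<Sum>t\<in>T. ?P t h * U (g \<otimes> inv h))"
          using member_le_sum[of t T "\<lambda>t. ?P t h * U (g \<otimes> inv h)"] tzc(1) T(1) by simp
        finally show ?thesis .
      qed simp
    qed
    also have "\<dots> = (\<Sum>t\<in>T. (\<integral>\<^sup>+h. ?P t h * U (g \<otimes> inv h) \<partial>MH))" by (rule nn_integral_sum[OF mP])
    also have "\<dots> = (\<Sum>t\<in>T. 1)"
    proof (rule sum.cong)
      fix t assume "t \<in> T"
      then have "t \<in> H" using T(2) by blast
      then show "(\<integral>\<^sup>+h. ?P t h * U (g \<otimes> inv h) \<partial>MH) = 1" by (rule inner[OF g])
    qed simp
    also have "\<dots> \<le> of_nat N" using T(3) by simp
    finally show ?thesis .
  qed
  have mg: "(\<lambda>p. fst p) \<in> measurable (MG \<Otimes>\<^sub>M MH) MG" by simp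
  have mh: "(\<lambda>p. snd p) \<in> measurable (MG \<Otimes>\<^sub>M MH) MG" by (rule measurable_compose[OF measurable_snd incHG])
  \<comment> \<open>Insert 1 as the integral of \<open>W\<close> over the coset g H.\<close>
  have "(\<integral>\<^sup>+g. I g * U g * F g \<partial>MG) = (\<integral>\<^sup>+g. (\<integral>\<^sup>+h. I g * U g * F g * W (g \<otimes> h) \<partial>MH) \<partial>MG)"
  proof (rule nn_integral_cong)
    fix g assume "g \<in> space MG"
    then have g: "g \<in> carrier G" using hG(2) by simp
    have "(\<lambda>h. W (g \<otimes> h)) \<in> borel_measurable MH"
      by (rule measurable_compose[OF measurable_left_mult[OF MH(1) MG(1) g] W(1)])
    from nn_integral_cmult[OF this, of "I g * U g * F g"]
    show "I g * U g * F g = (\<integral>\<^sup>+h. I g * U g * F g * W (g \<otimes> h) \<partial>MH)" using W(2)[OF g] by simp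
  qed
  also have "\<dots> = (\<integral>\<^sup>+h. (\<integral>\<^sup>+g. I g * U g * F g * W (g \<otimes> h) \<partial>MG) \<partial>MH)"
  proof (rule GH.Fubini'[symmetric])
    have "(\<lambda>p. I (fst p) * U (fst p) * F (fst p) * W (fst p \<otimes> snd p)) \<in> borel_measurable (MG \<Otimes>\<^sub>M MH)"
      by (intro borel_measurable_times_ennreal measurable_compose[OF mg I(1)] measurable_compose[OF mg U(1)]
        measurable_compose[OF mg F(1)] measurable_compose[OF measurable_mult[OF MG(1) mg mh] W(1)])
    then show "(\<lambda>(g, h). I g * U g * F g * W (g \<otimes> h)) \<in> borel_measurable (MG \<Otimes>\<^sub>M MH)"
      by (simp add: case_prod_unfold)
  qed
  \<comment> \<open>Replace g by g h^-1 in the inner integral: unimodularity enters here through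
    \<open>right\<close>, and \<open>F\<close> does not change along \<open>H\<close>.\<close>
  also have "\<dots> = (\<integral>\<^sup>+h. (\<integral>\<^sup>+g. I (g \<otimes> inv h) * U (g \<otimes> inv h) * F g * W g \<partial>MG) \<partial>MH)"
  proof (rule nn_integral_cong)
    fix h assume "h \<in> space MH"
    then have h: "h \<in> H" using hH(2) by simp
    have ih: "inv h \<in> carrier G" using HG[OF Hi[OF h]] .
    have r: "(\<lambda>g. g \<otimes> inv h) \<in> measurable MG MG" by (rule measurable_right_mult[OF MG(1) ih])
    have "(\<integral>\<^sup>+g. I g * U g * F g * W (g \<otimes> h) \<partial>MG) =
        (\<integral>\<^sup>+g. I (g \<otimes> h \<otimes> inv h) * U (g \<otimes> h \<otimes> inv h) * F (g \<otimes> h) * W (g \<otimes> h) \<partial>MG)"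
    proof (rule nn_integral_cong)
      fix g assume "g \<in> space MG"
      then have g: "g \<in> carrier G" using hG(2) by simp
      then have "g \<otimes> h \<otimes> inv h = g" using HG[OF h] by (simp add: m_assoc)
      then show "I g * U g * F g * W (g \<otimes> h) = I (g \<otimes> h \<otimes> inv h) * U (g \<otimes> h \<otimes> inv h) * F (g \<otimes> h) * W (g \<otimes> h)"
        using F(2)[OF g h] by simp
    qed
    also have "\<dots> = (\<integral>\<^sup>+g. I (g \<otimes> inv h) * U (g \<otimes> inv h) * F g * W g \<partial>MG)"
      by (rule right[OF h, of "\<lambda>g. I (g \<otimes> inv h) * U (g \<otimes> inv h) * F g * W g"])
        (intro borel_measurable_times_ennreal measurable_compose[OF r I(1)] measurable_compose[OF r U(1)] F(1) W(1))
    finally show "(\<integral>\<^sup>+g. I g * U g * F g * W (g \<otimes> h) \<partial>MG) =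
        (\<integral>\<^sup>+g. I (g \<otimes> inv h) * U (g \<otimes> inv h) * F g * W g \<partial>MG)" .
  qed
  also have "\<dots> = (\<integral>\<^sup>+g. (\<integral>\<^sup>+h. I (g \<otimes> inv h) * U (g \<otimes> inv h) * F g * W g \<partial>MH) \<partial>MG)"
  proof (rule GH.Fubini')
    have d: "(\<lambda>p. fst p \<otimes> inv (snd p)) \<in> measurable (MG \<Otimes>\<^sub>M MH) MG"
      by (intro measurable_mult[OF MG(1)] mg measurable_inv[OF MG(1)] mh)
    have "(\<lambda>p. I (fst p \<otimes> inv (snd p)) * U (fst p \<otimes> inv (snd p)) * F (fst p) * W (fst p)) \<in> borel_measurable (MG \<Otimes>\<^sub>M MH)"
      by (intro borel_measurable_times_ennreal measurable_compose[OF d I(1)] measurable_compose[OF d U(1)]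
        measurable_compose[OF mg F(1)] measurable_compose[OF mg W(1)])
    then show "(\<lambda>(g, h). I (g \<otimes> inv h) * U (g \<otimes> inv h) * F g * W g) \<in> borel_measurable (MG \<Otimes>\<^sub>M MH)"
      by (simp add: case_prod_unfold)
  qed
  also have "\<dots> \<le> (\<integral>\<^sup>+g. of_nat N * (W g * F g) \<partial>MG)"
  proof (rule nn_integral_mono)
    fix g assume "g \<in> space MG"
    then have g: "g \<in> carrier G" using hG(2) by simp
    have d: "(\<lambda>h. g \<otimes> inv h) \<in> measurable MH MG"
      by (intro measurable_mult[OF MG(1)] gc g measurable_inv[OF MG(1)] incHG)
    have "(\<integral>\<^sup>+h. I (g \<otimes> inv h) * U (g \<otimes> inv h) * F g * W g \<partial>MH) =
        (\<integral>\<^sup>+h. (I (g \<otimes> inv h) * U (g \<otimes> inv h)) * (W g * F g) \<partial>MH)" by (simp add: ac_simps)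
    also have "\<dots> = (\<integral>\<^sup>+h. I (g \<otimes> inv h) * U (g \<otimes> inv h) \<partial>MH) * (W g * F g)"
      by (intro nn_integral_multc borel_measurable_times_ennreal measurable_compose[OF d I(1)] measurable_compose[OF d U(1)])
    also have "\<dots> \<le> of_nat N * (W g * F g)" using fibre[OF g] by (rule mult_right_mono) simp
    finally show "(\<integral>\<^sup>+h. I (g \<otimes> inv h) * U (g \<otimes> inv h) * F g * W g \<partial>MH) \<le> of_nat N * (W g * F g)" .
  qed
  also have "\<dots> = of_nat N * (\<integral>\<^sup>+g. W g * F g \<partial>MG)"
    by (intro nn_integral_cmult borel_measurable_times_ennreal W(1) F(1))
  finally show ?thesis .
qed

end

section \<open>Extension of the valuation to the algebraic closure\<close>

locale local_field =
  fixes v :: "'a::field \<Rightarrow> int"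
  assumes local_field: "nonarch_local_field v"
begin

lemma v_mult: "x \<noteq> 0 \<Longrightarrow> y \<noteq> 0 \<Longrightarrow> v (x * y) = v x + v y"
  and v_add: "x \<noteq> 0 \<Longrightarrow> y \<noteq> 0 \<Longrightarrow> x + y \<noteq> 0 \<Longrightarrow> v (x + y) \<ge> min (v x) (v y)"
  and uniformizer: "\<exists>p. p \<noteq> 0 \<and> v p = 1"
  and residues: "\<exists>R. finite R \<and> (\<forall>x. vge v x 0 \<longrightarrow> (\<exists>r\<in>R. vge v r 0 \<and> vge v (x - r) 1))"
  and complete: "(\<forall>k. \<exists>N::nat. \<forall>p\<ge>N. \<forall>q\<ge>N. vge v (s p - s q) k) \<Longrightarrow> \<exists>l. \<forall>k. \<exists>N. \<forall>p\<ge>N. vge v (s p - l) k"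
proof -
  note lf = local_field[unfolded nonarch_local_field_def]
  show "x \<noteq> 0 \<Longrightarrow> y \<noteq> 0 \<Longrightarrow> v (x * y) = v x + v y" using conjunct1[OF lf] by simp
  show "x \<noteq> 0 \<Longrightarrow> y \<noteq> 0 \<Longrightarrow> x + y \<noteq> 0 \<Longrightarrow> v (x + y) \<ge> min (v x) (v y)"
    using conjunct1[OF conjunct2[OF lf]] by simp
  show "\<exists>p. p \<noteq> 0 \<and> v p = 1" using conjunct1[OF conjunct2[OF conjunct2[OF lf]]] .
  show "\<exists>R. finite R \<and> (\<forall>x. vge v x 0 \<longrightarrow> (\<exists>r\<in>R. vge v r 0 \<and> vge v (x - r) 1))"
    using conjunct1[OF conjunct2[OF conjunct2[OF conjunct2[OF lf]]]] .
  assume "\<forall>k. \<exists>N. \<forall>p\<ge>N. \<forall>q\<ge>N. vge v (s p - s q) k"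
  then show "\<exists>l. \<forall>k. \<exists>N. \<forall>p\<ge>N. vge v (s p - l) k"
    by (rule mp[OF spec[OF conjunct2[OF conjunct2[OF conjunct2[OF conjunct2[OF lf]]]]]])
qed

lemma v_1 [simp]: "v 1 = 0"
  using v_mult[of 1 1] by simp

lemma v_m1 [simp]: "v (-1) = 0"
  using v_mult[of "-1" "-1"] by simp

lemma v_minus [simp]: "x \<noteq> 0 \<Longrightarrow> v (-x) = v x"
  using v_mult[of "-1" x] by simp

lemma v_inverse: "x \<noteq> 0 \<Longrightarrow> v (inverse x) = - v x"
  using v_mult[of x "inverse x"] by simp

lemma v_power: "x \<noteq> 0 \<Longrightarrow> v (x ^ k) = int k * v x"
  by (induction k) (auto simp: v_mult algebra_simps)

lemma vge_0 [simp]: "vge v 0 k" by (simp add: vge_def)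

lemma vge_mono: "vge v x k \<Longrightarrow> l \<le> k \<Longrightarrow> vge v x l" by (auto simp: vge_def)

lemma vge_minus: "vge v x k \<Longrightarrow> vge v (- x) k" by (cases "x = 0") (auto simp: vge_def)

lemma vge_add: "vge v x k \<Longrightarrow> vge v y k \<Longrightarrow> vge v (x + y) k"
  using v_add[of x y] by (cases "x = 0"; cases "y = 0"; cases "x + y = 0") (auto simp: vge_def)

lemma vge_diff: "vge v x k \<Longrightarrow> vge v y k \<Longrightarrow> vge v (x - y) k"
  using vge_add[OF _ vge_minus, of x k y] by simp

lemma vge_mult: "vge v x k \<Longrightarrow> vge v y l \<Longrightarrow> vge v (x * y) (k + l)"
  using v_mult[of x y] by (cases "x = 0"; cases "y = 0") (auto simp: vge_def)

lemma vge_1 [simp]: "vge v 1 0" by (simp add: vge_def)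

lemma vge_sum: "(\<And>i. i \<in> A \<Longrightarrow> vge v (f i) k) \<Longrightarrow> vge v (sum f A) k"
  by (induction A rule: infinite_finite_induct) (auto intro: vge_add)

lemma vge_prod: "(\<And>i. i \<in> A \<Longrightarrow> vge v (f i) k) \<Longrightarrow> vge v (prod f A) (int (card A) * k)"
proof (induction A rule: infinite_finite_induct)
  case (insert a A)
  then have "vge v (f a * prod f A) (k + int (card A) * k)" by (intro vge_mult) auto
  then show ?case using insert by (simp add: algebra_simps)
qed auto

lemma vge_all_zero: "(\<And>k. vge v x k) \<Longrightarrow> x = 0"
  unfolding vge_def by (metis less_irrefl linorder_not_le zless_add1_eq add.commute)

section \<open>Maximal subrings of the algebraic closure\<close>

definition valuation_subring :: "'a alg_closure set \<Rightarrow> bool" where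
  "valuation_subring R \<longleftrightarrow> (\<forall>x\<in>R. \<forall>y\<in>R. x - y \<in> R \<and> x * y \<in> R) \<and>
     (\<forall>a. vge v a 0 \<longrightarrow> to_ac a \<in> R) \<and> (\<forall>a. to_ac a \<in> R \<longrightarrow> vge v a 0) \<and> (\<forall>x. x \<noteq> 0 \<longrightarrow> x \<in> R \<or> inverse x \<in> R)"

text \<open>Excluding the inverse of p says that p does not become a unit in \<open>R\<close>. Being
  a condition on a single element, it passes to unions of chains, as Zorn's lemma requires.\<close>

definition candidate :: "'a \<Rightarrow> 'a alg_closure set \<Rightarrow> bool" where
  "candidate p R \<longleftrightarrow> (\<forall>x\<in>R. \<forall>y\<in>R. x - y \<in> R \<and> x * y \<in> R) \<and>
     (\<forall>a. vge v a 0 \<longrightarrow> to_ac a \<in> R) \<and> inverse (to_ac p) \<notin> R"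

lemma subring_closed:
  assumes "\<forall>x\<in>R. \<forall>y\<in>R. x - y \<in> R \<and> x * y \<in> R" "(1 :: 'a alg_closure) \<in> R"
  shows "0 \<in> R" "\<And>x. x \<in> R \<Longrightarrow> - x \<in> R" "\<And>x y. x \<in> R \<Longrightarrow> y \<in> R \<Longrightarrow> x + y \<in> R"
    "\<And>f A. (\<And>i. i \<in> A \<Longrightarrow> f i \<in> R) \<Longrightarrow> sum f A \<in> R"
proof -
  show z: "0 \<in> R" using assms by (metis diff_self)
  show n: "- x \<in> R" if "x \<in> R" for x using assms(1) z that by (metis diff_0)
  show a: "x + y \<in> R" if "x \<in> R" "y \<in> R" for x y using assms(1) n[OF that(2)] that by (metis diff_minus_eq_add)
  show "sum f A \<in> R" if "\<And>i. i \<in> A \<Longrightarrow> f i \<in> R" for f :: "'b \<Rightarrow> _" and A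
    using that by (induction A rule: infinite_finite_induct) (auto simp: z a)
qed

text \<open>R[a] is a strictly larger subring containing the integers, so by maximality the only
  clause of \<open>candidate\<close> that it can violate is the one excluding the inverse of p; that
  inverse is thus a polynomial in a.\<close>

lemma candidate_adjoin:
  assumes R: "candidate p R" and max: "\<And>S. candidate p S \<Longrightarrow> R \<subseteq> S \<Longrightarrow> S = R" and a: "a \<notin> R"
  shows "\<exists>q. (\<forall>i. coeff q i \<in> R) \<and> poly q a = inverse (to_ac p)"
proof (rule ccontr)
  assume neg: "\<not> ?thesis"
  have rr: "\<forall>x\<in>R. \<forall>y\<in>R. x - y \<in> R \<and> x * y \<in> R" and oR: "\<And>b. vge v b 0 \<Longrightarrow> to_ac b \<in> R" using R by (auto simp: candidate_def)
  have one: "1 \<in> R" using oR[of 1] by simp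
  note cl = subring_closed[OF rr one]
  let ?S = "{poly q a | q. \<forall>i. coeff q i \<in> R}"
  have mem: "poly q a \<in> ?S" if "\<forall>i. coeff q i \<in> R" for q using that by blast
  have sub: "R \<subseteq> ?S"
  proof
    fix r assume r: "r \<in> R"
    have "\<forall>i. coeff [:r:] i \<in> R" using r cl(1) by (auto simp: coeff_pCons split: nat.splits)
    from mem[OF this] show "r \<in> ?S" by simp
  qed
  have "candidate p ?S"
    unfolding candidate_def
  proof (intro conjI ballI allI impI)
    fix x y assume "x \<in> ?S" "y \<in> ?S"
    then obtain q r where q: "x = poly q a" "\<forall>i. coeff q i \<in> R" and r: "y = poly r a" "\<forall>i. coeff r i \<in> R" by blast
    have "\<forall>i. coeff (q - r) i \<in> R" using q r rr by simp
    from mem[OF this] show "x - y \<in> ?S" using q r by simp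
    have "\<forall>i. coeff (q * r) i \<in> R" unfolding coeff_mult using q r rr by (auto intro!: cl(4))
    from mem[OF this] show "x * y \<in> ?S" using q r by simp
  next
    fix b assume "vge v b 0"
    then show "to_ac b \<in> ?S" using oR sub by blast
  next
    show "inverse (to_ac p) \<notin> ?S" using neg by (auto simp: eq_commute)
  qed
  then have "?S = R" using max sub by blast
  moreover have "a \<in> ?S"
  proof -
    have "\<forall>i. coeff [:0,1:] i \<in> R" using one cl(1) by (auto simp: coeff_pCons split: nat.splits)
    from mem[OF this] show ?thesis by simp
  qed
  ultimately show False using a by simp
qed

text \<open>Write P for p, m for the degree of q and s0 for the constant term of r. Since P r(1/a) =
  1, one has (1 - P s0) a^m = P t(a) with t of degree below m. Substituting this for the top term in
  (1 - P s0) q(a) = q(a) - s0 expresses 1/P as a polynomial in a of smaller degree, against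
  minimality.\<close>

lemma candidate_descent:
  assumes R: "candidate p R" and p: "p \<noteq> 0" "v p = 1" and a: "a \<noteq> 0"
    and q: "\<forall>i. coeff q i \<in> R" "poly q a = inverse (to_ac p)"
    and min: "\<And>q'. \<forall>i. coeff q' i \<in> R \<Longrightarrow> poly q' a = inverse (to_ac p) \<Longrightarrow> degree q \<le> degree q'"
    and r: "\<forall>i. coeff r i \<in> R" "poly r (inverse a) = inverse (to_ac p)" "degree r \<le> degree q"
  shows False
proof -
  have rr: "\<forall>x\<in>R. \<forall>y\<in>R. x - y \<in> R \<and> x * y \<in> R" and oR: "\<And>b. vge v b 0 \<Longrightarrow> to_ac b \<in> R"
    and np: "inverse (to_ac p) \<notin> R" using R by (auto simp: candidate_def)
  have one: "1 \<in> R" using oR[of 1] by simp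
  note cl = subring_closed[OF rr one]
  define m where "m = degree q"
  define P where "P = to_ac p"
  have P: "P \<noteq> 0" "P \<in> R" using p oR[of p] by (auto simp: P_def vge_def)
  have m0: "m > 0"
  proof (rule ccontr)
    assume "\<not> m > 0"
    then have "degree q = 0" using m_def by simp
    then obtain c where "q = [:c:]" by (rule degree_eq_zeroE)
    then have "coeff q 0 = inverse (to_ac p)" using q(2) by simp
    then show False using q(1) np by metis
  qed
  define s0 where "s0 = coeff r 0"
  define t where "t = (\<Sum>j\<in>{1..degree r}. monom (coeff r j) (m - j))"
  define q0 where "q0 = q - monom (coeff q m) m"
  \<comment> \<open>Multiplying by 1 - P s0 instead of dividing by it avoids having to know that it
    is a unit of \<open>R\<close>.\<close>
  define q2 where "q2 = [:s0:] + smult (1 - P * s0) q0 + smult (coeff q m * P) t"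
  have e1: "P * poly r (inverse a) = 1" "P * poly q a = 1" using r(2) q(2) P by (auto simp: P_def)
  have tr: "poly t a = a ^ m * (poly r (inverse a) - s0)"
  proof -
    have "poly r (inverse a) = (\<Sum>j\<le>degree r. coeff r j * inverse a ^ j)" by (simp add: poly_altdef)
    also have "\<dots> = s0 + (\<Sum>j\<in>{1..degree r}. coeff r j * inverse a ^ j)"
    proof -
      have "{..degree r} = insert 0 {1..degree r}" by auto
      then show ?thesis by (simp add: s0_def)
    qed
    finally have "a ^ m * (poly r (inverse a) - s0) = (\<Sum>j\<in>{1..degree r}. a ^ m * (coeff r j * inverse a ^ j))"
      by (simp add: sum_distrib_left)
    also have "\<dots> = (\<Sum>j\<in>{1..degree r}. coeff r j * a ^ (m - j))"
    proof (rule sum.cong)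
      fix j assume "j \<in> {1..degree r}"
      then have "j \<le> m" using r(3) m_def by simp
      then have "a ^ m = a ^ (m - j) * a ^ j" by (simp add: power_add[symmetric])
      then show "a ^ m * (coeff r j * inverse a ^ j) = coeff r j * a ^ (m - j)" using a by (simp add: field_simps)
    qed simp
    finally show ?thesis by (simp add: t_def poly_sum poly_monom)
  qed
  have q0: "poly q0 a = poly q a - coeff q m * a ^ m" by (simp add: q0_def poly_monom)
  have eq: "P * poly q2 a = 1"
  proof -
    have "P * poly q2 a = P * s0 + (1 - P * s0) * (P * poly q a) - (1 - P * s0) * P * coeff q m * a ^ m
       + coeff q m * P * a ^ m * (P * poly r (inverse a) - P * s0)"
      by (simp add: q2_def q0 tr algebra_simps)
    then show ?thesis unfolding e1 by (simp add: algebra_simps)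
  qed
  have "poly q2 a = inverse (to_ac p)" using eq P(1) by (simp add: P_def field_simps)
  moreover have "\<forall>i. coeff q2 i \<in> R"
  proof
    fix i
    have s0: "s0 \<in> R" using r(1) s0_def by simp
    have qm: "coeff q m \<in> R" using q(1) by blast
    have "coeff t i \<in> R" unfolding t_def coeff_sum using r(1) cl(1) by (intro cl(4)) (auto simp: coeff_monom)
    moreover have "coeff q0 i \<in> R" unfolding q0_def using q(1) rr cl(1) by (auto simp: coeff_monom)
    moreover have "coeff [:s0:] i \<in> R" using s0 cl(1) by (auto simp: coeff_pCons split: nat.splits)
    moreover have "1 - P * s0 \<in> R" "coeff q m * P \<in> R" using rr one P s0 qm by blast+
    ultimately show "coeff q2 i \<in> R" unfolding q2_def coeff_add coeff_smult using rr by (intro cl(3)) blast+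
  qed
  moreover have "degree q2 < m"
  proof -
    have "degree q0 < m"
    proof (rule degree_lessI)
      show "q0 \<noteq> 0 \<or> 0 < m" using m0 by simp
      show "\<forall>k\<ge>m. coeff q0 k = 0"
      proof (intro allI impI)
        fix k assume "m \<le> k"
        then show "coeff q0 k = 0" using coeff_eq_0[of q k] by (cases "k = m") (auto simp: q0_def coeff_monom m_def)
      qed
    qed
    moreover have "degree t \<le> m - 1" unfolding t_def
    proof (rule degree_sum_le)
      fix j assume "j \<in> {1..degree r}"
      then have "degree (monom (coeff r j) (m - j)) \<le> m - j" by (intro degree_monom_le)
      then show "degree (monom (coeff r j) (m - j)) \<le> m - 1" using \<open>j \<in> {1..degree r}\<close> by auto
    qed simp
    ultimately have "degree q2 \<le> m - 1" unfolding q2_def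
      using degree_smult_le[of "1 - P * s0" q0] degree_smult_le[of "coeff q m * P" t]
      by (intro degree_add_le) auto
    then show ?thesis using m0 by simp
  qed
  ultimately show False using min[of q2] m_def by simp
qed

lemma valuation_subring_exists: "\<exists>R. valuation_subring R"
proof -
  obtain p where p: "p \<noteq> 0" "v p = 1" using uniformizer by blast
  let ?A = "{R. candidate p R}"
  have np: "\<not> vge v (inverse p) 0" using p by (simp add: vge_def v_inverse)
  have "candidate p (to_ac ` {b. vge v b 0})"
    unfolding candidate_def
  proof (intro conjI ballI allI impI)
    fix x y assume "x \<in> to_ac ` {b. vge v b 0}" "y \<in> to_ac ` {b. vge v b 0}"
    then obtain b c where bc: "x = to_ac b" "y = to_ac c" "vge v b 0" "vge v c 0" by blast
    then have "x - y = to_ac (b - c)" "x * y = to_ac (b * c)" by simp_all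
    moreover have "vge v (b - c) 0" "vge v (b * c) 0" using vge_diff bc vge_mult[of b 0 c 0] by auto
    ultimately show "x - y \<in> to_ac ` {b. vge v b 0}" "x * y \<in> to_ac ` {b. vge v b 0}" by blast+
  next
    show "inverse (to_ac p) \<notin> to_ac ` {b. vge v b 0}" using np by (auto simp flip: to_ac_inverse)
  qed blast
  then have ne: "?A \<noteq> {}" by blast
  have "\<exists>M\<in>?A. \<forall>S\<in>?A. M \<subseteq> S \<longrightarrow> S = M"
  proof (rule subset_Zorn_nonempty[OF ne])
    fix C assume C: "C \<noteq> {}" "subset.chain ?A C"
    have CA: "\<And>R. R \<in> C \<Longrightarrow> candidate p R" and ch: "\<And>R S. R \<in> C \<Longrightarrow> S \<in> C \<Longrightarrow> R \<subseteq> S \<or> S \<subseteq> R"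
      using C(2) by (auto simp: subset_chain_def)
    have "candidate p (\<Union>C)"
      unfolding candidate_def
    proof (intro conjI ballI allI impI)
      fix x y assume "x \<in> \<Union>C" "y \<in> \<Union>C"
      then obtain R S where RS: "x \<in> R" "R \<in> C" "y \<in> S" "S \<in> C" by blast
      then obtain T where T: "T \<in> C" "x \<in> T" "y \<in> T" using ch[of R S] by blast
      then have "x - y \<in> T" "x * y \<in> T" using CA[of T] by (auto simp: candidate_def)
      then show "x - y \<in> \<Union>C" "x * y \<in> \<Union>C" using T(1) by blast+
    next
      fix b assume "vge v b 0"
      then show "to_ac b \<in> \<Union>C" using C(1) CA by (fastforce simp: candidate_def)
    next
      show "inverse (to_ac p) \<notin> \<Union>C" using CA by (auto simp: candidate_def)
    qed
    then show "\<Union>C \<in> ?A" by simp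
  qed
  then obtain M where M: "candidate p M" "\<And>S. candidate p S \<Longrightarrow> M \<subseteq> S \<Longrightarrow> S = M" by blast
  have "x \<in> M \<or> inverse x \<in> M" if x: "x \<noteq> 0" for x
  proof (rule ccontr)
    assume neg: "\<not> (x \<in> M \<or> inverse x \<in> M)"
    let ?Q = "\<lambda>a q. (\<forall>i. coeff q i \<in> M) \<and> poly q a = inverse (to_ac p)"
    have "\<exists>q. ?Q x q" using candidate_adjoin[OF M, of x] neg by blast
    then obtain q where q: "?Q x q" "\<And>q'. ?Q x q' \<Longrightarrow> degree q \<le> degree q'"
      using ex_has_least_nat[of "?Q x" _ degree] by blast
    have "\<exists>q. ?Q (inverse x) q" using candidate_adjoin[OF M, of "inverse x"] neg by blast
    then obtain r where r: "?Q (inverse x) r" "\<And>q'. ?Q (inverse x) q' \<Longrightarrow> degree r \<le> degree q'"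
      using ex_has_least_nat[of "?Q (inverse x)" _ degree] by blast
    \<comment> \<open>The relation of larger degree is the one to be shortened, so the roles of x
      and its inverse depend on the comparison of degrees.\<close>
    show False
    proof (cases "degree r \<le> degree q")
      case True
      show False by (rule candidate_descent[OF M(1) p x, of q r]) (use q r True in auto)
    next
      case False
      have ix: "inverse x \<noteq> 0" using x by simp
      show False by (rule candidate_descent[OF M(1) p ix, of r q]) (use q r False in auto)
    qed
  qed
  \<comment> \<open>If v a < 0 then 1/(a p) is integral, and its product with a would put 1/p into
    \<open>M\<close>; so \<open>M\<close> meets the base field only in its integers.\<close>
  moreover have "vge v a 0" if a: "to_ac a \<in> M" for a
  proof (rule ccontr)
    assume "\<not> vge v a 0"
    then have a0: "a \<noteq> 0" "v a < 0" by (auto simp: vge_def)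
    then have "vge v (inverse a * inverse p) 0" using p by (simp add: vge_def v_mult v_inverse)
    then have "to_ac (inverse a * inverse p) \<in> M" using M(1) by (auto simp: candidate_def)
    then have "to_ac a * to_ac (inverse a * inverse p) \<in> M" using a M(1) by (auto simp: candidate_def)
    moreover have "to_ac a * to_ac (inverse a * inverse p) = inverse (to_ac p)" using a0 by simp
    ultimately have "inverse (to_ac p) \<in> M" by (simp only:)
    then show False using M(1) unfolding candidate_def by blast
  qed
  ultimately have "valuation_subring M" using M(1) unfolding valuation_subring_def candidate_def by blast
  then show ?thesis by blast
qed

section \<open>Values of algebraic elements\<close>

context
  fixes R assumes R: "valuation_subring R"
begin

definition vunit :: "'a alg_closure \<Rightarrow> bool" where
  "vunit x \<longleftrightarrow> x \<noteq> 0 \<and> x \<in> R \<and> inverse x \<in> R"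

lemma R_diff: "x \<in> R \<Longrightarrow> y \<in> R \<Longrightarrow> x - y \<in> R" and R_mult: "x \<in> R \<Longrightarrow> y \<in> R \<Longrightarrow> x * y \<in> R"
  and R_to_ac: "to_ac a \<in> R \<longleftrightarrow> vge v a 0" and R_total: "x \<noteq> 0 \<Longrightarrow> x \<in> R \<or> inverse x \<in> R"
proof -
  note r = R[unfolded valuation_subring_def]
  show "x \<in> R \<Longrightarrow> y \<in> R \<Longrightarrow> x - y \<in> R" "x \<in> R \<Longrightarrow> y \<in> R \<Longrightarrow> x * y \<in> R" using conjunct1[OF r] by simp_all
  show "to_ac a \<in> R \<longleftrightarrow> vge v a 0"
    using spec[OF conjunct1[OF conjunct2[OF r]], of a] spec[OF conjunct1[OF conjunct2[OF conjunct2[OF r]]], of a] by (intro iffI) (erule (1) mp)+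
  show "x \<noteq> 0 \<Longrightarrow> x \<in> R \<or> inverse x \<in> R"
    using spec[OF conjunct2[OF conjunct2[OF conjunct2[OF r]]], of x] by (rule mp)
qed

lemma R_one: "1 \<in> R" using R_to_ac[of 1] by simp

lemma R_zero: "0 \<in> R" using R_to_ac[of 0] by simp

lemma R_add: "x \<in> R \<Longrightarrow> y \<in> R \<Longrightarrow> x + y \<in> R"
  using R_diff[OF _ R_diff[OF R_zero], of x y] by simp

lemma vunit_mult: "vunit x \<Longrightarrow> vunit y \<Longrightarrow> vunit (x * y)"
  unfolding vunit_def by (auto simp: R_mult)

lemma vunit_inverse: "vunit x \<Longrightarrow> vunit (inverse x)"
  unfolding vunit_def by auto

lemma vunit_one: "vunit 1"
  unfolding vunit_def by (simp add: R_one)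

lemma vunit_power: "vunit x \<Longrightarrow> vunit (x ^ k)"
  by (induction k) (auto intro: vunit_mult vunit_one)

lemma vunit_to_ac: "vunit (to_ac a) \<longleftrightarrow> a \<noteq> 0 \<and> v a = 0"
  unfolding vunit_def to_ac_inverse[symmetric] R_to_ac by (auto simp: vge_def v_inverse)

text \<open>In a valuation ring one of b/c and c/b is integral, say b/c; if b + c = c (b/c + 1) were
  a unit then c would be one. Induction extends this to finite sums.\<close>

lemma nonunit_sum:
  assumes "finite A" "\<And>i. i \<in> A \<Longrightarrow> f i \<in> R \<and> \<not> vunit (f i)"
  shows "sum f A \<in> R \<and> \<not> vunit (sum f A)"
  using assms
proof (induction A rule: finite_induct)
  case empty then show ?case by (simp add: R_zero vunit_def)
next
  case (insert a A)
  have two: "\<not> vunit (b + c)" if b: "b \<in> R" "\<not> vunit b" and c: "c \<in> R" "\<not> vunit c" and c0: "c \<noteq> 0" and d: "b / c \<in> R" for b c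
  proof
    assume u: "vunit (b + c)"
    have "inverse (b + c) * (b / c + 1) \<in> R" using u d unfolding vunit_def by (intro R_mult R_add R_one) auto
    moreover have "inverse (b + c) * (b / c + 1) = inverse c" using c0 u unfolding vunit_def by (simp add: field_simps)
    ultimately show False using c c0 by (simp add: vunit_def)
  qed
  have x: "f a \<in> R" "\<not> vunit (f a)" and y: "sum f A \<in> R" "\<not> vunit (sum f A)" using insert by auto
  have "\<not> vunit (f a + sum f A)"
  proof (cases "f a = 0 \<or> sum f A = 0")
    case False
    then show ?thesis using R_total[of "f a / sum f A"] two[OF x y] two[OF y x] by (auto simp: add.commute)
  qed (use x y in auto)
  then show ?case using insert x y by (simp add: R_add)
qed

text \<open>Divide the equation by a term of least value, one that divides all others in
  \<open>R\<close>. The remaining quotients sum to -1, so one of them is a unit. Two terms of equal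
  value, with exponents i and j, make x^|i-j| a unit multiple of an element of the base field, and
  |i-j| is at most the degree.\<close>

lemma vunit_ratio:
  assumes x: "x \<noteq> 0" and q: "q \<noteq> 0" "poly (map_poly to_ac q) x = 0"
  shows "\<exists>k a. 0 < k \<and> k \<le> degree q \<and> a \<noteq> 0 \<and> vunit (x ^ k / to_ac a)"
proof -
  let ?S = "{i. coeff q i \<noteq> 0}"
  let ?t = "\<lambda>i. to_ac (coeff q i) * x ^ i"
  have Sd: "?S \<subseteq> {..degree q}" using le_degree by auto
  then have fin: "finite ?S" by (rule finite_subset) simp
  have ne: "?S \<noteq> {}" using q(1) by (auto simp: poly_eq_iff)
  have tn: "?t i \<noteq> 0" if "i \<in> ?S" for i using that x by simp
  have tot: "?t i / ?t j \<in> R \<or> ?t j / ?t i \<in> R" if "i \<in> ?S" "j \<in> ?S" for i j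
    using R_total[of "?t i / ?t j"] tn[OF that(1)] tn[OF that(2)] by auto
  \<comment> \<open>Divisibility in \<open>R\<close> is a total preorder on the nonzero terms, so
    every finite nonempty set of them has a least one.\<close>
  have "\<exists>j\<in>S. \<forall>i\<in>S. ?t i / ?t j \<in> R" if "finite S" "S \<noteq> {}" "S \<subseteq> ?S" for S
    using that
  proof (induction S rule: finite_ne_induct)
    case (singleton i)
    then show ?case using tn[of i] R_one x by simp
  next
    case (insert i S)
    then obtain j where j: "j \<in> S" "\<forall>i\<in>S. ?t i / ?t j \<in> R" by auto
    have iS: "i \<in> ?S" "j \<in> ?S" using insert j by auto
    show ?case
    proof (cases "?t i / ?t j \<in> R")
      case True
      then show ?thesis using j by blast
    next
      case False
      then have ji: "?t j / ?t i \<in> R" using tot[OF iS] by blast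
      have "?t k / ?t i \<in> R" if k: "k \<in> insert i S" for k
      proof (cases "k = i")
        case True then show ?thesis using tn[OF iS(1)] R_one x by simp
      next
        case False
        then have "?t k / ?t j \<in> R" using j k by blast
        from R_mult[OF this ji] show ?thesis using tn[OF iS(2)] x by simp
      qed
      then show ?thesis by blast
    qed
  qed
  then obtain j where j: "j \<in> ?S" "\<forall>i\<in>?S. ?t i / ?t j \<in> R" using fin ne by blast
  have "(\<Sum>i\<in>?S. ?t i) = 0"
  proof -
    have "poly (map_poly to_ac q) x = (\<Sum>i\<le>degree q. ?t i)"
      by (simp add: poly_altdef coeff_map_poly degree_map_poly)
    also have "\<dots> = (\<Sum>i\<in>?S. ?t i)" by (rule sum.mono_neutral_right) (use Sd in auto)
    finally show ?thesis using q(2) by simp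
  qed
  then have "(\<Sum>i\<in>?S. ?t i / ?t j) = 0" by (simp flip: sum_divide_distrib)
  then have s: "(\<Sum>i\<in>?S - {j}. ?t i / ?t j) = -1"
    using sum.remove[OF fin j(1), of "\<lambda>i. ?t i / ?t j"] tn[OF j(1)] x by (simp add: eq_neg_iff_add_eq_0 add.commute)
  have "\<exists>i\<in>?S - {j}. vunit (?t i / ?t j)"
  proof (rule ccontr)
    assume "\<not> ?thesis"
    then have "\<not> vunit (\<Sum>i\<in>?S - {j}. ?t i / ?t j)" using nonunit_sum[of "?S - {j}" "\<lambda>i. ?t i / ?t j"] fin j(2) by blast
    moreover have "vunit (-1)" using vunit_to_ac[of "-1"] by simp
    ultimately show False using s by simp
  qed
  then obtain i where i: "i \<in> ?S" "i \<noteq> j" "vunit (?t i / ?t j)" by blast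
  have d: "i \<le> degree q" "j \<le> degree q" using i j Sd by auto
  show ?thesis
  proof (cases "i > j")
    case True
    have "?t i / ?t j = x ^ (i - j) / to_ac (coeff q j / coeff q i)"
      using i(1) j(1) x True by (simp add: field_simps power_diff)
    then show ?thesis using i(3) True d i(1) j(1)
      by (intro exI[of _ "i - j"] exI[of _ "coeff q j / coeff q i"]) auto
  next
    case False
    then have ij: "i < j" using i(2) by simp
    have "inverse (?t i / ?t j) = x ^ (j - i) / to_ac (coeff q i / coeff q j)"
      using i(1) j(1) x ij by (simp add: field_simps power_diff)
    then have "vunit (x ^ (j - i) / to_ac (coeff q i / coeff q j))" using vunit_inverse[OF i(3)] by simp
    then show ?thesis using ij d i(1) j(1)
      by (intro exI[of _ "j - i"] exI[of _ "coeff q i / coeff q j"]) auto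
  qed
qed

text \<open>The value is forced: if x^k / a is a unit then k w(x) must equal v a.
  \<open>wext_unique\<close> shows that the choice of k and a does not matter.\<close>

definition wext :: "'a alg_closure \<Rightarrow> real" where
  "wext x = (SOME r. \<exists>k a. 0 < k \<and> a \<noteq> 0 \<and> vunit (x ^ k / to_ac a) \<and> r = real_of_int (v a) / real k)"

text \<open>Raising the two units to the powers l and k eliminates x and leaves the unit b^k / a^l
  of the base field.\<close>

lemma wext_unique:
  assumes "vunit (x ^ k / to_ac a)" "vunit (x ^ l / to_ac b)" "0 < k" "0 < l" "a \<noteq> 0" "b \<noteq> 0"
  shows "real_of_int (v a) / real k = real_of_int (v b) / real l"
proof -
  have x: "x \<noteq> 0" using assms(1,3) by (auto simp: vunit_def)
  have "vunit ((x ^ k / to_ac a) ^ l * inverse ((x ^ l / to_ac b) ^ k))"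
    using assms(1,2) by (intro vunit_mult vunit_inverse vunit_power)
  moreover have "(x ^ k / to_ac a) ^ l * inverse ((x ^ l / to_ac b) ^ k) = to_ac (b ^ k / a ^ l)"
    using x assms(5,6) by (simp add: field_simps power_mult[symmetric] mult.commute)
  ultimately have "vunit (to_ac (b ^ k / a ^ l))" by (simp only:)
  then have "v (b ^ k / a ^ l) = 0" using vunit_to_ac[of "b ^ k / a ^ l"] by blast
  then have "v (b ^ k) = v (a ^ l)" using assms(5,6) by (simp add: divide_inverse v_mult v_inverse)
  then have "int k * v b = int l * v a" using assms(5,6) by (simp add: v_power)
  then have "real k * real_of_int (v b) = real l * real_of_int (v a)"
    by (metis of_int_mult of_int_of_nat_eq)
  then show ?thesis using assms(3,4) by (simp add: field_simps)
qed

lemma wext_eq: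
  assumes "vunit (x ^ k / to_ac a)" "0 < k" "a \<noteq> 0"
  shows "wext x = real_of_int (v a) / real k"
proof -
  let ?P = "\<lambda>r. \<exists>k a. 0 < k \<and> a \<noteq> 0 \<and> vunit (x ^ k / to_ac a) \<and> r = real_of_int (v a) / real k"
  have "?P (real_of_int (v a) / real k)" using assms by blast
  then have "?P (wext x)" unfolding wext_def by (rule someI[of ?P])
  then show ?thesis using wext_unique assms by metis
qed

lemma wext_ex:
  assumes "x \<noteq> 0"
  shows "\<exists>k a. 0 < k \<and> a \<noteq> 0 \<and> vunit (x ^ k / to_ac a)"
proof -
  obtain q :: "'a poly" where "q \<noteq> 0" "poly (map_poly to_ac q) x = 0" by (rule alg_closure_algebraic)
  then show ?thesis using vunit_ratio[OF assms] by blast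
qed

lemma wext_to_ac: "a \<noteq> 0 \<Longrightarrow> wext (to_ac a) = real_of_int (v a)"
  using wext_eq[of "to_ac a" 1 a] vunit_one by simp

lemma wext_mult:
  assumes x: "x \<noteq> 0" and y: "y \<noteq> 0"
  shows "wext (x * y) = wext x + wext y"
proof -
  obtain k a where a: "0 < k" "a \<noteq> 0" "vunit (x ^ k / to_ac a)" using wext_ex[OF x] by blast
  obtain l b where b: "0 < l" "b \<noteq> 0" "vunit (y ^ l / to_ac b)" using wext_ex[OF y] by blast
  have "vunit ((x ^ k / to_ac a) ^ l * (y ^ l / to_ac b) ^ k)" using a b by (intro vunit_mult vunit_power)
  moreover have "(x ^ k / to_ac a) ^ l * (y ^ l / to_ac b) ^ k = (x * y) ^ (k * l) / to_ac (a ^ l * b ^ k)"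
    by (simp add: power_divide power_mult_distrib power_mult[symmetric] mult.commute)
  ultimately have "wext (x * y) = real_of_int (v (a ^ l * b ^ k)) / real (k * l)"
    using a b by (intro wext_eq) auto
  moreover have "wext x = real_of_int (v a) / real k" "wext y = real_of_int (v b) / real l"
    using a b by (auto intro: wext_eq)
  moreover have "real_of_int (v (a ^ l * b ^ k)) = real l * real_of_int (v a) + real k * real_of_int (v b)"
    using a b by (simp add: v_mult v_power)
  ultimately show ?thesis using a(1) b(1) by (simp add: add_divide_distrib)
qed

lemma wext_nonneg:
  assumes x: "x \<noteq> 0" "x \<in> R"
  shows "wext x \<ge> 0"
proof -
  obtain k a where a: "0 < k" "a \<noteq> 0" "vunit (x ^ k / to_ac a)" using wext_ex[OF x(1)] by blast
  have "x ^ k \<in> R" by (induction k) (auto simp: R_one R_mult x(2))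
  then have "x ^ k * inverse (x ^ k / to_ac a) \<in> R" using a(3) unfolding vunit_def by (intro R_mult) auto
  then have "to_ac a \<in> R" using x(1) by simp
  then have "v a \<ge> 0" using a(2) by (simp add: R_to_ac vge_def)
  then show ?thesis using wext_eq[OF a(3,1,2)] by simp
qed

text \<open>If b/c is integral then b + c = c (b/c + 1) with an integral second factor; totality of
  \<open>R\<close> provides this for one of the two orders of the summands.\<close>

lemma wext_add:
  assumes x: "x \<noteq> 0" and y: "y \<noteq> 0" and xy: "x + y \<noteq> 0"
  shows "wext (x + y) \<ge> min (wext x) (wext y)"
proof -
  have key: "wext (b + c) \<ge> wext c" if b: "b \<noteq> 0" "c \<noteq> 0" "b + c \<noteq> 0" "b / c \<in> R" for b c
  proof -
    have "b / c + 1 \<in> R" using b(4) by (intro R_add R_one)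
    moreover have e: "b + c = c * (b / c + 1)" using b by (simp add: field_simps)
    moreover have "b / c + 1 \<noteq> 0" using b(3) e by auto
    ultimately show ?thesis using wext_nonneg[of "b / c + 1"] wext_mult[of c "b / c + 1"] b(2) by simp
  qed
  show ?thesis using R_total[of "x / y"] key[of x y] key[of y x] assms by (auto simp: add.commute)
qed

end

text \<open>The last clause bounds denominators: a root of a polynomial of degree d has value in
  (1/d!) Z. It makes the possible valuation vectors on the torus discrete, hence countable by a
  polynomial bound.\<close>

definition extends_valuation :: "('a alg_closure \<Rightarrow> real) \<Rightarrow> bool" where
  "extends_valuation w \<longleftrightarrow> (\<forall>a. a \<noteq> 0 \<longrightarrow> w (to_ac a) = real_of_int (v a)) \<and>
    (\<forall>x y. x \<noteq> 0 \<longrightarrow> y \<noteq> 0 \<longrightarrow> w (x * y) = w x + w y) \<and>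
    (\<forall>x y. x \<noteq> 0 \<longrightarrow> y \<noteq> 0 \<longrightarrow> x + y \<noteq> 0 \<longrightarrow> w (x + y) \<ge> min (w x) (w y)) \<and>
    (\<forall>x q. x \<noteq> 0 \<longrightarrow> q \<noteq> 0 \<longrightarrow> poly (map_poly to_ac q) x = 0 \<longrightarrow> fact (degree q) * w x \<in> \<int>)"

lemma extends_valuationD:
  assumes "extends_valuation w"
  shows "a \<noteq> 0 \<Longrightarrow> w (to_ac a) = real_of_int (v a)"
    "x \<noteq> 0 \<Longrightarrow> y \<noteq> 0 \<Longrightarrow> w (x * y) = w x + w y"
    "x \<noteq> 0 \<Longrightarrow> y \<noteq> 0 \<Longrightarrow> x + y \<noteq> 0 \<Longrightarrow> w (x + y) \<ge> min (w x) (w y)"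
    "x \<noteq> 0 \<Longrightarrow> q \<noteq> 0 \<Longrightarrow> poly (map_poly to_ac q) x = 0 \<Longrightarrow> fact (degree q) * w x \<in> \<int>"
  using assms unfolding extends_valuation_def by simp_all

text \<open>Chevalley's extension argument: a subring of the algebraic closure that is maximal among those
  containing the integers but not the inverse of a uniformizer is a valuation ring. Its value group
  is torsion over that of v, because two terms of an algebraic equation must have equal value;
  hence it defines a real valued extension of v.\<close>

lemma valuation_extension: "\<exists>w. extends_valuation w"
proof -
  obtain R where R: "valuation_subring R" using valuation_subring_exists by blast
  have "extends_valuation (wext R)"
    unfolding extends_valuation_def
  proof (intro conjI allI impI)
    fix x :: "'a alg_closure" and q assume x: "x \<noteq> 0" "q \<noteq> 0" "poly (map_poly to_ac q) x = 0"
    obtain k a where a: "0 < k" "k \<le> degree q" "a \<noteq> 0" "vunit R (x ^ k / to_ac a)" using vunit_ratio[OF R x] by blast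
    then have w: "wext R x = real_of_int (v a) / real k" by (intro wext_eq[OF R])
    have "k dvd fact (degree q)" using a by (intro dvd_fact) auto
    then obtain c where c: "(fact (degree q) :: nat) = k * c" by (rule dvdE)
    have "(fact (degree q) :: real) = real (fact (degree q))" by simp
    also have "\<dots> = real k * real c" unfolding c by simp
    finally have "fact (degree q) * wext R x = real_of_int (int c * v a)" using w a(1) by simp
    then show "fact (degree q) * wext R x \<in> \<int>" by (metis Ints_of_int)
  qed (rule wext_to_ac[OF R] wext_mult[OF R] wext_add[OF R]; assumption)+
  then show ?thesis by blast
qed

end

section \<open>Valuations of the eigenvalues\<close>

lemma mult_index:
  fixes A B :: "'b::semiring_0 mat"
  assumes "A \<in> carrier_mat n n" "B \<in> carrier_mat n n" "i < n" "j < n"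
  shows "(A * B) $$ (i,j) = (\<Sum>k<n. A $$ (i,k) * B $$ (k,j))"
  using assms by (auto simp: scalar_prod_def lessThan_atLeast0 intro!: sum.cong)

lemma mult_vec_index:
  fixes A :: "'b::semiring_0 mat"
  assumes "A \<in> carrier_mat n n" "u \<in> carrier_vec n" "i < n"
  shows "(A *\<^sub>v u) $ i = (\<Sum>k<n. A $$ (i,k) * u $ k)"
  using assms by (auto simp: scalar_prod_def lessThan_atLeast0 intro!: sum.cong)

lemma mult_diag_index:
  fixes A :: "'b::semiring_0 mat"
  assumes "A \<in> carrier_mat n n" "i < n" "j < n"
  shows "(A * mat_diag n d) $$ (i,j) = A $$ (i,j) * d j"
  using assms by (subst mat_diag_mult_right) auto

lemma diag_mult_index:
  fixes A :: "'b::semiring_0 mat"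
  assumes "A \<in> carrier_mat n n" "i < n" "j < n"
  shows "(mat_diag n d * A) $$ (i,j) = d i * A $$ (i,j)"
  using assms by (subst mat_diag_mult_left) auto

text \<open>The adjugate formula replaces the choice in \<open>ginv\<close> because its entries are
  cofactors up to a scalar and can be bounded.\<close>

definition matinv :: "'b::field mat \<Rightarrow> 'b mat" where
  "matinv g = inverse (det g) \<cdot>\<^sub>m adj_mat g"

lemma matinv:
  fixes g :: "'b::field mat"
  assumes g: "g \<in> carrier_mat n n" "det g \<noteq> 0"
  shows "matinv g \<in> carrier_mat n n" "g * matinv g = 1\<^sub>m n" "matinv g * g = 1\<^sub>m n"
proof -
  note a = adj_mat[OF g(1)]
  show "matinv g \<in> carrier_mat n n" unfolding matinv_def using a by simp
  have "g * matinv g = inverse (det g) \<cdot>\<^sub>m (g * adj_mat g)"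
    unfolding matinv_def by (rule mult_smult_distrib[OF g(1) a(1)])
  also have "\<dots> = 1\<^sub>m n" unfolding a(2) using g(2) by (intro eq_matI) auto
  finally show "g * matinv g = 1\<^sub>m n" .
  have "matinv g * g = inverse (det g) \<cdot>\<^sub>m (adj_mat g * g)"
    unfolding matinv_def by (rule mult_smult_assoc_mat[OF a(1) g(1)])
  also have "\<dots> = 1\<^sub>m n" unfolding a(3) using g(2) by (intro eq_matI) auto
  finally show "matinv g * g = 1\<^sub>m n" .
qed

text \<open>Take a nonzero kernel vector c of \<open>P\<close> with fewest nonzero entries, and j
  with c_j nonzero. The vector with entries (d_i - d_j) c_i is again in the kernel and loses
  position j, so it vanishes; then c is supported at j alone and column j of \<open>P\<close> is
  zero.\<close>

lemma eigenvector_matrix_invertible: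
  fixes A P :: "'b::field mat"
  assumes A: "A \<in> carrier_mat n n" and P: "P \<in> carrier_mat n n"
    and AP: "A * P = P * mat_diag n d" and inj: "inj_on d {..<n}"
    and ne: "\<And>j. j < n \<Longrightarrow> col P j \<noteq> 0\<^sub>v n"
  shows "det P \<noteq> 0"
proof
  assume "det P = 0"
  let ?K = "\<lambda>c :: 'b Matrix.vec. c \<in> carrier_vec n \<and> c \<noteq> 0\<^sub>v n \<and> P *\<^sub>v c = 0\<^sub>v n"
  let ?N = "\<lambda>c :: 'b Matrix.vec. card {i. i < n \<and> c $ i \<noteq> 0}"
  have "\<exists>c. ?K c" using \<open>det P = 0\<close> det_0_iff_vec_prod_zero[OF P] by blast
  then obtain c where c: "?K c" and min: "\<And>c'. ?K c' \<Longrightarrow> ?N c \<le> ?N c'"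
    using ex_has_least_nat[of ?K _ ?N] by blast
  have cc: "c \<in> carrier_vec n" and Pc: "P *\<^sub>v c = 0\<^sub>v n" using c by auto
  have "\<exists>j<n. c $ j \<noteq> 0"
  proof (rule ccontr)
    assume "\<not> ?thesis"
    then have "c = 0\<^sub>v n" using cc by (intro eq_vecI) auto
    then show False using c by simp
  qed
  then obtain j where j: "j < n" "c $ j \<noteq> 0" by blast
  define c' where "c' = vec n (\<lambda>i. (d i - d j) * c $ i)"
  have c'c: "c' \<in> carrier_vec n" by (simp add: c'_def)
  have "P *\<^sub>v c' = 0\<^sub>v n"
  proof (rule eq_vecI)
    fix r assume "r < dim_vec (0\<^sub>v n :: 'b vec)"
    then have r: "r < n" by simp
    have p0: "(\<Sum>k<n. P $$ (i,k) * c $ k) = 0" if "i < n" for i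
      using mult_vec_index[OF P cc that] Pc that by simp
    have "(P *\<^sub>v c') $ r = (\<Sum>k<n. P $$ (r,k) * ((d k - d j) * c $ k))"
      using mult_vec_index[OF P c'c r] by (simp add: c'_def)
    also have "\<dots> = (\<Sum>k<n. (P * mat_diag n d) $$ (r,k) * c $ k) - d j * (\<Sum>k<n. P $$ (r,k) * c $ k)"
      unfolding sum_distrib_left sum_subtractf[symmetric]
      by (rule sum.cong) (auto simp: mult_diag_index[OF P r] algebra_simps)
    also have "(\<Sum>k<n. (P * mat_diag n d) $$ (r,k) * c $ k) = (\<Sum>k<n. (\<Sum>i<n. A $$ (r,i) * P $$ (i,k)) * c $ k)"
      unfolding AP[symmetric] by (rule sum.cong) (auto simp: mult_index[OF A P r])
    also have "\<dots> = (\<Sum>i<n. A $$ (r,i) * (\<Sum>k<n. P $$ (i,k) * c $ k))"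
      unfolding sum_distrib_left sum_distrib_right by (subst sum.swap) (simp add: mult.assoc)
    also have "\<dots> = 0" using p0 by simp
    finally show "(P *\<^sub>v c') $ r = 0\<^sub>v n $ r" using p0[OF r] r by simp
  qed (use P in simp)
  then have Pc': "P *\<^sub>v c' = 0\<^sub>v n" .
  have c'i: "c' $ i = (d i - d j) * c $ i" if "i < n" for i using that by (simp add: c'_def)
  have "{i. i < n \<and> c' $ i \<noteq> 0} \<subseteq> {i. i < n \<and> c $ i \<noteq> 0}"
  proof
    fix i assume "i \<in> {i. i < n \<and> c' $ i \<noteq> 0}"
    then have "i < n" "c' $ i \<noteq> 0" by simp_all
    then show "i \<in> {i. i < n \<and> c $ i \<noteq> 0}" using c'i[of i] by simp
  qed
  moreover have "j \<in> {i. i < n \<and> c $ i \<noteq> 0}" "j \<notin> {i. i < n \<and> c' $ i \<noteq> 0}" using j c'i[of j] by simp_all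
  ultimately have "{i. i < n \<and> c' $ i \<noteq> 0} \<subset> {i. i < n \<and> c $ i \<noteq> 0}" by blast
  then have less: "?N c' < ?N c" by (rule psubset_card_mono[rotated]) simp
  have c'0: "c' = 0\<^sub>v n"
  proof (rule ccontr)
    assume "c' \<noteq> 0\<^sub>v n"
    then have "?N c \<le> ?N c'" using min[of c'] c'c Pc' by simp
    then show False using less by simp
  qed
  have c0: "c $ i = 0" if i: "i < n" "i \<noteq> j" for i
  proof -
    have "c' $ i = 0" using c'0 i by simp
    then have "(d i - d j) * c $ i = 0" using i by (simp add: c'_def)
    moreover have "d i \<noteq> d j" using inj i j by (auto simp: inj_on_def)
    ultimately show ?thesis by simp
  qed
  have "col P j = 0\<^sub>v n"
  proof (rule eq_vecI)
    fix r assume "r < dim_vec (0\<^sub>v n :: 'b vec)"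
    then have r: "r < n" by simp
    have "0 = (\<Sum>k<n. P $$ (r,k) * c $ k)" using mult_vec_index[OF P cc r] Pc r by simp
    also have "\<dots> = (\<Sum>k\<in>{j}. P $$ (r,k) * c $ k)"
      by (rule sum.mono_neutral_right) (use c0 j in auto)
    finally show "col P j $ r = 0\<^sub>v n $ r" using j P r by simp
  qed (use P in simp)
  then show False using ne[OF j(1)] by simp
qed

interpretation to_ac_hom: field_hom "to_ac :: 'b::field \<Rightarrow> 'b alg_closure"
  by unfold_locales auto

text \<open>A nonzero discriminant survives the field extension and makes the characteristic
  polynomial coprime to its derivative. So its n roots in the closure are distinct, and eigenvectors
  for them form an invertible matrix.\<close>

lemma rss_diagonalizable:
  fixes x :: "'b::field mat"
  assumes x: "x \<in> G_rss n"
  obtains P Q :: "'b alg_closure mat" and d where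
    "P \<in> carrier_mat n n" "Q \<in> carrier_mat n n" "P * Q = 1\<^sub>m n" "Q * P = 1\<^sub>m n"
    "inj_on d {..<n}" "map_mat to_ac x * P = P * mat_diag n d"
proof -
  let ?A = "map_mat to_ac x"
  have xc: "x \<in> carrier_mat n n" and D: "Delta x \<noteq> 0" using x by (auto simp: G_rss_def GL_def)
  have A: "?A \<in> carrier_mat n n" using xc by simp
  define p where "p = char_poly ?A"
  have p_eq: "p = map_poly to_ac (char_poly x)" unfolding p_def by (rule to_ac_hom.char_poly_hom[OF xc])
  have deg: "degree p = n" "coeff p n = 1" unfolding p_def using degree_monic_char_poly[OF A] by auto
  have p0: "p \<noteq> 0" using deg(2) by auto
  have "resultant (char_poly x) (pderiv (char_poly x)) \<noteq> 0" using D by (auto simp: Delta_def disc_def)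
  then have "resultant p (pderiv p) \<noteq> 0"
    unfolding p_eq to_ac_hom.map_poly_pderiv[symmetric] to_ac_hom.resultant_hom by simp
  then have g0: "degree (gcd p (pderiv p)) = 0" using resultant_0_gcd[of p "pderiv p"] by blast
  obtain M where M: "size M = degree p" "p = smult (lead_coeff p) (\<Prod>x\<in>#M. [:-x, 1:])"
    using alg_closed_imp_factorization[OF p0] by blast
  obtain xs where xs: "mset xs = M" using ex_mset by blast
  have len: "length xs = n" using M(1) deg xs by (metis size_mset)
  have pxs: "p = (\<Prod>a\<leftarrow>xs. [:-a, 1:])"
  proof -
    have "p = (\<Prod>x\<in>#M. [:-x, 1:])" using M(2) deg by simp
    also have "\<dots> = (\<Prod>a\<leftarrow>xs. [:-a, 1:])" unfolding xs[symmetric] prod_mset_prod_list[symmetric] by simp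
    finally show ?thesis .
  qed
  have dist: "distinct xs"
  proof (rule ccontr)
    assume "\<not> distinct xs"
    then obtain as bs cs a where dec: "xs = as @ [a] @ bs @ [a] @ cs" using not_distinct_decomp by blast
    let ?l = "[:-a, 1:]"
    define r where "r = (\<Prod>a\<leftarrow>as. [:-a, 1:]) * (\<Prod>a\<leftarrow>bs. [:-a, 1:]) * (\<Prod>a\<leftarrow>cs. [:-a, 1:])"
    have pr: "p = ?l * (?l * r)" unfolding pxs dec r_def
      by (simp only: map_append prod_list.append list.map prod_list.Cons prod_list.Nil mult_1_left mult_1_right ac_simps)
    then have "pderiv p = ?l * (pderiv (?l * r)) + (?l * r) * pderiv ?l" by (simp only: pderiv_mult)
    then have "pderiv p = ?l * (pderiv (?l * r) + r * pderiv ?l)" by (simp only: distrib_left mult.assoc)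
    then have "?l dvd pderiv p" by (rule dvdI)
    moreover have "?l dvd p" using pr by (rule dvdI)
    ultimately have "?l dvd gcd p (pderiv p)" by simp
    moreover have "gcd p (pderiv p) \<noteq> 0" using p0 by simp
    ultimately have "degree ?l \<le> degree (gcd p (pderiv p))" by (rule dvd_imp_degree_le)
    then show False using g0 by simp
  qed
  have "\<exists>e. eigenvector ?A e (xs ! j)" if j: "j < n" for j
  proof -
    have "poly p (xs ! j) = 0" unfolding pxs poly_prod_list prod_list_zero_iff using j len
      by (auto simp: image_iff intro!: bexI[of _ "xs ! j"])
    then show ?thesis using eigenvalue_root_char_poly[OF A] unfolding p_def eigenvalue_def by blast
  qed
  then obtain e where e: "\<And>j. j < n \<Longrightarrow> eigenvector ?A (e j) (xs ! j)" by metis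
  have ec: "e j \<in> carrier_vec n" "e j \<noteq> 0\<^sub>v n" "?A *\<^sub>v e j = (xs ! j) \<cdot>\<^sub>v e j" if "j < n" for j
    using e[OF that] xc unfolding eigenvector_def by auto
  define P where "P = Matrix.mat n n (\<lambda>(i,j). e j $ i)"
  have P: "P \<in> carrier_mat n n" by (simp add: P_def)
  have AP: "?A * P = P * mat_diag n (\<lambda>j. xs ! j)"
  proof (rule eq_matI)
    fix i j assume "i < dim_row (P * mat_diag n (\<lambda>j. xs ! j))" "j < dim_col (P * mat_diag n (\<lambda>j. xs ! j))"
    then have ij: "i < n" "j < n" using P by (auto simp: mat_diag_def)
    have "(?A * P) $$ (i,j) = (\<Sum>k<n. ?A $$ (i,k) * e j $ k)"
      unfolding mult_index[OF A P ij] using ij by (intro sum.cong) (auto simp: P_def)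
    also have "\<dots> = (?A *\<^sub>v e j) $ i" using mult_vec_index[OF A ec(1)[OF ij(2)] ij(1)] by simp
    also have "\<dots> = xs ! j * e j $ i" unfolding ec(3)[OF ij(2)] using ec(1)[OF ij(2)] ij by simp
    finally show "(?A * P) $$ (i,j) = (P * mat_diag n (\<lambda>j. xs ! j)) $$ (i,j)"
      unfolding mult_diag_index[OF P ij] using ij by (simp add: P_def mult.commute)
  qed (use A P in \<open>auto simp: mat_diag_def\<close>)
  have inj: "inj_on (\<lambda>j. xs ! j) {..<n}" using dist len by (auto simp: inj_on_def nth_eq_iff_index_eq)
  have "col P j \<noteq> 0\<^sub>v n" if j: "j < n" for j
  proof -
    have "col P j = e j" using ec(1)[OF j] j by (intro eq_vecI) (auto simp: P_def)
    then show ?thesis using ec(2)[OF j] by simp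
  qed
  then have "det P \<noteq> 0" by (rule eigenvector_matrix_invertible[OF A P AP inj])
  from matinv[OF P this] show ?thesis by (intro that[OF P _ _ _ inj AP])
qed

section \<open>The valuation map of a regular torus\<close>

context local_field
begin

definition mvge :: "nat \<Rightarrow> 'a mat \<Rightarrow> int \<Rightarrow> bool" where
  "mvge n g k \<longleftrightarrow> (\<forall>i<n. \<forall>j<n. vge v (g $$ (i,j)) k)"

text \<open>The functions t i are the valuations of the eigenvalues, for a fixed ordering of the
  characters of the torus.\<close>

definition torus_valuation :: "nat \<Rightarrow> 'a mat \<Rightarrow> (nat \<Rightarrow> 'a mat \<Rightarrow> real) \<Rightarrow> int \<Rightarrow> bool" where
  "torus_valuation n x t B \<longleftrightarrow>
    (\<forall>g\<in>centralizer n x. \<forall>h\<in>centralizer n x. g * h = h * g) \<and>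
    (\<forall>g\<in>centralizer n x. \<forall>h\<in>centralizer n x. \<forall>i<n. t i (g * h) = t i g + t i h) \<and>
    (\<forall>h\<in>centralizer n x. \<forall>i<n. \<forall>J. mvge n h J \<longrightarrow> t i h \<ge> real_of_int J) \<and>
    (\<forall>h\<in>centralizer n x. (\<forall>i<n. t i h \<ge> 0) \<longrightarrow> mvge n h (- B)) \<and>
    (\<forall>h\<in>centralizer n x. \<forall>i<n. fact n * t i h \<in> \<int>)"

text \<open>The eigenvector matrix \<open>P\<close> of x diagonalizes the whole centralizer, because
  a matrix commuting with a diagonal matrix of distinct entries is diagonal. The coordinates are the
  resulting characters followed by an extended valuation.\<close>

lemma torus_valuation_exists:
  assumes x: "x \<in> G_rss n"
  shows "\<exists>t B. torus_valuation n x t B"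
proof -
  obtain P Q :: "'a alg_closure mat" and d where PQ: "P \<in> carrier_mat n n" "Q \<in> carrier_mat n n"
    "P * Q = 1\<^sub>m n" "Q * P = 1\<^sub>m n" "inj_on d {..<n}" "map_mat to_ac x * P = P * mat_diag n d"
    using rss_diagonalizable[OF x] by blast
  obtain w where "extends_valuation w" using valuation_extension by blast
  note w = extends_valuationD[OF this]
  define wge where "wge y r \<longleftrightarrow> y = 0 \<or> w y \<ge> r" for y r
  have wge_add: "wge (y + z) r" if "wge y r" "wge z r" for y z r
    using that w(3)[of y z] by (cases "y = 0"; cases "z = 0"; cases "y + z = 0") (auto simp: wge_def)
  have wge_sum: "wge (sum f A) r" if "\<And>i. i \<in> A \<Longrightarrow> wge (f i) r" for f :: "nat \<Rightarrow> _" and A r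
    using that by (induction A rule: infinite_finite_induct) (auto simp: wge_add, auto simp: wge_def)
  have wge_mult: "wge (y * z) (r + s)" if "wge y r" "wge z s" for y z r s
    using that w(2)[of y z] by (cases "y = 0"; cases "z = 0") (auto simp: wge_def)
  have wge_to_ac: "wge (to_ac a) (real_of_int J) \<longleftrightarrow> vge v a J" for a J
    using w(1)[of a] by (cases "a = 0") (auto simp: wge_def vge_def)
  define H where "H h = Q * (map_mat to_ac h * P)" for h
  define c where "c i h = H h $$ (i,i)" for i h
  have xc: "x \<in> carrier_mat n n" using x by (auto simp: G_rss_def GL_def)
  have cc: "h \<in> carrier_mat n n" "det h \<noteq> 0" "h * x = x * h" if "h \<in> centralizer n x" for h
    using that by (auto simp: centralizer_def GL_def)
  have mc: "map_mat to_ac h \<in> carrier_mat n n" if "h \<in> carrier_mat n n" for h :: "'a mat" using that by simp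
  note assoc = assoc_mult_mat[of _ n n _ n _ n]
  have Hc: "H h \<in> carrier_mat n n" if "h \<in> centralizer n x" for h
    unfolding H_def using PQ cc(1)[OF that] by (metis mc mult_carrier_mat)
  have PH: "P * H h = map_mat to_ac h * P" if h: "h \<in> centralizer n x" for h
  proof -
    have m: "map_mat to_ac h * P \<in> carrier_mat n n" using mc[OF cc(1)[OF h]] PQ(1) by (rule mult_carrier_mat)
    have "P * H h = (P * Q) * (map_mat to_ac h * P)" unfolding H_def using assoc[OF PQ(1,2) m] by simp
    then show ?thesis unfolding PQ(3) using left_mult_one_mat[OF m] by simp
  qed
  have Hdiag: "H h = mat_diag n (\<lambda>i. c i h)" if h: "h \<in> centralizer n x" for h
  proof (rule eq_matI)
    let ?h = "map_mat to_ac h" and ?x = "map_mat to_ac x" and ?D = "mat_diag n d"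
    fix i j assume "i < dim_row (mat_diag n (\<lambda>i. c i h))" "j < dim_col (mat_diag n (\<lambda>i. c i h))"
    then have ij: "i < n" "j < n" by (auto simp: mat_diag_def)
    have hx: "?h * ?x = ?x * ?h"
      using cc(3)[OF h] to_ac_hom.mat_hom_mult[OF cc(1)[OF h] xc] to_ac_hom.mat_hom_mult[OF xc cc(1)[OF h]] by simp
    have D: "?D \<in> carrier_mat n n" by simp
    note C = PQ(1,2) mc[OF cc(1)[OF h]] mc[OF xc] D Hc[OF h]
    have "P * (H h * ?D) = (P * H h) * ?D" using assoc[OF C(1,6,5)] by simp
    also have "\<dots> = ?h * (P * ?D)" unfolding PH[OF h] using assoc[OF C(3,1,5)] by simp
    also have "\<dots> = (?h * ?x) * P" unfolding PQ(6)[symmetric] using assoc[OF C(3,4,1)] by simp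
    also have "\<dots> = ?x * (P * H h)" unfolding hx PH[OF h] using assoc[OF C(4,3,1)] by simp
    also have "\<dots> = (P * ?D) * H h" unfolding PQ(6)[symmetric] using assoc[OF C(4,1,6)] by simp
    also have "\<dots> = P * (?D * H h)" using assoc[OF C(1,5,6)] by simp
    finally have e: "P * (H h * ?D) = P * (?D * H h)" .
    have "H h * ?D = (Q * P) * (H h * ?D)" unfolding PQ(4) using left_mult_one_mat[of "H h * ?D" n n] C by (metis mult_carrier_mat)
    also have "\<dots> = Q * (P * (H h * ?D))" using assoc[OF C(2,1), of "H h * ?D"] C by (metis mult_carrier_mat)
    also have "\<dots> = (Q * P) * (?D * H h)" unfolding e using assoc[OF C(2,1), of "?D * H h"] C by (metis mult_carrier_mat)
    also have "\<dots> = ?D * H h" unfolding PQ(4) using left_mult_one_mat[of "?D * H h" n n] C by (metis mult_carrier_mat)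
    finally have "(H h * ?D) $$ (i,j) = (?D * H h) $$ (i,j)" by simp
    then have "H h $$ (i,j) * d j = d i * H h $$ (i,j)"
      unfolding mult_diag_index[OF Hc[OF h] ij] diag_mult_index[OF Hc[OF h] ij] .
    then have "(d j - d i) * H h $$ (i,j) = 0" by (simp add: algebra_simps)
    then have "i \<noteq> j \<Longrightarrow> H h $$ (i,j) = 0" using PQ(5) ij by (auto simp: inj_on_def)
    then show "H h $$ (i,j) = mat_diag n (\<lambda>i. c i h) $$ (i,j)" using ij by (auto simp: mat_diag_def c_def)
  qed (use Hc[OF h] in \<open>auto simp: mat_diag_def\<close>)
  have hrep: "map_mat to_ac h = P * (mat_diag n (\<lambda>i. c i h) * Q)" if h: "h \<in> centralizer n x" for h
  proof -
    note C = PQ(1,2) mc[OF cc(1)[OF h]] Hc[OF h]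
    have "P * (H h * Q) = (P * H h) * Q" using assoc[OF C(1,4,2)] by simp
    also have "\<dots> = map_mat to_ac h * (P * Q)" unfolding PH[OF h] using assoc[OF C(3,1,2)] by simp
    also have "\<dots> = map_mat to_ac h" unfolding PQ(3) using right_mult_one_mat[OF C(3)] by simp
    finally show ?thesis unfolding Hdiag[OF h] by simp
  qed
  have cent_mult: "g * h \<in> centralizer n x" if g: "g \<in> centralizer n x" and h: "h \<in> centralizer n x" for g h
  proof -
    note C = cc(1)[OF g] cc(1)[OF h] xc
    have "(g * h) * x = g * (x * h)" using assoc[OF C] cc(3)[OF h] by simp
    also have "\<dots> = (x * g) * h" using assoc[OF C(1,3,2)] cc(3)[OF g] by simp
    also have "\<dots> = x * (g * h)" using assoc[OF C(3,1,2)] by simp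
    finally show ?thesis using C cc(2)[OF g] cc(2)[OF h] det_mult[OF C(1,2)] by (auto simp: centralizer_def GL_def)
  qed
  have Hmult: "H (g * h) = H g * H h" if g: "g \<in> centralizer n x" and h: "h \<in> centralizer n x" for g h
  proof -
    let ?g = "map_mat to_ac g" and ?h = "map_mat to_ac h"
    note C = PQ(1,2) mc[OF cc(1)[OF g]] mc[OF cc(1)[OF h]] Hc[OF h]
    have gP: "?g * P \<in> carrier_mat n n" using C(3,1) by (rule mult_carrier_mat)
    have "H g * H h = Q * ((?g * P) * H h)" unfolding H_def[of g] using assoc[OF C(2) gP C(5)] .
    also have "(?g * P) * H h = ?g * (?h * P)" using assoc[OF C(3,1,5)] PH[OF h] by simp
    also have "\<dots> = (?g * ?h) * P" using assoc[OF C(3,4,1)] by simp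
    also have "?g * ?h = map_mat to_ac (g * h)" using to_ac_hom.mat_hom_mult[OF cc(1)[OF g] cc(1)[OF h]] by simp
    finally show ?thesis by (simp add: H_def)
  qed
  have c_mult: "c i (g * h) = c i g * c i h" if g: "g \<in> centralizer n x" and h: "h \<in> centralizer n x" and i: "i < n" for g h i
  proof -
    have "c i (g * h) = (H g * mat_diag n (\<lambda>i. c i h)) $$ (i,i)" unfolding c_def[of _ "g * h"] Hmult[OF g h] Hdiag[OF h] ..
    then show ?thesis unfolding mult_diag_index[OF Hc[OF g] i i] by (simp add: c_def)
  qed
  have comm: "g * h = h * g" if g: "g \<in> centralizer n x" and h: "h \<in> centralizer n x" for g h
  proof -
    have "H (g * h) = H (h * g)" unfolding Hmult[OF g h] Hmult[OF h g] Hdiag[OF g] Hdiag[OF h] by (simp add: mult.commute)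
    then have "map_mat to_ac (g * h) = map_mat to_ac (h * g)"
      using hrep[OF cent_mult[OF g h]] hrep[OF cent_mult[OF h g]] by (simp add: c_def)
    then show ?thesis by (rule to_ac_hom.mat_hom_inj)
  qed
  have ev: "c i h * P $$ (r,i) = (\<Sum>s<n. to_ac (h $$ (r,s)) * P $$ (s,i))" if h: "h \<in> centralizer n x" and i: "i < n" and r: "r < n" for i h r
  proof -
    have "(P * mat_diag n (\<lambda>i. c i h)) $$ (r,i) = (map_mat to_ac h * P) $$ (r,i)" using PH[OF h] Hdiag[OF h] by simp
    then have "P $$ (r,i) * c i h = (\<Sum>s<n. map_mat to_ac h $$ (r,s) * P $$ (s,i))"
      unfolding mult_diag_index[OF PQ(1) r i] mult_index[OF mc[OF cc(1)[OF h]] PQ(1) r i] .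
    also have "\<dots> = (\<Sum>s<n. to_ac (h $$ (r,s)) * P $$ (s,i))" using cc(1)[OF h] r by (intro sum.cong) auto
    finally show ?thesis by (simp add: mult.commute)
  qed
  have colP: "\<exists>r<n. P $$ (r,i) \<noteq> 0" if i: "i < n" for i
  proof (rule ccontr)
    assume "\<not> ?thesis"
    then have "(Q * P) $$ (i,i) = 0" unfolding mult_index[OF PQ(2,1) i i] by (intro sum.neutral) auto
    then show False using PQ(4) i by simp
  qed
  have eig: "eigenvector (map_mat to_ac h) (col P i) (c i h)" if h: "h \<in> centralizer n x" and i: "i < n" for h i
  proof -
    have "col P i \<noteq> 0\<^sub>v n"
    proof
      assume z: "col P i = 0\<^sub>v n"
      obtain r where r: "r < n" "P $$ (r,i) \<noteq> 0" using colP[OF i] by blast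
      have "col P i $ r = P $$ (r,i)" using PQ(1) r i by simp
      then show False using z r by simp
    qed
    moreover have "map_mat to_ac h *\<^sub>v col P i = c i h \<cdot>\<^sub>v col P i"
    proof (rule eq_vecI)
      fix r assume "r < dim_vec (c i h \<cdot>\<^sub>v col P i)"
      then have r: "r < n" using PQ(1) by simp
      have "(map_mat to_ac h *\<^sub>v col P i) $ r = (\<Sum>s<n. map_mat to_ac h $$ (r,s) * col P i $ s)"
        by (rule mult_vec_index[OF mc[OF cc(1)[OF h]] _ r]) (use PQ(1) in auto)
      also have "\<dots> = (\<Sum>s<n. to_ac (h $$ (r,s)) * P $$ (s,i))"
        by (rule sum.cong) (use cc(1)[OF h] PQ(1) r i in auto)
      finally show "(map_mat to_ac h *\<^sub>v col P i) $ r = (c i h \<cdot>\<^sub>v col P i) $ r"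
        using ev[OF h i r] PQ(1) r i by simp
    qed (use PQ(1) cc(1)[OF h] in auto)
    ultimately show ?thesis unfolding eigenvector_def using PQ(1) cc(1)[OF h] by auto
  qed
  have c0: "c i h \<noteq> 0" if h: "h \<in> centralizer n x" and i: "i < n" for h i
  proof
    assume "c i h = 0"
    then have "map_mat to_ac h *\<^sub>v col P i = 0\<^sub>v n" "col P i \<in> carrier_vec n" "col P i \<noteq> 0\<^sub>v n"
      using eig[OF h i] PQ(1) cc(1)[OF h] unfolding eigenvector_def by auto
    then have "det (map_mat to_ac h) = 0" using det_0_iff_vec_prod_zero[OF mc[OF cc(1)[OF h]]] by blast
    then show False using cc(2)[OF h] by simp
  qed
  have bnd: "\<exists>\<beta>. \<forall>i<n. \<forall>j<n. wge (A $$ (i,j)) \<beta>" for A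
  proof -
    let ?S = "insert 0 ((\<lambda>(i,j). w (A $$ (i,j))) ` ({..<n} \<times> {..<n}))"
    have "wge (A $$ (i,j)) (Min ?S)" if "i < n" "j < n" for i j
      unfolding wge_def using that by (intro disjI2 Min_le) auto
    then show ?thesis by blast
  qed
  obtain \<beta> where \<beta>: "\<forall>i<n. \<forall>j<n. wge (P $$ (i,j)) \<beta>" using bnd by blast
  obtain \<gamma> where \<gamma>: "\<forall>i<n. \<forall>j<n. wge (Q $$ (i,j)) \<gamma>" using bnd by blast
  \<comment> \<open>\<open>\<beta>\<close> and \<open>\<gamma>\<close> bound the values of the
    entries of \<open>P\<close> and \<open>Q\<close> from below. If the diagonal has nonnegative
    values, the entries of h = P diag Q have value at least their sum; the floor makes this an
    integer bound.\<close>
  have "torus_valuation n x (\<lambda>i h. w (c i h)) (- \<lfloor>\<beta> + \<gamma>\<rfloor>)"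
    unfolding torus_valuation_def
  proof (intro conjI ballI allI impI)
    show "g * h = h * g" if "g \<in> centralizer n x" "h \<in> centralizer n x" for g h using comm[OF that] .
    show "w (c i (g * h)) = w (c i g) + w (c i h)" if "g \<in> centralizer n x" "h \<in> centralizer n x" "i < n" for g h i
      using w(2)[OF c0[OF that(1,3)] c0[OF that(2,3)]] c_mult[OF that] by simp
    show "w (c i h) \<ge> real_of_int J" if h: "h \<in> centralizer n x" and i: "i < n" and J: "mvge n h J" for h i J
    proof -
      \<comment> \<open>Evaluate the eigenvalue equation in the row where the eigenvector has least
        value: every term of the sum has value at least J plus that least value.\<close>
      let ?S = "{r. r < n \<and> P $$ (r,i) \<noteq> 0}"
      have S: "finite ?S" "?S \<noteq> {}" using colP[OF i] by auto
      let ?f = "\<lambda>r. w (P $$ (r,i))"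
      have "Min (?f ` ?S) \<in> ?f ` ?S" using S by (intro Min_in) simp_all
      then obtain r where r1: "r \<in> ?S" "Min (?f ` ?S) = ?f r" by blast
      have r: "r \<in> ?S" "?f r \<le> ?f s" if "s \<in> ?S" for s
        using r1 Min_le[of "?f ` ?S" "?f s"] S(1) that by simp_all
      have rn: "r < n" "P $$ (r,i) \<noteq> 0" using r1(1) by auto
      have "wge (\<Sum>s<n. to_ac (h $$ (r,s)) * P $$ (s,i)) (real_of_int J + w (P $$ (r,i)))"
      proof (rule wge_sum, rule wge_mult)
        fix s assume "s \<in> {..<n}"
        then have s: "s < n" by simp
        show "wge (to_ac (h $$ (r,s))) (real_of_int J)" using J rn s unfolding wge_to_ac mvge_def by blast
        show "wge (P $$ (s,i)) (w (P $$ (r,i)))" using r(2)[of s] s by (auto simp: wge_def)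
      qed
      then have "w (c i h * P $$ (r,i)) \<ge> real_of_int J + w (P $$ (r,i))"
        unfolding ev[OF h i rn(1), symmetric] wge_def using c0[OF h i] rn(2) by simp
      then show ?thesis using w(2)[OF c0[OF h i] rn(2)] by simp
    qed
    show "mvge n h (- (- \<lfloor>\<beta> + \<gamma>\<rfloor>))" if h: "h \<in> centralizer n x" and pos: "\<forall>i<n. w (c i h) \<ge> 0" for h
      unfolding mvge_def
    proof (intro allI impI)
      fix a b assume ab: "a < n" "b < n"
      have DQ: "mat_diag n (\<lambda>i. c i h) * Q \<in> carrier_mat n n" using PQ(2) by (metis mat_diag_dim mult_carrier_mat)
      have "to_ac (h $$ (a,b)) = map_mat to_ac h $$ (a,b)" using cc(1)[OF h] ab by simp
      also have "\<dots> = (\<Sum>i<n. P $$ (a,i) * (mat_diag n (\<lambda>i. c i h) * Q) $$ (i,b))"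
        unfolding hrep[OF h] by (rule mult_index[OF PQ(1) DQ ab])
      also have "\<dots> = (\<Sum>i<n. P $$ (a,i) * (c i h * Q $$ (i,b)))"
        by (rule sum.cong) (auto simp: diag_mult_index[OF PQ(2) _ ab(2)])
      finally have e: "to_ac (h $$ (a,b)) = (\<Sum>i<n. P $$ (a,i) * (c i h * Q $$ (i,b)))" .
      have "wge (\<Sum>i<n. P $$ (a,i) * (c i h * Q $$ (i,b))) (\<beta> + (0 + \<gamma>))"
        by (intro wge_sum wge_mult) (use \<beta> \<gamma> ab pos in \<open>auto simp: wge_def\<close>)
      then have "wge (to_ac (h $$ (a,b))) (real_of_int \<lfloor>\<beta> + \<gamma>\<rfloor>)" unfolding e[symmetric] wge_def
        by (auto intro: order_trans[OF of_int_floor_le])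
      then show "vge v (h $$ (a,b)) (- (- \<lfloor>\<beta> + \<gamma>\<rfloor>))" unfolding wge_to_ac by simp
    qed
    show "fact n * w (c i h) \<in> \<int>" if h: "h \<in> centralizer n x" and i: "i < n" for h i
    proof -
      \<comment> \<open>The eigenvalue is a root of a polynomial of degree n over the base field;
        this is the origin of the factor n!.\<close>
      have dm: "degree (char_poly h) = n" "coeff (char_poly h) n = 1" using degree_monic_char_poly[OF cc(1)[OF h]] by auto
      then have "char_poly h \<noteq> 0" by auto
      moreover have "poly (map_poly to_ac (char_poly h)) (c i h) = 0"
        unfolding to_ac_hom.char_poly_hom[OF cc(1)[OF h], symmetric] eigenvalue_root_char_poly[OF mc[OF cc(1)[OF h]], symmetric]
        eigenvalue_def using eig[OF h i] by blast
      ultimately show ?thesis using w(4)[OF c0[OF h i]] dm by metis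
    qed
  qed
  then show ?thesis by blast
qed

section \<open>The congruence filtration of the general linear group\<close>

lemma mvgeI: "(\<And>i j. i < n \<Longrightarrow> j < n \<Longrightarrow> vge v (g $$ (i,j)) k) \<Longrightarrow> mvge n g k"
  by (simp add: mvge_def)

lemma mvgeD: "mvge n g k \<Longrightarrow> i < n \<Longrightarrow> j < n \<Longrightarrow> vge v (g $$ (i,j)) k"
  by (simp add: mvge_def)

lemma mvge_mono: "mvge n g k \<Longrightarrow> l \<le> k \<Longrightarrow> mvge n g l"
  unfolding mvge_def by (blast intro: vge_mono)

lemma mvge_mult:
  assumes "A \<in> carrier_mat n n" "B \<in> carrier_mat n n" "mvge n A a" "mvge n B b"
  shows "mvge n (A * B) (a + b)"
proof (rule mvgeI)
  fix i j assume ij: "i < n" "j < n"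
  show "vge v ((A * B) $$ (i,j)) (a + b)"
    unfolding mult_index[OF assms(1,2) ij]
    by (intro vge_sum vge_mult mvgeD[OF assms(3)] mvgeD[OF assms(4)]) (use ij in auto)
qed

lemma mvge_add: 
  assumes "A \<in> carrier_mat n n" "B \<in> carrier_mat n n" "mvge n A a" "mvge n B a"
  shows "mvge n (A + B) a"
  using assms by (auto simp: mvge_def intro: vge_add)

lemma mvge_diff:
  assumes "A \<in> carrier_mat n n" "B \<in> carrier_mat n n" "mvge n A a" "mvge n B a"
  shows "mvge n (A - B) a"
  using assms by (auto simp: mvge_def intro: vge_diff)

lemma mvge_one: "mvge n (1\<^sub>m n) 0"
  by (auto simp: mvge_def one_mat_def)

lemma mvge_bounded: "\<exists>b::nat. mvge n g (- int b)"
proof -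
  let ?S = "insert 0 ((\<lambda>(i,j). v (g $$ (i,j))) ` ({..<n} \<times> {..<n}))"
  have "mvge n g (Min ?S)"
  proof (rule mvgeI)
    fix i j assume "i < n" "j < n"
    then have "v (g $$ (i,j)) \<in> ?S" by (intro insertI2 image_eqI[of _ _ "(i,j)"]) simp_all
    then have "Min ?S \<le> v (g $$ (i,j))" by (intro Min_le) simp_all
    then show "vge v (g $$ (i,j)) (Min ?S)" by (simp add: vge_def)
  qed
  moreover have "z \<ge> - int (nat (- z))" for z by simp
  ultimately have "mvge n g (- int (nat (- Min ?S)))" by (rule mvge_mono)
  then show ?thesis by blast
qed

lemma vge_sign: "vge v (of_int (sign p)) 0"
  by (cases "sign p = 1") (auto simp: sign_def vge_def)

lemma vge_det:
  assumes A: "A \<in> carrier_mat m m" "\<And>i j. i < m \<Longrightarrow> j < m \<Longrightarrow> vge v (A $$ (i,j)) k"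
  shows "vge v (det A) (int m * k)"
proof -
  have "vge v (of_int (sign p) * (\<Prod>i = 0..<m. A $$ (i, p i))) (0 + int (card {0..<m}) * k)" if p: "p permutes {0..<m}" for p
  proof (intro vge_mult vge_sign vge_prod)
    fix i assume "i \<in> {0..<m}"
    then show "vge v (A $$ (i, p i)) k" using permutes_in_image[OF p, of i] by (intro A(2)) auto
  qed
  then show ?thesis unfolding det_def'[OF A(1)] by (intro vge_sum) auto
qed

text \<open>Cramer's rule: cofactors are determinants of size n - 1, and dividing by the determinant
  costs its valuation.\<close>

lemma mvge_matinv:
  assumes g: "g \<in> carrier_mat n n" "det g \<noteq> 0" and k: "mvge n g k"
  shows "mvge n (matinv g) (int (n - 1) * k - v (det g))"
proof (rule mvgeI)
  fix i j assume ij: "i < n" "j < n"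
  have del: "mat_delete g j i \<in> carrier_mat (n - 1) (n - 1)" using mat_delete_carrier[OF g(1)] .
  have "vge v (det (mat_delete g j i)) (int (n - 1) * k)"
  proof (rule vge_det[OF del])
    fix a b assume "a < n - 1" "b < n - 1"
    then show "vge v (mat_delete g j i $$ (a,b)) k" using g(1) mvgeD[OF k] by (auto simp: mat_delete_def)
  qed
  moreover have "vge v ((-1) ^ (j + i)) 0" by (simp add: vge_def v_power)
  ultimately have "vge v (cofactor g j i) (0 + int (n - 1) * k)" unfolding cofactor_def by (intro vge_mult)
  then have "vge v (inverse (det g) * cofactor g j i) (- v (det g) + (0 + int (n - 1) * k))"
    using g(2) by (intro vge_mult) (auto simp: vge_def v_inverse)
  moreover have "matinv g $$ (i,j) = inverse (det g) * cofactor g j i"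
    using g(1) ij by (simp add: matinv_def adj_mat_def)
  ultimately show "vge v (matinv g $$ (i,j)) (int (n - 1) * k - v (det g))" by (simp add: algebra_simps)
qed

lemma vge_prod_one:
  assumes "finite S" "\<And>i. i \<in> S \<Longrightarrow> vge v (a i - 1) 1"
  shows "vge v (prod a S - 1) 1"
  using assms
proof (induction S rule: finite_induct)
  case (insert i S)
  have "vge v ((a i - 1) * (prod a S - 1)) (1 + 1)" using insert by (intro vge_mult) auto
  then have "vge v ((a i - 1) * (prod a S - 1)) 1" by (rule vge_mono) simp
  then have "vge v ((a i - 1) * (prod a S - 1) + (a i - 1) + (prod a S - 1)) 1" using insert by (intro vge_add) auto
  moreover have "a i * prod a S - 1 = (a i - 1) * (prod a S - 1) + (a i - 1) + (prod a S - 1)" by (simp add: algebra_simps)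
  ultimately have "vge v (a i * prod a S - 1) 1" by (simp only:)
  then show ?case using insert by simp
qed simp

text \<open>In the Leibniz expansion the identity permutation contributes 1 modulo the maximal
  ideal, and every other permutation uses an off-diagonal entry, which lies in that ideal. So this
  congruence alone forces a unit determinant.\<close>

lemma det_one_unit:
  assumes g: "g \<in> carrier_mat n n" and k: "mvge n (g - 1\<^sub>m n) 1"
  shows "det g \<noteq> 0" "v (det g) = 0" "mvge n g 0"
proof -
  have e: "vge v (g $$ (i,j) - (if i = j then 1 else 0)) 1" if "i < n" "j < n" for i j
    using mvgeD[OF k that] g that by simp
  have int: "vge v (g $$ (i,j)) 0" if "i < n" "j < n" for i j
  proof -
    have "vge v (g $$ (i,j) - (if i = j then 1 else 0)) 0" by (rule vge_mono[OF e[OF that]]) simp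
    moreover have "vge v (if i = j then 1 else 0) 0" by simp
    ultimately have "vge v (g $$ (i,j) - (if i = j then 1 else 0) + (if i = j then 1 else 0)) 0" by (rule vge_add)
    then show ?thesis by simp
  qed
  then show "mvge n g 0" by (intro mvgeI)
  let ?t = "\<lambda>p. of_int (sign p) * (\<Prod>i = 0..<n. g $$ (i, p i))"
  have fin: "finite {p. p permutes {0..<n}}" by (simp add: finite_permutations)
  have "det g = ?t id + sum ?t ({p. p permutes {0..<n}} - {id})"
    unfolding det_def'[OF g] by (rule sum.remove[OF fin]) (simp add: permutes_id)
  then have d: "det g - 1 = ((\<Prod>i = 0..<n. g $$ (i,i)) - 1) + sum ?t ({p. p permutes {0..<n}} - {id})"
    by simp
  have "vge v (sum ?t ({p. p permutes {0..<n}} - {id})) 1"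
  proof (rule vge_sum)
    fix p assume p': "p \<in> {p. p permutes {0..<n}} - {id}"
    then have p: "p permutes {0..<n}" "p \<noteq> id" by auto
    then obtain i where i: "p i \<noteq> i" by (auto simp: fun_eq_iff)
    then have i0: "i \<in> {0..<n}" using p(1) by (metis permutes_not_in)
    have pi: "p j < n" if "j < n" for j using permutes_in_image[OF p(1), of j] that by simp
    have "vge v (g $$ (i, p i)) 1" using e[of i "p i"] i i0 pi by auto
    moreover have "vge v (\<Prod>j\<in>{0..<n} - {i}. g $$ (j, p j)) (int (card ({0..<n} - {i})) * 0)"
      by (rule vge_prod) (use int pi in auto)
    ultimately have "vge v (g $$ (i, p i) * (\<Prod>j\<in>{0..<n} - {i}. g $$ (j, p j))) (1 + int (card ({0..<n} - {i})) * 0)"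
      by (rule vge_mult)
    then have "vge v (\<Prod>j = 0..<n. g $$ (j, p j)) 1" using prod.remove[of "{0..<n}" i "\<lambda>j. g $$ (j, p j)"] i0 by simp
    from vge_mult[OF vge_sign[of p] this] show "vge v (?t p) 1" by simp
  qed
  moreover have "vge v ((\<Prod>i = 0..<n. g $$ (i,i)) - 1) 1"
    by (rule vge_prod_one) (use e in force)+
  ultimately have d1: "vge v (det g - 1) 1" unfolding d by (rule vge_add[rotated])
  have d0: "vge v (det g) 0" using vge_det[OF g int] by simp
  have nd: "\<not> vge v (det g) 1"
  proof
    assume "vge v (det g) 1"
    from vge_diff[OF this d1] have "vge v (1::'a) 1" by simp
    then show False by (simp add: vge_def)
  qed
  then show "det g \<noteq> 0" by auto
  then show "v (det g) = 0" using d0 nd by (auto simp: vge_def)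
qed

section \<open>The group and its congruence subgroups\<close>

lemma GL_carrier: "g \<in> GL n \<Longrightarrow> g \<in> carrier_mat n n" "g \<in> GL n \<Longrightarrow> det g \<noteq> 0"
  by (auto simp: GL_def)

lemma GL_mult: "g \<in> GL n \<Longrightarrow> h \<in> GL n \<Longrightarrow> g * h \<in> GL n"
  by (auto simp: GL_def det_mult)

lemma GL_one: "1\<^sub>m n \<in> GL n" by (simp add: GL_def)

lemma GL_matinv: 
  assumes g: "g \<in> GL n"
  shows "matinv g \<in> GL n" "g * matinv g = 1\<^sub>m n" "matinv g * g = 1\<^sub>m n" "det (matinv g) = inverse (det g)"
proof -
  note c = GL_carrier[OF g] and m = matinv[OF GL_carrier[OF g]]
  show "g * matinv g = 1\<^sub>m n" "matinv g * g = 1\<^sub>m n" using m by auto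
  have "det g * det (matinv g) = 1" using det_mult[OF c(1) m(1)] m(2) by simp
  then show "det (matinv g) = inverse (det g)" using c(2) by (simp add: field_simps)
  then show "matinv g \<in> GL n" using m(1) c(2) by (simp add: GL_def)
qed

definition GLg :: "nat \<Rightarrow> 'a mat monoid" where
  "GLg n = \<lparr>carrier = GL n, monoid.mult = (*), one = 1\<^sub>m n\<rparr>"

lemma GLg_simps [simp]: "carrier (GLg n) = GL n" "monoid.mult (GLg n) = (*)" "one (GLg n) = 1\<^sub>m n"
  by (simp_all add: GLg_def)

lemma group_GLg: "group (GLg n)"
proof (rule groupI)
  fix x y z assume "x \<in> carrier (GLg n)" "y \<in> carrier (GLg n)" "z \<in> carrier (GLg n)"
  then show "x \<otimes>\<^bsub>GLg n\<^esub> y \<otimes>\<^bsub>GLg n\<^esub> z = x \<otimes>\<^bsub>GLg n\<^esub> (y \<otimes>\<^bsub>GLg n\<^esub> z)"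
    using assoc_mult_mat[of x n n y n z n] by (simp add: GL_def)
next
  fix x assume x: "x \<in> carrier (GLg n)"
  then show "\<one>\<^bsub>GLg n\<^esub> \<otimes>\<^bsub>GLg n\<^esub> x = x" using GL_carrier(1)[of x n] by simp
  show "\<exists>y\<in>carrier (GLg n). y \<otimes>\<^bsub>GLg n\<^esub> x = \<one>\<^bsub>GLg n\<^esub>"
    using x GL_matinv[of x n] by (intro bexI[of _ "matinv x"]) auto
qed (auto simp: GL_mult GL_one)

lemma inv_GLg: "g \<in> GL n \<Longrightarrow> inv\<^bsub>GLg n\<^esub> g = matinv g"
  using group.inv_equality[OF group_GLg[of n], of "matinv g" g] GL_matinv[of g n] by simp

lemma ginv_matinv:
  assumes g: "g \<in> GL n"
  shows "ginv n g = matinv g"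
proof -
  note c = GL_carrier[OF g] and m = GL_matinv[OF g]
  let ?P = "\<lambda>h. h \<in> carrier_mat n n \<and> g * h = 1\<^sub>m n \<and> h * g = 1\<^sub>m n"
  have "?P (matinv g)" using m GL_carrier by blast
  then have P: "?P (ginv n g)" unfolding ginv_def by (rule someI[of ?P])
  have mc: "matinv g \<in> carrier_mat n n" using GL_carrier(1)[OF m(1)] .
  have gc: "ginv n g \<in> carrier_mat n n" using P by blast
  have "ginv n g = (matinv g * g) * ginv n g" using m(3) left_mult_one_mat[OF gc] by simp
  also have "\<dots> = matinv g * (g * ginv n g)" by (rule assoc_mult_mat[OF mc c(1) gc])
  also have "\<dots> = matinv g" using P right_mult_one_mat[OF mc] by simp
  finally show ?thesis .
qed

text \<open>At level 0 the congruence says nothing beyond integrality, so the intersection with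
  \<open>GL_O\<close> supplies the unit determinant there; from level 1 on,
  \<open>det_one_unit\<close> gives it.\<close>

definition Kc :: "nat \<Rightarrow> nat \<Rightarrow> 'a mat set" where
  "Kc n m = {g \<in> GL_O v n. mvge n (g - 1\<^sub>m n) (int m)}"

lemma GL_O_iff: "g \<in> GL_O v n \<longleftrightarrow> g \<in> GL n \<and> mvge n g 0 \<and> v (det g) = 0"
  by (auto simp: GL_O_def mvge_def)

lemma Kc_0: "Kc n 0 = GL_O v n"
proof -
  have "mvge n (g - 1\<^sub>m n) 0" if "g \<in> GL_O v n" for g
    using that GL_carrier(1)[of g n] mvge_diff[of g n "1\<^sub>m n" 0] mvge_one by (simp add: GL_O_iff)
  then show ?thesis by (auto simp: Kc_def)
qed

lemma Kc_GL: "g \<in> Kc n m \<Longrightarrow> g \<in> GL n" by (simp add: Kc_def GL_O_iff)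

lemma KcI:
  assumes g: "g \<in> carrier_mat n n" and k: "mvge n (g - 1\<^sub>m n) k" "k \<ge> 1" "k \<ge> int m"
  shows "g \<in> Kc n m"
proof -
  have "mvge n (g - 1\<^sub>m n) 1" by (rule mvge_mono[OF k(1,2)])
  from det_one_unit[OF g this] g have "g \<in> GL_O v n" by (simp add: GL_O_iff GL_def)
  then show ?thesis using mvge_mono[OF k(1,3)] by (simp add: Kc_def)
qed

lemma matinv_GL_O:
  assumes "g \<in> GL_O v n"
  shows "matinv g \<in> GL_O v n"
proof -
  have g: "g \<in> GL n" "mvge n g 0" "v (det g) = 0" using assms by (auto simp: GL_O_iff)
  have "mvge n (matinv g) 0" using mvge_matinv[OF GL_carrier[OF g(1)] g(2)] g(3) by simp
  moreover have "v (det (matinv g)) = 0" using GL_matinv(4)[OF g(1)] g(3) v_inverse[OF GL_carrier(2)[OF g(1)]] by simp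
  ultimately show ?thesis using GL_matinv(1)[OF g(1)] by (simp add: GL_O_iff)
qed

lemma GL_O_mult:
  assumes "g \<in> GL_O v n" "h \<in> GL_O v n"
  shows "g * h \<in> GL_O v n"
proof -
  have g: "g \<in> GL n" "mvge n g 0" "v (det g) = 0" and h: "h \<in> GL n" "mvge n h 0" "v (det h) = 0" using assms by (auto simp: GL_O_iff)
  note gc = GL_carrier[OF g(1)] and hc = GL_carrier[OF h(1)]
  have "mvge n (g * h) 0" using mvge_mult[OF gc(1) hc(1) g(2) h(2)] by simp
  moreover have "v (det (g * h)) = 0" using det_mult[OF gc(1) hc(1)] v_mult[OF gc(2) hc(2)] g(3) h(3) by simp
  ultimately show ?thesis using GL_mult[OF g(1) h(1)] by (simp add: GL_O_iff)
qed

lemma minus_one_mult: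
  fixes g h :: "'a mat"
  assumes g: "g \<in> carrier_mat n n" and h: "h \<in> carrier_mat n n"
  shows "g * h - 1\<^sub>m n = (g - 1\<^sub>m n) * h + (h - 1\<^sub>m n)" "g * (h - 1\<^sub>m n) = g * h - g"
proof -
  have "(g - 1\<^sub>m n) * h = g * h - 1\<^sub>m n * h" by (rule minus_mult_distrib_mat[OF g _ h]) simp
  then show "g * h - 1\<^sub>m n = (g - 1\<^sub>m n) * h + (h - 1\<^sub>m n)" using g h by (intro eq_matI) auto
  have "g * (h - 1\<^sub>m n) = g * h - g * 1\<^sub>m n" by (rule mult_minus_distrib_mat[OF g h]) simp
  then show "g * (h - 1\<^sub>m n) = g * h - g" using g by simp
qed

lemma Kc_subgroup: "subgroup (Kc n m) (GLg n)"
proof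
  show "Kc n m \<subseteq> carrier (GLg n)" using Kc_GL by auto
  have "mvge n (1\<^sub>m n - 1\<^sub>m n) (int m)" by (rule mvgeI) simp
  then show "\<one>\<^bsub>GLg n\<^esub> \<in> Kc n m" using GL_one mvge_one by (simp add: Kc_def GL_O_iff)
  fix g assume g: "g \<in> Kc n m"
  then have gO: "g \<in> GL_O v n" and gk: "mvge n (g - 1\<^sub>m n) (int m)" by (auto simp: Kc_def)
  note gG = Kc_GL[OF g]
  note gc = GL_carrier(1)[OF gG]
  {
    fix h assume h: "h \<in> Kc n m"
    then have hO: "h \<in> GL_O v n" and hk: "mvge n (h - 1\<^sub>m n) (int m)" by (auto simp: Kc_def)
    have hc: "h \<in> carrier_mat n n" using GL_carrier(1)[OF Kc_GL[OF h]] .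
    have "mvge n ((g - 1\<^sub>m n) * h) (int m + 0)" by (rule mvge_mult) (use gc hc gk hO in \<open>auto simp: GL_O_iff\<close>)
    then have "mvge n ((g - 1\<^sub>m n) * h) (int m)" by simp
    then have "mvge n (g * h - 1\<^sub>m n) (int m)" unfolding minus_one_mult(1)[OF gc hc]
      by (intro mvge_add[OF _ _ _ hk]) (use gc hc in auto)
    then show "g \<otimes>\<^bsub>GLg n\<^esub> h \<in> Kc n m" using GL_O_mult[OF gO hO] by (simp add: Kc_def)
  }
  have iO: "matinv g \<in> GL_O v n" by (rule matinv_GL_O[OF gO])
  have ic: "matinv g \<in> carrier_mat n n" using GL_carrier(1)[OF GL_matinv(1)[OF gG]] .
  have "mvge n (matinv g * (g - 1\<^sub>m n)) (0 + int m)" by (rule mvge_mult) (use ic gc gk iO in \<open>auto simp: GL_O_iff\<close>)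
  then have k: "mvge n (1\<^sub>m n - matinv g) (int m)" unfolding minus_one_mult(2)[OF ic gc] GL_matinv(3)[OF gG] by simp
  have "mvge n (matinv g - 1\<^sub>m n) (int m)"
  proof (rule mvgeI)
    fix i j assume ij: "i < n" "j < n"
    have "(matinv g - 1\<^sub>m n) $$ (i,j) = - ((1\<^sub>m n - matinv g) $$ (i,j))" using ij ic by simp
    then show "vge v ((matinv g - 1\<^sub>m n) $$ (i,j)) (int m)" using vge_minus[OF mvgeD[OF k ij]] by simp
  qed
  then show "inv\<^bsub>GLg n\<^esub> g \<in> Kc n m" unfolding inv_GLg[OF gG] using iO by (simp add: Kc_def)
qed

lemma Kc_conj:
  assumes g: "g \<in> GL n"
  shows "\<exists>l. \<forall>k\<in>Kc n l. g * k * matinv g \<in> Kc n m"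
proof -
  obtain a where a: "mvge n g (- int a)" using mvge_bounded by blast
  obtain b where b: "mvge n (matinv g) (- int b)" using mvge_bounded by blast
  note gc = GL_carrier(1)[OF g] and ic = GL_carrier(1)[OF GL_matinv(1)[OF g]]
  \<comment> \<open>Conjugation of k - 1 loses a + b in valuation; the extra 1 keeps the result
    congruent to the identity modulo the maximal ideal even for m = 0, as \<open>KcI\<close>
    demands.\<close>
  have "g * k * matinv g \<in> Kc n m" if k: "k \<in> Kc n (m + 1 + a + b)" for k
  proof -
    have kc: "k \<in> carrier_mat n n" using GL_carrier(1)[OF Kc_GL[OF k]] .
    have kk: "mvge n (k - 1\<^sub>m n) (int (m + 1 + a + b))" using k by (simp add: Kc_def)
    have km: "k - 1\<^sub>m n \<in> carrier_mat n n" by (rule minus_carrier_mat) simp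
    have gk: "g * (k - 1\<^sub>m n) \<in> carrier_mat n n" using gc km by (rule mult_carrier_mat)
    have "mvge n (g * (k - 1\<^sub>m n) * matinv g) (- int a + int (m + 1 + a + b) + - int b)"
      by (intro mvge_mult gc km gk ic a b kk)
    moreover have "g * (k - 1\<^sub>m n) * matinv g = g * k * matinv g - 1\<^sub>m n"
    proof -
      have gk': "g * k \<in> carrier_mat n n" using gc kc by (rule mult_carrier_mat)
      show ?thesis unfolding minus_one_mult(2)[OF gc kc]
        using minus_mult_distrib_mat[OF gk' gc ic] GL_matinv(2)[OF g] by simp
    qed
    ultimately have "mvge n (g * k * matinv g - 1\<^sub>m n) (int m + 1)" by (simp add: add.commute)
    moreover have "g * k * matinv g \<in> carrier_mat n n" using gc kc ic by (metis mult_carrier_mat)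
    ultimately show ?thesis by (intro KcI) auto
  qed
  then show ?thesis by blast
qed

section \<open>Finite nets, second countability and the topology\<close>

lemma element_of_value: "\<exists>q. q \<noteq> 0 \<and> v q = k"
proof -
  obtain p where p: "p \<noteq> 0" "v p = 1" using uniformizer by blast
  show ?thesis
  proof (cases "k \<ge> 0")
    case True
    then show ?thesis using p by (intro exI[of _ "p ^ nat k"]) (simp add: v_power)
  next
    case False
    then show ?thesis using p by (intro exI[of _ "inverse (p ^ nat (- k))"]) (simp add: v_power v_inverse)
  qed
qed

text \<open>Digit expansion: each step refines the approximation by a residue class times an element
  \<open>q\<close> of valuation b + k, and there are finitely many residue classes.\<close>

lemma finite_net: "\<exists>R. finite R \<and> (\<forall>a. vge v a b \<longrightarrow> (\<exists>r\<in>R. vge v (a - r) (b + int k)))"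
proof (induction k)
  case 0
  show ?case by (rule exI[of _ "{0}"]) simp
next
  case (Suc k)
  then obtain R where R: "finite R" "\<forall>a. vge v a b \<longrightarrow> (\<exists>r\<in>R. vge v (a - r) (b + int k))" by blast
  obtain S where S: "finite S" "\<forall>x. vge v x 0 \<longrightarrow> (\<exists>r\<in>S. vge v r 0 \<and> vge v (x - r) 1)" using residues by blast
  obtain q where q: "q \<noteq> 0" "v q = b + int k" using element_of_value by blast
  have "\<exists>t\<in>(\<lambda>(r,s). r + q * s) ` (R \<times> S). vge v (a - t) (b + int (Suc k))" if a: "vge v a b" for a
  proof -
    obtain r where r: "r \<in> R" "vge v (a - r) (b + int k)" using R(2) a by blast
    have "vge v ((a - r) * inverse q) ((b + int k) + - (b + int k))"
      using r(2) q by (intro vge_mult) (auto simp: vge_def v_inverse)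
    then have "vge v ((a - r) * inverse q) 0" by simp
    then obtain s where s: "s \<in> S" "vge v ((a - r) * inverse q - s) 1" using S(2) by blast
    have "vge v (q * ((a - r) * inverse q - s)) ((b + int k) + 1)" using s(2) q by (intro vge_mult) (auto simp: vge_def)
    moreover have "q * ((a - r) * inverse q - s) = (q * inverse q) * (a - r) - q * s" by (simp only: algebra_simps)
    then have "q * ((a - r) * inverse q - s) = a - (r + q * s)" using q(1) by simp
    moreover have "b + int k + 1 = b + int (Suc k)" by simp
    ultimately have "vge v (a - (r + q * s)) (b + int (Suc k))" by (simp only:)
    then show ?thesis using r(1) s(1) by force
  qed
  moreover have "finite ((\<lambda>(r,s). r + q * s) ` (R \<times> S))" using R(1) S(1) by simp
  ultimately show ?case by blast
qed

lemma finite_matrix_net: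
  "\<exists>R. finite R \<and> R \<subseteq> carrier_mat n n \<and> (\<forall>g\<in>carrier_mat n n. mvge n g b \<longrightarrow> (\<exists>r\<in>R. mvge n (g - r) c))"
proof -
  obtain R where R: "finite R" "\<forall>a. vge v a b \<longrightarrow> (\<exists>r\<in>R. vge v (a - r) (b + int (nat (c - b))))" using finite_net by blast
  let ?F = "PiE ({..<n} \<times> {..<n}) (\<lambda>_. R)"
  let ?M = "Matrix.mat n n ` ?F"
  have "\<exists>r\<in>?M. mvge n (g - r) c" if g: "g \<in> carrier_mat n n" "mvge n g b" for g
  proof -
    define f where "f = restrict (\<lambda>ij. SOME r. r \<in> R \<and> vge v (g $$ ij - r) (b + int (nat (c - b)))) ({..<n} \<times> {..<n})"
    have f: "f (i,j) \<in> R \<and> vge v (g $$ (i,j) - f (i,j)) (b + int (nat (c - b)))" if ij: "i < n" "j < n" for i j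
    proof -
      let ?P = "\<lambda>r. r \<in> R \<and> vge v (g $$ (i,j) - r) (b + int (nat (c - b)))"
      have "\<exists>r. ?P r" using R(2) mvgeD[OF g(2) ij] by blast
      then have "?P (SOME r. ?P r)" by (rule someI_ex)
      then show ?thesis using ij by (simp add: f_def)
    qed
    have "f \<in> ?F" using f by (auto simp: f_def PiE_def extensional_def)
    moreover have "mvge n (g - Matrix.mat n n f) c"
    proof (rule mvgeI)
      fix i j assume ij: "i < n" "j < n"
      have "vge v (g $$ (i,j) - f (i,j)) c" using f[OF ij] by (auto intro: vge_mono)
      then show "vge v ((g - Matrix.mat n n f) $$ (i,j)) c" using ij by simp
    qed
    ultimately show ?thesis by blast
  qed
  moreover have "finite ?M" using R(1) by (intro finite_imageI finite_PiE) auto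
  moreover have "?M \<subseteq> carrier_mat n n" by auto
  ultimately show ?thesis by blast
qed

text \<open>Since x^-1 (y - x) = x^-1 y - 1, entrywise closeness becomes a congruence after losing
  the bound b of the inverse; the margin 1 serves level 0.\<close>

lemma close_in_coset:
  assumes x: "x \<in> GL n" and y: "y \<in> carrier_mat n n" and b: "mvge n (matinv x) (- int b)"
    and c: "mvge n (y - x) c" "c \<ge> int m + 1 + int b"
  shows "matinv x * y \<in> Kc n m"
proof -
  note xc = GL_carrier(1)[OF x] and ic = GL_carrier(1)[OF GL_matinv(1)[OF x]]
  have "mvge n (matinv x * (y - x)) (- int b + c)" by (rule mvge_mult[OF ic _ b c(1)]) (use xc y in auto)
  moreover have "matinv x * (y - x) = matinv x * y - 1\<^sub>m n"
    using mult_minus_distrib_mat[OF ic y xc] GL_matinv(3)[OF x] by simp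
  ultimately have "mvge n (matinv x * y - 1\<^sub>m n) (- int b + c)" by simp
  moreover have "matinv x * y \<in> carrier_mat n n" using ic y by (rule mult_carrier_mat)
  ultimately show ?thesis using c(2) by (intro KcI) auto
qed

text \<open>Points of a finite net of matrices may lie outside \<open>S\<close> or be singular. Each
  net point close to \<open>S\<close> is replaced by a nearby element of \<open>S\<close>, which
  costs nothing by the ultrametric inequality.\<close>

lemma finite_cover_bounded:
  assumes S: "S \<subseteq> GL n" "\<And>g. g \<in> S \<Longrightarrow> mvge n g (- int b) \<and> mvge n (matinv g) (- int b)"
  shows "\<exists>R. finite R \<and> R \<subseteq> S \<and> (\<forall>g\<in>S. \<exists>r\<in>R. matinv r * g \<in> Kc n m)"
proof -
  let ?c = "int m + 1 + int b"
  obtain N where N: "finite N" "N \<subseteq> carrier_mat n n" 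
    "\<forall>g\<in>carrier_mat n n. mvge n g (- int b) \<longrightarrow> (\<exists>r\<in>N. mvge n (g - r) ?c)"
    using finite_matrix_net[of n "- int b" ?c] by blast
  let ?N = "{r\<in>N. \<exists>g\<in>S. mvge n (g - r) ?c}"
  let ?f = "\<lambda>r. SOME g. g \<in> S \<and> mvge n (g - r) ?c"
  have f: "?f r \<in> S \<and> mvge n (?f r - r) ?c" if "r \<in> ?N" for r
  proof -
    have "\<exists>g. g \<in> S \<and> mvge n (g - r) ?c" using that by blast
    then show ?thesis by (rule someI_ex)
  qed
  have "\<exists>r\<in>?f ` ?N. matinv r * g \<in> Kc n m" if g: "g \<in> S" for g
  proof -
    have gc: "g \<in> carrier_mat n n" using g S(1) GL_carrier(1) by blast
    obtain r where r: "r \<in> N" "mvge n (g - r) ?c" using N(3) gc S(2)[OF g] by blast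
    have rN: "r \<in> ?N" using r g by blast
    have rc: "r \<in> carrier_mat n n" using r(1) N(2) by blast
    have fG: "?f r \<in> GL n" using f[OF rN] S(1) by blast
    note fc = GL_carrier(1)[OF fG]
    have "mvge n ((g - r) - (?f r - r)) ?c" by (rule mvge_diff) (use gc rc fc r(2) f[OF rN] in auto)
    moreover have "(g - r) - (?f r - r) = g - ?f r" using gc rc fc by (intro eq_matI) auto
    ultimately have "mvge n (g - ?f r) ?c" by simp
    then have "matinv (?f r) * g \<in> Kc n m" using close_in_coset[OF fG gc] f[OF rN] S(2) by blast
    then show ?thesis using rN by blast
  qed
  moreover have "finite (?f ` ?N)" using N(1) by simp
  moreover have "?f ` ?N \<subseteq> S" using f by blast
  ultimately show ?thesis by blast
qed

lemma filtered_group_GL: "filtered_group (GLg n) (Kc n)"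
proof -
  show ?thesis
  proof (intro filtered_group.intro filtered_group_axioms.intro group_GLg)
    show "subgroup (Kc n m) (GLg n)" for m by (rule Kc_subgroup)
    show "Kc n l \<subseteq> Kc n m" if "m \<le> l" for m l using that mvge_mono by (auto simp: Kc_def)
    show "\<exists>l. \<forall>k\<in>Kc n l. g \<otimes>\<^bsub>GLg n\<^esub> k \<otimes>\<^bsub>GLg n\<^esub> inv\<^bsub>GLg n\<^esub> g \<in> Kc n m" if "g \<in> carrier (GLg n)" for g m
      using Kc_conj[of g n m] that by (simp add: inv_GLg)
    show "\<exists>R. finite R \<and> R \<subseteq> carrier (GLg n) \<and> (\<forall>k\<in>Kc n 0. \<exists>r\<in>R. inv\<^bsub>GLg n\<^esub> r \<otimes>\<^bsub>GLg n\<^esub> k \<in> Kc n m)" for m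
    proof -
      have s: "Kc n 0 \<subseteq> GL n" using Kc_GL by blast
      have "mvge n g (- int 0) \<and> mvge n (matinv g) (- int 0)" if "g \<in> Kc n 0" for g
        using that matinv_GL_O[of g n] by (simp add: Kc_0 GL_O_iff)
      from finite_cover_bounded[OF s this, of m] obtain R where
        R: "finite R" "R \<subseteq> Kc n 0" "\<forall>g\<in>Kc n 0. \<exists>r\<in>R. matinv r * g \<in> Kc n m" by blast
      have "inv\<^bsub>GLg n\<^esub> r = matinv r" if "r \<in> R" for r using that R(2) s inv_GLg by blast
      then show ?thesis using R s by (intro exI[of _ R]) auto
    qed
    show "\<exists>D. countable D \<and> D \<subseteq> carrier (GLg n) \<and> (\<forall>g\<in>carrier (GLg n). \<exists>d\<in>D. inv\<^bsub>GLg n\<^esub> d \<otimes>\<^bsub>GLg n\<^esub> g \<in> Kc n 0)"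
    proof -
      \<comment> \<open>The sets on which a matrix and its inverse are both bounded by b exhaust the
        group, and each is covered by finitely many cosets.\<close>
      let ?S = "\<lambda>b. {g \<in> GL n. mvge n g (- int b) \<and> mvge n (matinv g) (- int b)}"
      have "\<exists>R. finite R \<and> R \<subseteq> ?S b \<and> (\<forall>g\<in>?S b. \<exists>r\<in>R. matinv r * g \<in> Kc n 0)" for b
        by (rule finite_cover_bounded) auto
      then have "\<forall>b. \<exists>R. finite R \<and> R \<subseteq> ?S b \<and> (\<forall>g\<in>?S b. \<exists>r\<in>R. matinv r * g \<in> Kc n 0)" ..
      from choice[OF this] obtain R where 
        R: "\<forall>b. finite (R b) \<and> R b \<subseteq> ?S b \<and> (\<forall>g\<in>?S b. \<exists>r\<in>R b. matinv r * g \<in> Kc n 0)" ..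
      let ?D = "\<Union>b. R b"
      have cD: "countable ?D" using R by (auto intro: countable_finite)
      have sD: "?D \<subseteq> GL n" using R by blast
      have "\<exists>d\<in>?D. matinv d * g \<in> Kc n 0" if g: "g \<in> GL n" for g
      proof -
        obtain a where a: "mvge n g (- int a)" using mvge_bounded by blast
        obtain b where b: "mvge n (matinv g) (- int b)" using mvge_bounded by blast
        have "mvge n g (- int (max a b))" "mvge n (matinv g) (- int (max a b))"
          using mvge_mono[OF a] mvge_mono[OF b] by simp_all
        then have "g \<in> ?S (max a b)" using g by simp
        then have "\<exists>r\<in>R (max a b). matinv r * g \<in> Kc n 0" using R by blast
        then show ?thesis by blast
      qed
      moreover have "inv\<^bsub>GLg n\<^esub> r = matinv r" if "r \<in> ?D" for r using that sD inv_GLg by blast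
      ultimately show ?thesis using cD sD by (intro exI[of _ ?D]) auto
    qed
  qed
qed

lemma openin_GLtop_iff:
  "openin (GLtop v n) U \<longleftrightarrow> U \<subseteq> GL n \<and>
     (\<forall>x\<in>U. \<exists>k::int. \<forall>y\<in>GL n. (\<forall>i<n. \<forall>j<n. vge v (y $$ (i,j) - x $$ (i,j)) k) \<longrightarrow> y \<in> U)"
proof -
  let ?c = "\<lambda>x y k. \<forall>i<n. \<forall>j<n. vge v (y $$ (i,j) - x $$ (i,j)) k"
  let ?P = "\<lambda>U. U \<subseteq> GL n \<and> (\<forall>x\<in>U. \<exists>k::int. \<forall>y\<in>GL n. ?c x y k \<longrightarrow> y \<in> U)"
  have "istopology ?P"
    unfolding istopology_def
  proof (intro conjI allI impI)
    fix S T assume S: "?P S" and T: "?P T"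
    show "S \<inter> T \<subseteq> GL n" using S by blast
    show "\<forall>x\<in>S \<inter> T. \<exists>k. \<forall>y\<in>GL n. ?c x y k \<longrightarrow> y \<in> S \<inter> T"
    proof
      fix x assume x: "x \<in> S \<inter> T"
      obtain k where k: "\<forall>y\<in>GL n. ?c x y k \<longrightarrow> y \<in> S" using S x by blast
      obtain l where l: "\<forall>y\<in>GL n. ?c x y l \<longrightarrow> y \<in> T" using T x by blast
      have "\<forall>y\<in>GL n. ?c x y (max k l) \<longrightarrow> y \<in> S \<inter> T"
      proof (intro ballI impI)
        fix y assume y: "y \<in> GL n" "?c x y (max k l)"
        have "?c x y k" "?c x y l" using y(2) vge_mono[of _ "max k l" k] vge_mono[of _ "max k l" l] by simp_all
        then show "y \<in> S \<inter> T" using k l y(1) by blast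
      qed
      then show "\<exists>k. \<forall>y\<in>GL n. ?c x y k \<longrightarrow> y \<in> S \<inter> T" by blast
    qed
  next
    fix \<K> assume K: "\<forall>S\<in>\<K>. ?P S"
    show "\<Union>\<K> \<subseteq> GL n" using K by blast
    show "\<forall>x\<in>\<Union>\<K>. \<exists>k. \<forall>y\<in>GL n. ?c x y k \<longrightarrow> y \<in> \<Union>\<K>"
    proof
      fix x assume "x \<in> \<Union>\<K>"
      then obtain S where S: "S \<in> \<K>" "x \<in> S" by blast
      then obtain k where "\<forall>y\<in>GL n. ?c x y k \<longrightarrow> y \<in> S" using K by blast
      then show "\<exists>k. \<forall>y\<in>GL n. ?c x y k \<longrightarrow> y \<in> \<Union>\<K>" using S by blast
    qed
  qed
  then show ?thesis unfolding GLtop_def by (simp add: topology_inverse')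
qed

text \<open>Cosets x K_m and additive balls around x give the same neighbourhoods: passing from one
  kind to the other costs a bound on the entries of x or of its inverse.\<close>

lemma openin_GLtop: "openin (GLtop v n) U \<longleftrightarrow> filtered_group.gopen (GLg n) (Kc n) U"
proof -
  interpret filtered_group "GLg n" "Kc n" by (rule filtered_group_GL)
  have key1: "\<exists>m. nb m x \<subseteq> U" if x: "x \<in> GL n" and k: "\<forall>y\<in>GL n. (\<forall>i<n. \<forall>j<n. vge v (y $$ (i,j) - x $$ (i,j)) k) \<longrightarrow> y \<in> U" for x and k :: int
  proof -
    obtain b where b: "mvge n x (- int b)" using mvge_bounded by blast
    have "y \<in> U" if y: "y \<in> nb (nat (k + int b)) x" for y
    proof -
      have xg: "x \<in> carrier (GLg n)" using x by simp
      obtain z where z: "z \<in> Kc n (nat (k + int b))" "y = x * z" using nb_iff[OF xg, of y "nat (k + int b)"] y by auto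
      have yG: "y \<in> GL n" using y nb_carrier by auto
      note xc = GL_carrier(1)[OF x] and yc = GL_carrier(1)[OF yG] and zc = GL_carrier(1)[OF Kc_GL[OF z(1)]]
      have "mvge n (x * (z - 1\<^sub>m n)) (- int b + int (nat (k + int b)))"
        by (rule mvge_mult[OF xc _ b]) (use zc z(1) in \<open>auto simp: Kc_def\<close>)
      moreover have "x * (z - 1\<^sub>m n) = y - x" using minus_one_mult(2)[OF xc zc] z(2) by simp
      ultimately have "mvge n (y - x) k" by (auto intro: mvge_mono)
      then have "\<forall>i<n. \<forall>j<n. vge v (y $$ (i,j) - x $$ (i,j)) k" using xc yc by (simp add: mvge_def)
      then show ?thesis using k yG by blast
    qed
    then show ?thesis by blast
  qed
  have key2: "\<exists>k::int. \<forall>y\<in>GL n. (\<forall>i<n. \<forall>j<n. vge v (y $$ (i,j) - x $$ (i,j)) k) \<longrightarrow> y \<in> U" if x: "x \<in> GL n" and m: "nb m x \<subseteq> U" for x m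
  proof -
    obtain b where b: "mvge n (matinv x) (- int b)" using mvge_bounded by blast
    have "y \<in> U" if y: "y \<in> GL n" and c: "\<forall>i<n. \<forall>j<n. vge v (y $$ (i,j) - x $$ (i,j)) (int m + 1 + int b)" for y
    proof -
      note xc = GL_carrier(1)[OF x] and yc = GL_carrier(1)[OF y]
      have "mvge n (y - x) (int m + 1 + int b)" using c xc yc by (simp add: mvge_def)
      then have "matinv x * y \<in> Kc n m" using close_in_coset[OF x yc b] by simp
      then have "y \<in> nb m x" using x y by (simp add: nb_def inv_GLg)
      then show ?thesis using m by blast
    qed
    then show ?thesis by blast
  qed
  show ?thesis unfolding openin_GLtop_iff gopen_def GLg_simps
  proof (intro conj_cong refl ball_cong)
    fix x assume U: "U \<subseteq> GL n" and "x \<in> U"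
    then have x: "x \<in> GL n" by blast
    show "(\<exists>k::int. \<forall>y\<in>GL n. (\<forall>i<n. \<forall>j<n. vge v (y $$ (i,j) - x $$ (i,j)) k) \<longrightarrow> y \<in> U) = (\<exists>m. nb m x \<subseteq> U)"
      using key1[OF x] key2[OF x] by blast
  qed
qed

section \<open>Unimodularity\<close>

text \<open>A unipotent matrix that differs from the identity in column k only; the value of c at k
  is ignored. Left multiplication by one such matrix clears a whole column at once.\<close>

definition colmat :: "nat \<Rightarrow> nat \<Rightarrow> (nat \<Rightarrow> 'a) \<Rightarrow> 'a mat" where
  "colmat n k c = Matrix.mat n n (\<lambda>(i,j). if i = j then 1 else if j = k then c i else 0)"

definition diag_at :: "nat \<Rightarrow> nat \<Rightarrow> 'a \<Rightarrow> 'a mat" where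
  "diag_at n k a = mat_diag n (\<lambda>i. if i = k then a else 1)"

lemma colmat_carrier: "colmat n k c \<in> carrier_mat n n"
  by (simp add: colmat_def)

lemma colmat_mult_index:
  assumes A: "A \<in> carrier_mat n n" and k: "k < n" and ij: "i < n" "j < n"
  shows "(colmat n k c * A) $$ (i,j) = (if i = k then A $$ (k,j) else A $$ (i,j) + c i * A $$ (k,j))"
proof -
  have "(colmat n k c * A) $$ (i,j) = (\<Sum>m<n. (if i = m then 1 else if m = k then c i else 0) * A $$ (m,j))"
    unfolding mult_index[OF colmat_carrier A ij] using ij by (intro sum.cong) (auto simp: colmat_def)
  also have "\<dots> = (\<Sum>m<n. (if m = i then A $$ (m,j) else 0) + (if m = k then (if i = k then 0 else c i * A $$ (k,j)) else 0))"
    by (rule sum.cong) auto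
  also have "\<dots> = A $$ (i,j) + (if i = k then 0 else c i * A $$ (k,j))"
    using ij k by (simp add: sum.distrib)
  finally show ?thesis by auto
qed

lemma diag_at_GL:
  assumes a: "a \<noteq> 0"
  shows "diag_at n k a \<in> GL n" "matinv (diag_at n k a) = diag_at n k (inverse a)"
proof -
  have m: "diag_at n k b * diag_at n k (inverse b) = 1\<^sub>m n" if "b \<noteq> 0" for b
  proof -
    have "diag_at n k b * diag_at n k (inverse b) = mat_diag n (\<lambda>i. (if i = k then b else 1) * (if i = k then inverse b else 1))"
      by (simp add: diag_at_def)
    also have "(\<lambda>i. (if i = k then b else 1) * (if i = k then inverse b else 1)) = (\<lambda>i. 1)" using that by auto
    finally show ?thesis by simp
  qed
  have c: "diag_at n k b \<in> carrier_mat n n" for b by (simp add: diag_at_def)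
  have G: "diag_at n k b \<in> GL n" if "b \<noteq> 0" for b
  proof -
    have "det (diag_at n k b) * det (diag_at n k (inverse b)) = 1" using det_mult[OF c c] m[OF that] by (metis det_one)
    then show ?thesis using c by (auto simp: GL_def)
  qed
  show "diag_at n k a \<in> GL n" using G[OF a] .
  have "inv\<^bsub>GLg n\<^esub> (diag_at n k a) = diag_at n k (inverse a)"
    using group.inv_equality[OF group_GLg[of n], of "diag_at n k (inverse a)" "diag_at n k a"] m[of "inverse a"] G[OF a] G[of "inverse a"] a by simp
  then show "matinv (diag_at n k a) = diag_at n k (inverse a)" using inv_GLg[OF G[OF a]] by simp
qed

lemma colmat_conj:
  assumes a: "a \<noteq> 0"
  shows "diag_at n k a * colmat n k c * diag_at n k (inverse a) = colmat n k (\<lambda>i. c i * inverse a)"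
proof (rule eq_matI)
  fix i j assume "i < dim_row (colmat n k (\<lambda>i. c i * inverse a))" "j < dim_col (colmat n k (\<lambda>i. c i * inverse a))"
  then have ij: "i < n" "j < n" by (auto simp: colmat_def)
  have c: "diag_at n k a * colmat n k c \<in> carrier_mat n n"
    by (rule mult_carrier_mat[of _ n n]) (auto simp: diag_at_def colmat_carrier)
  show "(diag_at n k a * colmat n k c * diag_at n k (inverse a)) $$ (i,j) = colmat n k (\<lambda>i. c i * inverse a) $$ (i,j)"
    unfolding diag_at_def[of n k "inverse a"] mult_diag_index[OF c ij]
    unfolding diag_at_def diag_mult_index[OF colmat_carrier ij] using ij a by (auto simp: colmat_def)
qed (auto simp: colmat_def diag_at_def mat_diag_def)

lemma colmat_contract:
  "\<exists>a. a \<noteq> 0 \<and> colmat n k (\<lambda>i. c i * inverse a) \<in> Kc n 0"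
proof -
  let ?S = "insert 0 ((\<lambda>i. v (c i)) ` {..<n})"
  define \<mu> where "\<mu> = Min ?S"
  \<comment> \<open>\<open>\<mu>\<close> is at most the valuation of every nonzero c_i; subtracting
    1 puts all c_i / a into the maximal ideal, so \<open>KcI\<close> applies.\<close>
  obtain a where a: "a \<noteq> 0" "v a = \<mu> - 1" using element_of_value by blast
  have "vge v (c i * inverse a) 1" if i: "i < n" for i
  proof (cases "c i = 0")
    case False
    have "\<mu> \<le> v (c i)" unfolding \<mu>_def by (rule Min_le) (use i in auto)
    then show ?thesis using a False by (simp add: vge_def v_mult v_inverse)
  qed simp
  then have "mvge n (colmat n k (\<lambda>i. c i * inverse a) - 1\<^sub>m n) 1"
    by (intro mvgeI) (auto simp: colmat_def)
  then have "colmat n k (\<lambda>i. c i * inverse a) \<in> Kc n 0" by (rule KcI[OF colmat_carrier]) auto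
  then show ?thesis using a by blast
qed

section \<open>The modular function on elementary matrices\<close>

context
  fixes n :: nat and M :: "'a mat measure"
  assumes n: "n \<ge> 1" and M: "filtered_group.haar (GLg n) (Kc n) (GL n) M" and M1: "emeasure M (GL_O v n) = 1"
begin

interpretation filtered_group "GLg n" "Kc n" by (rule filtered_group_GL)

lemma haarM: "haar (carrier (GLg n)) M" "emeasure M (Kc n 0) = 1"
  using M M1 by (simp_all add: Kc_0)

definition modular_kernel :: "'a mat set" where "modular_kernel = {g \<in> GL n. modular M g = 1}"

lemma modular_kernel_mult: "g \<in> modular_kernel \<Longrightarrow> h \<in> modular_kernel \<Longrightarrow> g * h \<in> modular_kernel"
  using modular_mult[OF haarM, of g h] by (auto simp: modular_kernel_def GL_mult)

text \<open>The modular function is invariant under conjugation, so triviality passes back from the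
  conjugate. Invertibility of \<open>u\<close> is recovered from that of the conjugate by
  determinants.\<close>

lemma modular_kernel_conj:
  assumes g: "g \<in> GL n" and u: "g * u * matinv g \<in> modular_kernel" "u \<in> carrier_mat n n"
  shows "u \<in> modular_kernel"
proof -
  note gc = GL_carrier(1)[OF g] and ic = GL_carrier(1)[OF GL_matinv(1)[OF g]]
  have "det (g * u * matinv g) = det g * det u * det (matinv g)"
    using det_mult[OF mult_carrier_mat[OF gc u(2)] ic] det_mult[OF gc u(2)] by simp
  moreover have "det (g * u * matinv g) \<noteq> 0" using u(1) by (auto simp: modular_kernel_def GL_def)
  ultimately have uG: "u \<in> GL n" using u(2) by (auto simp: GL_def)
  then show ?thesis using modular_conj[OF haarM, of g u] g u(1) by (simp add: modular_kernel_def inv_GLg)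
qed

lemma Kc_modular_kernel: "g \<in> Kc n 0 \<Longrightarrow> g \<in> modular_kernel"
  using modular_K0[OF haarM, of g] Kc_GL[of g n 0] by (simp add: modular_kernel_def)

text \<open>Unipotent elements are contracted into the integral subgroup by conjugation, so the modular
  function is trivial on them.\<close>

lemma colmat_modular_kernel: "colmat n k c \<in> modular_kernel"
proof -
  obtain a where a: "a \<noteq> 0" "colmat n k (\<lambda>i. c i * inverse a) \<in> Kc n 0" using colmat_contract by blast
  have "diag_at n k a * colmat n k c * matinv (diag_at n k a) \<in> modular_kernel"
    unfolding diag_at_GL(2)[OF a(1)] colmat_conj[OF a(1)] using Kc_modular_kernel[OF a(2)] .
  then show ?thesis by (rule modular_kernel_conj[OF diag_at_GL(1)[OF a(1)] _ colmat_carrier])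
qed

text \<open>The permutation matrix of the transposition of k and l conjugates one dilation into the
  other.\<close>

lemma diag_at_modular_eq:
  assumes a: "a \<noteq> 0" and k: "k < n" and l: "l < n"
  shows "modular M (diag_at n k a) = modular M (diag_at n l a)"
proof -
  define \<tau> where "\<tau> = Transposition.transpose k l"
  have \<tau>: "\<tau> (\<tau> i) = i" "\<tau> i = k \<longleftrightarrow> i = l" "i < n \<Longrightarrow> \<tau> i < n" for i
    using k l by (auto simp: \<tau>_def Transposition.transpose_def)
  define S where "S = Matrix.mat n n (\<lambda>(i,j). if j = \<tau> i then 1 else 0 :: 'a)"
  have Sc: "S \<in> carrier_mat n n" by (simp add: S_def)
  have SS: "S * S = 1\<^sub>m n"
  proof (rule eq_matI)
    fix i j assume "i < dim_row (1\<^sub>m n :: 'a mat)" "j < dim_col (1\<^sub>m n :: 'a mat)"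
    then have ij: "i < n" "j < n" by auto
    have "(S * S) $$ (i,j) = (\<Sum>m<n. if m = \<tau> i then (if j = i then 1 else 0) else 0)"
      unfolding mult_index[OF Sc Sc ij] by (rule sum.cong) (use ij \<tau>(1) in \<open>auto simp: S_def\<close>)
    also have "\<dots> = (if j = i then 1 else 0)" using \<tau>(3)[OF ij(1)] by simp
    finally show "(S * S) $$ (i,j) = 1\<^sub>m n $$ (i,j)" using ij by simp
  qed (use Sc in auto)
  then have "det S * det S = 1" using det_mult[OF Sc Sc] by simp
  then have dS: "det S \<noteq> 0" "v (det S * det S) = 0" by auto
  then have dS: "det S \<noteq> 0" "v (det S) = 0" using v_mult[OF dS(1,1)] by auto
  have SG: "S \<in> GL n" using Sc dS by (simp add: GL_def)
  have "mvge n S 0" by (rule mvgeI) (auto simp: S_def)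
  then have SO: "S \<in> Kc n 0" using SG dS by (simp add: Kc_0 GL_O_iff)
  have iS: "matinv S = S"
    using group.inv_equality[OF group_GLg[of n], of S S] SS SG inv_GLg[OF SG] by simp
  have dc: "diag_at n k b \<in> carrier_mat n n" for k b by (simp add: diag_at_def)
  have "S * diag_at n k a = diag_at n l a * S"
  proof (rule eq_matI)
    fix i j assume "i < dim_row (diag_at n l a * S)" "j < dim_col (diag_at n l a * S)"
    then have ij: "i < n" "j < n" using Sc dc by (auto simp: diag_at_def mat_diag_def)
    show "(S * diag_at n k a) $$ (i,j) = (diag_at n l a * S) $$ (i,j)"
      unfolding diag_at_def mult_diag_index[OF Sc ij] diag_mult_index[OF Sc ij] using ij \<tau>(2)[of i] by (auto simp: S_def)
  qed (use Sc in \<open>auto simp: diag_at_def mat_diag_def\<close>)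
  then have "S * diag_at n k a * matinv S = diag_at n l a"
    unfolding iS using assoc_mult_mat[OF dc Sc Sc] SS right_mult_one_mat[OF dc] by simp
  then show ?thesis using modular_conj[OF haarM, of S "diag_at n k a"] SG diag_at_GL(1)[OF a] by (simp add: inv_GLg)
qed

text \<open>The product of the n dilations, built up as \<open>E n\<close>, is a scalar matrix;
  being central it has modular value 1. All factors share the value q, so q^n = 1, and the only such
  nonnegative real is 1.\<close>

lemma diag_at_modular_kernel:
  assumes a: "a \<noteq> 0" and k: "k < n"
  shows "diag_at n k a \<in> modular_kernel"
proof -
  define E where "E j = mat_diag n (\<lambda>i. if i < j then a else 1)" for j
  define q where "q = modular M (diag_at n 0 a)"
  have EG: "E j \<in> GL n \<and> modular M (E j) = q ^ j" if "j \<le> n" for j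
    using that
  proof (induction j)
    case 0
    have "E 0 = 1\<^sub>m n" by (simp add: E_def)
    moreover have "1\<^sub>m n \<in> Kc n 0" using subgroup.one_closed[OF K_sub[of 0]] by simp
    ultimately show ?case using modular_K0[OF haarM, of "1\<^sub>m n"] GL_one by simp
  next
    case (Suc j)
    have "E j * diag_at n j a = mat_diag n (\<lambda>i. (if i < j then a else 1) * (if i = j then a else 1))"
      by (simp add: E_def diag_at_def)
    also have "(\<lambda>i. (if i < j then a else 1) * (if i = j then a else 1)) = (\<lambda>i. if i < Suc j then a else 1)" by auto
    finally have E: "E (Suc j) = E j * diag_at n j a" by (simp add: E_def)
    have ej: "E j \<in> GL n" "modular M (E j) = q ^ j" using Suc by auto
    have "modular M (diag_at n j a) = q" using diag_at_modular_eq[OF a, of j 0] Suc n by (simp add: q_def)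
    then have "modular M (E (Suc j)) = q ^ j * q" using modular_mult[OF haarM, of "E j" "diag_at n j a"] ej diag_at_GL(1)[OF a] E by simp
    then show ?case using GL_mult[OF ej(1) diag_at_GL(1)[OF a]] E by (simp add: mult.commute)
  qed
  have En: "E n \<in> carrier (GLg n)" using EG[of n] by simp
  have "modular M (E n) = 1"
  proof (rule modular_central[OF haarM En])
    fix g assume "g \<in> carrier (GLg n)"
    then have gc: "g \<in> carrier_mat n n" using GL_carrier(1)[of g n] by simp
    show "g \<otimes>\<^bsub>GLg n\<^esub> E n = E n \<otimes>\<^bsub>GLg n\<^esub> g" unfolding GLg_simps
    proof (rule eq_matI)
      fix i j assume "i < dim_row (E n * g)" "j < dim_col (E n * g)"
      then have ij: "i < n" "j < n" using gc by (auto simp: E_def mat_diag_def)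
      show "(g * E n) $$ (i,j) = (E n * g) $$ (i,j)"
        unfolding E_def mult_diag_index[OF gc ij] diag_mult_index[OF gc ij] using ij by simp
    qed (use gc in \<open>auto simp: E_def mat_diag_def\<close>)
  qed
  then have qn: "q ^ n = 1" using EG[of n] by simp
  \<comment> \<open>Finiteness lets the n-th root be taken among the real numbers.\<close>
  have "q \<noteq> \<infinity>" unfolding q_def using modular_finite[OF haarM, of "diag_at n 0 a"] diag_at_GL(1)[OF a] by simp
  then obtain r where r: "q = ennreal r" "r \<ge> 0" by (cases q) auto
  have "ennreal (r ^ n) = ennreal 1" using qn r by (simp add: ennreal_power)
  then have "r ^ n = 1" using r(2) by (simp del: ennreal_1)
  then have "r = 1" using r(2) n power_eq_imp_eq_base[of r n 1] by simp
  then have "q = 1" using r(1) by simp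
  then show ?thesis using diag_at_modular_eq[OF a k, of 0] n diag_at_GL(1)[OF a] by (simp add: modular_kernel_def q_def)
qed

section \<open>Gauss-Jordan elimination with matrices of modular value 1\<close>

definition reduced :: "nat \<Rightarrow> 'a mat \<Rightarrow> bool" where
  "reduced k A \<longleftrightarrow> (\<forall>i<n. \<forall>j<k. A $$ (i,j) = (if i = j then 1 else 0))"

text \<open>Otherwise column k would be a combination of the columns before it, which are standard
  basis vectors; \<open>u\<close> is the resulting nonzero kernel vector.\<close>

lemma reduced_pivot:
  assumes A: "A \<in> GL n" "reduced k A" and k: "k < n"
  shows "\<exists>r<n. k \<le> r \<and> A $$ (r,k) \<noteq> 0"
proof (rule ccontr)
  assume neg: "\<not> ?thesis"
  note Ac = GL_carrier(1)[OF A(1)]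
  define u where "u = Matrix.vec n (\<lambda>j. if j = k then 1 else if j < k then - A $$ (j,k) else 0)"
  have uc: "u \<in> carrier_vec n" by (simp add: u_def)
  have "A *\<^sub>v u = 0\<^sub>v n"
  proof (rule eq_vecI)
    fix i assume "i < dim_vec (0\<^sub>v n :: 'a Matrix.vec)"
    then have i: "i < n" by simp
    have "(A *\<^sub>v u) $ i = (\<Sum>j<n. (if j = k then A $$ (i,k) else 0) + (if j = i then (if i < k then - A $$ (i,k) else 0) else 0))"
      unfolding mult_vec_index[OF Ac uc i]
    proof (rule sum.cong)
      fix j assume "j \<in> {..<n}"
      then have j: "j < n" by simp
      show "A $$ (i,j) * u $ j = (if j = k then A $$ (i,k) else 0) + (if j = i then (if i < k then - A $$ (i,k) else 0) else 0)"
      proof (cases "j < k")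
        case True
        then have "A $$ (i,j) = (if i = j then 1 else 0)" using A(2) i unfolding reduced_def by blast
        then show ?thesis using True j by (auto simp: u_def)
      qed (use j in \<open>auto simp: u_def\<close>)
    qed simp
    also have "\<dots> = A $$ (i,k) + (if i < k then - A $$ (i,k) else 0)" using i k by (simp add: sum.distrib)
    also have "\<dots> = 0" using neg i by auto
    finally show "(A *\<^sub>v u) $ i = 0\<^sub>v n $ i" using i by simp
  qed (use Ac in simp)
  moreover have "u \<noteq> 0\<^sub>v n"
  proof
    assume "u = 0\<^sub>v n"
    then have "u $ k = 0" using k by simp
    then show False using k by (simp add: u_def)
  qed
  ultimately have "det A = 0" using det_0_iff_vec_prod_zero[OF Ac] uc by blast
  then show False using GL_carrier(2)[OF A(1)] by simp
qed

text \<open>Make the pivot nonzero, scale it to 1, clear its column. A row is added where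
  elimination would usually swap two rows, so that only matrices already known to have modular value
  1 occur.\<close>

lemma reduced_step:
  assumes A: "A \<in> GL n" "reduced k A" and k: "k < n"
  shows "\<exists>e\<in>modular_kernel. reduced (Suc k) (e * A)"
proof -
  have NG: "e \<in> GL n" if "e \<in> modular_kernel" for e using that by (simp add: modular_kernel_def)
  have "\<exists>e\<in>modular_kernel. reduced k (e * A) \<and> (e * A) $$ (k,k) \<noteq> 0"
  proof -
    obtain r where r: "r < n" "k \<le> r" "A $$ (r,k) \<noteq> 0" using reduced_pivot[OF A k] by blast
    \<comment> \<open>If the pivot is already nonzero, all coefficients vanish and this is the
      identity; otherwise r differs from k and row r is added to row k. As r is at least k, row r is
      zero in the columns already treated.\<close>
    let ?e = "colmat n r (\<lambda>i. if i = k \<and> A $$ (k,k) = 0 then 1 else 0)"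
    note Ac = GL_carrier(1)[OF A(1)]
    have "reduced k (?e * A)"
      unfolding reduced_def
    proof (intro allI impI)
      fix i j assume ij: "i < n" "j < k"
      then have j: "j < n" using k by simp
      have "A $$ (r,j) = 0" "A $$ (i,j) = (if i = j then 1 else 0)" using A(2) ij r unfolding reduced_def by auto
      then show "(?e * A) $$ (i,j) = (if i = j then 1 else 0)"
        unfolding colmat_mult_index[OF Ac r(1) ij(1) j] by auto
    qed
    moreover have "(?e * A) $$ (k,k) \<noteq> 0"
      unfolding colmat_mult_index[OF Ac r(1) k k] using r by auto
    ultimately show ?thesis using colmat_modular_kernel by blast
  qed
  then obtain e where e: "e \<in> modular_kernel" "reduced k (e * A)" "(e * A) $$ (k,k) \<noteq> 0" by blast
  define A1 where "A1 = e * A"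
  have A1: "A1 \<in> carrier_mat n n" unfolding A1_def using GL_carrier(1)[OF NG[OF e(1)]] GL_carrier(1)[OF A(1)] by (rule mult_carrier_mat)
  define f where "f = diag_at n k (inverse (A1 $$ (k,k)))"
  have fN: "f \<in> modular_kernel" unfolding f_def using e(3) by (intro diag_at_modular_kernel[OF _ k]) (simp add: A1_def)
  define A2 where "A2 = f * A1"
  have A2: "A2 \<in> carrier_mat n n" unfolding A2_def using GL_carrier(1)[OF NG[OF fN]] A1 by (rule mult_carrier_mat)
  have A2i: "A2 $$ (i,j) = (if i = k then inverse (A1 $$ (k,k)) else 1) * A1 $$ (i,j)" if "i < n" "j < n" for i j
    unfolding A2_def f_def diag_at_def diag_mult_index[OF A1 that] ..
  define h where "h = colmat n k (\<lambda>i. - A2 $$ (i,k))"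
  have hN: "h \<in> modular_kernel" unfolding h_def by (rule colmat_modular_kernel)
  have red: "reduced (Suc k) (h * A2)"
    unfolding reduced_def
  proof (intro allI impI)
    fix i j assume ij: "i < n" "j < Suc k"
    then have j: "j < n" using k by simp
    have kk: "A2 $$ (k,k) = 1" using A2i[OF k k] e(3) by (simp add: A1_def)
    show "(h * A2) $$ (i,j) = (if i = j then 1 else 0)"
    proof (cases "j = k")
      case True
      then show ?thesis unfolding h_def colmat_mult_index[OF A2 k ij(1) j] using kk by auto
    next
      case False
      then have jk: "j < k" using ij by simp
      have "A1 $$ (k,j) = 0" "A1 $$ (i,j) = (if i = j then 1 else 0)" using e(2) jk ij k unfolding reduced_def A1_def by auto
      then show ?thesis unfolding h_def colmat_mult_index[OF A2 k ij(1) j] using A2i[OF k j] A2i[OF ij(1) j] jk by auto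
    qed
  qed
  have "h * A2 = (h * (f * e)) * A"
  proof -
    note c = GL_carrier(1)[OF NG[OF hN]] GL_carrier(1)[OF NG[OF fN]] GL_carrier(1)[OF NG[OF e(1)]] GL_carrier(1)[OF A(1)]
    have "(h * (f * e)) * A = h * ((f * e) * A)" by (rule assoc_mult_mat[OF c(1) mult_carrier_mat[OF c(2,3)] c(4)])
    also have "(f * e) * A = f * (e * A)" by (rule assoc_mult_mat[OF c(2,3,4)])
    finally show ?thesis by (simp add: A2_def A1_def)
  qed
  then show ?thesis using red modular_kernel_mult[OF hN modular_kernel_mult[OF fN e(1)]] by auto
qed

text \<open>Elimination multiplies g on the left by elements of modular value 1 until it becomes the
  identity.\<close>

lemma modular_trivial:
  assumes g: "g \<in> GL n"
  shows "modular M g = 1"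
proof -
  have "\<exists>e\<in>modular_kernel. reduced k (e * g)" if "k \<le> n" for k
    using that
  proof (induction k)
    case 0
    have "1\<^sub>m n \<in> modular_kernel" using Kc_modular_kernel[of "1\<^sub>m n"] subgroup.one_closed[OF K_sub[of 0]] by simp
    then show ?case by (auto simp: reduced_def)
  next
    case (Suc k)
    then obtain e where e: "e \<in> modular_kernel" "reduced k (e * g)" by auto
    have eG: "e \<in> GL n" using e(1) by (simp add: modular_kernel_def)
    obtain f where f: "f \<in> modular_kernel" "reduced (Suc k) (f * (e * g))" using reduced_step[OF GL_mult[OF eG g] e(2)] Suc by auto
    have fG: "f \<in> GL n" using f(1) by (simp add: modular_kernel_def)
    have "f * (e * g) = (f * e) * g"
      using assoc_mult_mat[OF GL_carrier(1)[OF fG] GL_carrier(1)[OF eG] GL_carrier(1)[OF g]] by simp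
    then show ?case using f(2) modular_kernel_mult[OF f(1) e(1)] by auto
  qed
  then obtain e where e: "e \<in> modular_kernel" "reduced n (e * g)" by blast
  have eG: "e \<in> GL n" "modular M e = 1" using e(1) by (auto simp: modular_kernel_def)
  have "e * g = 1\<^sub>m n" using e(2) GL_carrier(1)[OF GL_mult[OF eG(1) g]] by (intro eq_matI) (auto simp: reduced_def)
  then have "modular M e * modular M g = 1"
    using modular_mult[OF haarM, of e g] eG(1) g modular_K0[OF haarM, of "1\<^sub>m n"] subgroup.one_closed[OF K_sub[of 0]] by simp
  then show ?thesis using eG(2) by simp
qed

lemma right_invariant:
  assumes g: "g \<in> GL n" and f: "f \<in> borel_measurable M"
  shows "(\<integral>\<^sup>+h. f (h * g) \<partial>M) = (\<integral>\<^sup>+h. f h \<partial>M)"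
  using nn_integral_right_mult[OF haarM, of g f] modular_trivial[OF GL_matinv(1)[OF g]] g f by (simp add: inv_GLg)

end

section \<open>The maximal compact subgroup of a regular torus\<close>

lemma topspace_GLtop: "topspace (GLtop v n) = GL n"
proof -
  have "openin (GLtop v n) (GL n)" by (simp add: openin_GLtop_iff)
  then have "GL n \<subseteq> topspace (GLtop v n)" by (rule openin_subset)
  moreover have "topspace (GLtop v n) \<subseteq> GL n" using openin_topspace[of "GLtop v n"] unfolding openin_GLtop_iff by (rule conjunct1)
  ultimately show ?thesis by blast
qed

lemma mvge_limit:
  fixes s :: "nat \<Rightarrow> 'a mat"
  assumes s: "\<And>p. s p \<in> carrier_mat n n"
    and cauchy: "\<And>k::int. \<exists>N. \<forall>p\<ge>N. \<forall>q\<ge>N. mvge n (s p - s q) k"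
  shows "\<exists>L\<in>carrier_mat n n. \<forall>k::int. \<exists>N. \<forall>p\<ge>N. mvge n (s p - L) k"
proof -
  have "\<exists>l. \<forall>k. \<exists>N. \<forall>p\<ge>N. vge v (s p $$ ij - l) k" if ij: "ij \<in> {..<n} \<times> {..<n}" for ij
  proof (rule complete, intro allI)
    fix k
    obtain N where N: "\<forall>p\<ge>N. \<forall>q\<ge>N. mvge n (s p - s q) k" using cauchy by blast
    have "vge v (s p $$ ij - s q $$ ij) k" if "p \<ge> N" "q \<ge> N" for p q
    proof -
      have "mvge n (s p - s q) k" using N that by blast
      then show ?thesis using ij s[of p] s[of q] by (auto dest: mvgeD)
    qed
    then show "\<exists>N. \<forall>p\<ge>N. \<forall>q\<ge>N. vge v (s p $$ ij - s q $$ ij) k" by blast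
  qed
  then have "\<forall>ij\<in>{..<n} \<times> {..<n}. \<exists>l. \<forall>k. \<exists>N. \<forall>p\<ge>N. vge v (s p $$ ij - l) k" by blast
  from bchoice[OF this] obtain l where l: "\<forall>ij\<in>{..<n} \<times> {..<n}. \<forall>k. \<exists>N. \<forall>p\<ge>N. vge v (s p $$ ij - l ij) k" ..
  let ?L = "Matrix.mat n n l"
  have "\<exists>N. \<forall>p\<ge>N. mvge n (s p - ?L) k" for k :: int
  proof -
    have "\<forall>ij\<in>{..<n} \<times> {..<n}. \<exists>N. \<forall>p\<ge>N. vge v (s p $$ ij - l ij) k" using l by blast
    from bchoice[OF this] obtain N where N: "\<forall>ij\<in>{..<n} \<times> {..<n}. \<forall>p\<ge>N ij. vge v (s p $$ ij - l ij) k" ..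
    let ?N = "Max (insert 0 (N ` ({..<n} \<times> {..<n})))"
    have "mvge n (s p - ?L) k" if p: "p \<ge> ?N" for p
    proof (rule mvgeI)
      fix i j assume ij: "i < n" "j < n"
      have "N (i,j) \<le> ?N" by (rule Max_ge) (use ij in auto)
      then have "vge v (s p $$ (i,j) - l (i,j)) k" using N[rule_format, of "(i,j)" p] ij p by simp
      then show "vge v ((s p - ?L) $$ (i,j)) k" using ij s[of p] by simp
    qed
    then show ?thesis by blast
  qed
  then show ?thesis by (intro bexI[of _ ?L]) auto
qed

lemma centralizer_subgroup:
  assumes x: "x \<in> GL n"
  shows "subgroup (centralizer n x) (GLg n)"
proof
  note xc = GL_carrier(1)[OF x]
  show "centralizer n x \<subseteq> carrier (GLg n)" by (auto simp: centralizer_def)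
  show "\<one>\<^bsub>GLg n\<^esub> \<in> centralizer n x" using GL_one xc by (simp add: centralizer_def)
  fix g assume g: "g \<in> centralizer n x"
  then have gG: "g \<in> GL n" and gx: "g * x = x * g" by (auto simp: centralizer_def)
  note gc = GL_carrier(1)[OF gG]
  {
    fix h assume h: "h \<in> centralizer n x"
    then have hG: "h \<in> GL n" and hx: "h * x = x * h" by (auto simp: centralizer_def)
    note hc = GL_carrier(1)[OF hG]
    have "(g * h) * x = g * (x * h)" using assoc_mult_mat[OF gc hc xc] hx by simp
    also have "\<dots> = (x * g) * h" using assoc_mult_mat[OF gc xc hc] gx by simp
    also have "\<dots> = x * (g * h)" using assoc_mult_mat[OF xc gc hc] by simp
    finally show "g \<otimes>\<^bsub>GLg n\<^esub> h \<in> centralizer n x" using GL_mult[OF gG hG] by (simp add: centralizer_def)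
  }
  note m = GL_matinv[OF gG] and mc = GL_carrier(1)[OF GL_matinv(1)[OF gG]]
  have xm: "x * matinv g \<in> carrier_mat n n" using xc mc by (rule mult_carrier_mat)
  have "matinv g * x = matinv g * (x * (g * matinv g))" using m(2) xc by simp
  also have "\<dots> = matinv g * ((g * x) * matinv g)" using assoc_mult_mat[OF xc gc mc] gx by simp
  also have "\<dots> = (matinv g * g) * (x * matinv g)" using assoc_mult_mat[OF gc xc mc] assoc_mult_mat[OF mc gc xm] by simp
  also have "\<dots> = x * matinv g" using m(3) left_mult_one_mat[OF xm] by simp
  finally show "inv\<^bsub>GLg n\<^esub> g \<in> centralizer n x" using m(1) by (simp add: inv_GLg[OF gG] centralizer_def)
qed

text \<open>The maximum in \<open>ov_G\<close> runs over a finite set that always contains the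
  determinant term, so the bound can be tested term by term.\<close>

lemma G_le_iff: "a \<in> G_le v n i \<longleftrightarrow> a \<in> GL n \<and> mvge n a (- int i) \<and> v (det a) \<le> int i"
proof -
  let ?S = "{- v (a $$ (k,l)) | k l. k < n \<and> l < n \<and> a $$ (k,l) \<noteq> 0}"
  have "?S \<subseteq> (\<lambda>(k,l). - v (a $$ (k,l))) ` ({..<n} \<times> {..<n})" by auto
  then have "finite ?S" by (rule finite_subset) simp
  then have "ov_G v n a \<le> int i \<longleftrightarrow> (\<forall>y\<in>?S \<union> {v (det a)}. y \<le> int i)"
    unfolding ov_G_def by (intro Max.bounded_iff) auto
  also have "\<dots> \<longleftrightarrow> mvge n a (- int i) \<and> v (det a) \<le> int i"
  proof -
    have "(\<forall>y\<in>?S. y \<le> int i) \<longleftrightarrow> mvge n a (- int i)"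
    proof
      assume S: "\<forall>y\<in>?S. y \<le> int i"
      show "mvge n a (- int i)"
      proof (rule mvgeI)
        fix k l assume kl: "k < n" "l < n"
        show "vge v (a $$ (k,l)) (- int i)"
        proof (cases "a $$ (k,l) = 0")
          case False
          then have "- v (a $$ (k,l)) \<in> ?S" using kl by blast
          then have "- v (a $$ (k,l)) \<le> int i" using S by blast
          then show ?thesis by (simp add: vge_def)
        qed simp
      qed
    next
      assume m: "mvge n a (- int i)"
      show "\<forall>y\<in>?S. y \<le> int i"
      proof
        fix y assume "y \<in> ?S"
        then obtain k l where "k < n" "l < n" "a $$ (k,l) \<noteq> 0" "y = - v (a $$ (k,l))" by blast
        then show "y \<le> int i" using mvgeD[OF m, of k l] by (simp add: vge_def)
      qed
    qed
    then show ?thesis by auto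
  qed
  finally show ?thesis by (auto simp: G_le_def)
qed

text \<open>The cofactors contribute (n - 1) i, and the division contributes another i through the
  determinant term of \<open>ov_G\<close>.\<close>

lemma G_le_matinv:
  assumes a: "a \<in> G_le v n i" and n: "n \<ge> 1"
  shows "mvge n (matinv a) (- int (n * i))"
proof -
  have aG: "a \<in> GL n" and m: "mvge n a (- int i)" and d: "v (det a) \<le> int i" using a by (auto simp: G_le_iff)
  have "int (n * i) = int (n - 1) * int i + int i"
    using n by (cases n) (simp_all add: algebra_simps)
  then show ?thesis using mvge_mono[OF mvge_matinv[OF GL_carrier[OF aG] m]] d by simp
qed

lemma Zc_central:
  assumes "z \<in> Zc n"
  shows "z \<in> GL n" "g \<in> carrier_mat n n \<Longrightarrow> z * g = g * z"
proof -
  obtain c where c: "c \<noteq> 0" "z = c \<cdot>\<^sub>m 1\<^sub>m n" using assms by (auto simp: Zc_def)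
  show "z \<in> GL n" using c by (simp add: GL_def)
  show "z * g = g * z" if "g \<in> carrier_mat n n"
    using that c mult_smult_assoc_mat[of "1\<^sub>m n" n n g n c] mult_smult_distrib[of g n n "1\<^sub>m n" n c] by simp
qed

lemma Zc_subgroup: "subgroup (Zc n) (GLg n)"
proof
  show "Zc n \<subseteq> carrier (GLg n)" using Zc_central(1) by auto
  have "1\<^sub>m n = (1::'a) \<cdot>\<^sub>m 1\<^sub>m n" by (intro eq_matI) auto
  then show "\<one>\<^bsub>GLg n\<^esub> \<in> Zc n" unfolding Zc_def GLg_simps by (intro CollectI exI[of _ "1::'a"]) simp
  have prod: "(c \<cdot>\<^sub>m 1\<^sub>m n) * (d \<cdot>\<^sub>m 1\<^sub>m n) = (c * d) \<cdot>\<^sub>m 1\<^sub>m n" for c d :: 'a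
    using mult_smult_assoc_mat[of "1\<^sub>m n" n n "d \<cdot>\<^sub>m 1\<^sub>m n" n c] by (auto intro!: eq_matI)
  have Zin: "c \<cdot>\<^sub>m 1\<^sub>m n \<in> Zc n" if "c \<noteq> 0" for c :: 'a using that unfolding Zc_def by blast
  fix z :: "'a mat" assume "z \<in> Zc n"
  then obtain c where c: "c \<noteq> 0" "z = c \<cdot>\<^sub>m 1\<^sub>m n" by (auto simp: Zc_def)
  {
    fix y :: "'a mat" assume "y \<in> Zc n"
    then obtain d where d: "d \<noteq> 0" "y = d \<cdot>\<^sub>m 1\<^sub>m n" by (auto simp: Zc_def)
    show "z \<otimes>\<^bsub>GLg n\<^esub> y \<in> Zc n" using prod[of c d] Zin[of "c * d"] c d by simp
  }
  have "inverse c \<cdot>\<^sub>m 1\<^sub>m n * z = 1\<^sub>m n" using prod[of "inverse c" c] c by (auto intro!: eq_matI)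
  then have "inv\<^bsub>GLg n\<^esub> z = inverse c \<cdot>\<^sub>m 1\<^sub>m n"
    using group.inv_equality[OF group_GLg[of n], of "inverse c \<cdot>\<^sub>m 1\<^sub>m n" z] Zc_central(1)[OF Zin[of c]] Zc_central(1)[OF Zin[of "inverse c"]] c by simp
  then show "inv\<^bsub>GLg n\<^esub> z \<in> Zc n" using Zin[of "inverse c"] c by simp
qed

text \<open>The determinant of the scalar matrix c has valuation n v(c), which for positive n
  vanishes exactly when v(c) does.\<close>

lemma Zc_O_eq:
  assumes n: "n \<ge> 1"
  shows "Zc_O v n = Kc n 0 \<inter> Zc n"
proof -
  have "c \<cdot>\<^sub>m 1\<^sub>m n \<in> GL_O v n \<longleftrightarrow> v c = 0" if c: "c \<noteq> 0" for c
  proof -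
    have "v (det (c \<cdot>\<^sub>m 1\<^sub>m n)) = int n * v c" using c by (simp add: v_power)
    moreover have "mvge n (c \<cdot>\<^sub>m 1\<^sub>m n) 0" if "v c = 0" using that by (intro mvgeI) (auto simp: vge_def)
    moreover have "c \<cdot>\<^sub>m 1\<^sub>m n \<in> GL n" using c by (simp add: GL_def)
    ultimately show ?thesis using n by (auto simp: GL_O_iff)
  qed
  then show ?thesis unfolding Kc_0 Zc_O_def Zc_def by auto
qed

section \<open>The group of torus elements with unit eigenvalues\<close>

context
  fixes n :: nat and x :: "'a mat" and t :: "nat \<Rightarrow> 'a mat \<Rightarrow> real" and B :: int
  assumes n: "n \<ge> 1" and x: "x \<in> G_rss n" and tv: "torus_valuation n x t B"
begin

lemma comm: "g \<in> centralizer n x \<Longrightarrow> h \<in> centralizer n x \<Longrightarrow> g * h = h * g"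
  and t_mult: "g \<in> centralizer n x \<Longrightarrow> h \<in> centralizer n x \<Longrightarrow> i < n \<Longrightarrow> t i (g * h) = t i g + t i h"
  and t_ge: "h \<in> centralizer n x \<Longrightarrow> i < n \<Longrightarrow> mvge n h J \<Longrightarrow> t i h \<ge> real_of_int J"
  and t_bound: "h \<in> centralizer n x \<Longrightarrow> (\<And>i. i < n \<Longrightarrow> t i h \<ge> 0) \<Longrightarrow> mvge n h (- B)"
  and t_int: "h \<in> centralizer n x \<Longrightarrow> i < n \<Longrightarrow> fact n * t i h \<in> \<int>"
  using tv unfolding torus_valuation_def by simp_all

interpretation filtered_group "GLg n" "Kc n" by (rule filtered_group_GL)

abbreviation "T \<equiv> centralizer n x"

lemma xG: "x \<in> GL n" using x by (simp add: G_rss_def)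

lemma T_GL: "h \<in> T \<Longrightarrow> h \<in> GL n" by (simp add: centralizer_def)

lemma T_closed: "1\<^sub>m n \<in> T" "g \<in> T \<Longrightarrow> h \<in> T \<Longrightarrow> g * h \<in> T" "g \<in> T \<Longrightarrow> matinv g \<in> T"
  using subgroup.one_closed[OF centralizer_subgroup[OF xG]] subgroup.m_closed[OF centralizer_subgroup[OF xG], of g h]
    subgroup.m_inv_closed[OF centralizer_subgroup[OF xG], of g] inv_GLg[OF T_GL, of g] by auto

lemma t_one: "i < n \<Longrightarrow> t i (1\<^sub>m n) = 0"
  using t_mult[OF T_closed(1) T_closed(1), of i] by simp

lemma t_inv: "h \<in> T \<Longrightarrow> i < n \<Longrightarrow> t i (matinv h) = - t i h"
  using t_mult[OF _ T_closed(3), of h h i] GL_matinv(2)[OF T_GL, of h] t_one[of i] by simp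

text \<open>The kernel of the valuation map on the torus; \<open>max_compact_Kx\<close> identifies
  it as the maximal compact subgroup.\<close>

definition Kx :: "'a mat set" where "Kx = {h \<in> T. \<forall>i<n. t i h = 0}"

lemma Kx_T: "h \<in> Kx \<Longrightarrow> h \<in> T" by (simp add: Kx_def)

lemma Kx_closed: "1\<^sub>m n \<in> Kx" "g \<in> Kx \<Longrightarrow> h \<in> Kx \<Longrightarrow> g * h \<in> Kx" "g \<in> Kx \<Longrightarrow> matinv g \<in> Kx"
  using T_closed t_one t_mult t_inv by (simp_all add: Kx_def)

lemma KxI:
  assumes h: "h \<in> T" and J: "\<And>i. i < n \<Longrightarrow> t i h \<ge> 0" "\<And>i. i < n \<Longrightarrow> t i (matinv h) \<ge> 0"
  shows "h \<in> Kx"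
proof -
  have "t i h = 0" if "i < n" for i using J(1)[OF that] J(2)[OF that] t_inv[OF h that] by simp
  then show ?thesis using h by (simp add: Kx_def)
qed

text \<open>For a matrix that is integral together with its inverse, \<open>t_ge\<close> makes the
  valuations of both nonnegative; they are opposite, hence zero.\<close>

lemma integral_Kx: "Kc n 0 \<inter> T \<subseteq> Kx"
proof
  fix h assume "h \<in> Kc n 0 \<inter> T"
  then have h: "h \<in> GL_O v n" "h \<in> T" by (auto simp: Kc_0)
  have "mvge n h 0" "mvge n (matinv h) 0" using h(1) matinv_GL_O[OF h(1)] by (auto simp: GL_O_iff)
  then show "h \<in> Kx" using t_ge[OF h(2), of _ 0] t_ge[OF T_closed(3)[OF h(2)], of _ 0] by (intro KxI[OF h(2)]) auto
qed

lemma Kx_bounded: "\<exists>b. \<forall>h\<in>Kx. mvge n h (- int b) \<and> mvge n (matinv h) (- int b)"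
proof (rule exI[of _ "nat B"], rule ballI)
  fix h assume h: "h \<in> Kx"
  have "mvge n h (- B)" using t_bound[of h] h by (simp add: Kx_def)
  moreover have "mvge n (matinv h) (- B)" using t_bound[of "matinv h"] Kx_closed(3)[OF h] by (simp add: Kx_def)
  ultimately show "mvge n h (- int (nat B)) \<and> mvge n (matinv h) (- int (nat B))"
    using mvge_mono[of n h "- B" "- int (nat B)"] mvge_mono[of n "matinv h" "- B" "- int (nat B)"] by simp
qed

text \<open>Bounded entries turn nested cosets into an entrywise Cauchy sequence. Its limit lies in
  every coset because late terms are close to it, commutes with x by continuity, and differs from
  \<open>s 0\<close> by an integral torus element, so it stays in \<open>Kx\<close>.\<close>

lemma Kx_complete:
  assumes s: "\<And>m. s m \<in> Kx" "\<And>m. s (Suc m) \<in> nb m (s m)"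
  shows "\<exists>L\<in>Kx. \<forall>m. L \<in> nb m (s m)"
proof -
  obtain b where b: "\<forall>h\<in>Kx. mvge n h (- int b) \<and> mvge n (matinv h) (- int b)" using Kx_bounded by blast
  have sG: "s m \<in> GL n" for m using T_GL[OF Kx_T[OF s(1)]] .
  have sg: "s m \<in> carrier (GLg n)" for m using sG by simp
  have sc: "s m \<in> carrier_mat n n" for m using GL_carrier(1)[OF sG] .
  have near: "s (m + d) \<in> nb m (s m)" for m d
  proof (induction d)
    case 0 then show ?case using nb_self[OF sg, of m m] by simp
  next
    case (Suc d)
    have "s (Suc (m + d)) \<in> nb m (s (m + d))" using s(2)[of "m + d"] nb_anti[of m "m + d" "s (m + d)"] by auto
    then show ?case using nb_trans[OF sg Suc, of "s (Suc (m + d))"] by simp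
  qed
  have close: "mvge n (s p - s m) (- int b + int m)" if "p \<ge> m" for p m
  proof -
    have "s p \<in> nb m (s m)" using near[of m "p - m"] that by simp
    then obtain z where z: "z \<in> Kc n m" "s p = s m * z" using nb_iff[OF sg, of "s p" m m] by auto
    have zc: "z \<in> carrier_mat n n" using GL_carrier(1)[OF Kc_GL[OF z(1)]] .
    have "mvge n (s m * (z - 1\<^sub>m n)) (- int b + int m)"
      by (rule mvge_mult[OF sc]) (use zc z(1) b s(1) in \<open>auto simp: Kc_def\<close>)
    then show ?thesis using minus_one_mult(2)[OF sc zc] z(2) by simp
  qed
  have "\<exists>L\<in>carrier_mat n n. \<forall>k::int. \<exists>N. \<forall>p\<ge>N. mvge n (s p - L) k"
  proof (rule mvge_limit[OF sc])
    fix k :: int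
    let ?N = "nat (k + int b)"
    have "mvge n (s p - s q) k" if "p \<ge> ?N" "q \<ge> ?N" for p q
    proof -
      have "mvge n (s p - s ?N) k" "mvge n (s q - s ?N) k"
        using close[OF that(1)] close[OF that(2)] by (auto intro: mvge_mono)
      then have "mvge n ((s p - s ?N) - (s q - s ?N)) k" by (rule mvge_diff[OF minus_carrier_mat[OF sc] minus_carrier_mat[OF sc]])
      moreover have "(s p - s ?N) - (s q - s ?N) = s p - s q" using sc[of p] sc[of q] sc[of ?N] by (intro eq_matI) auto
      ultimately show ?thesis by simp
    qed
    then show "\<exists>N. \<forall>p\<ge>N. \<forall>q\<ge>N. mvge n (s p - s q) k" by blast
  qed
  then obtain L where L: "L \<in> carrier_mat n n" "\<forall>k::int. \<exists>N. \<forall>p\<ge>N. mvge n (s p - L) k" by blast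
  have lim: "\<exists>N. \<forall>p\<ge>N. mvge n (L - s p) k" for k :: int
  proof -
    obtain N where N: "\<forall>p\<ge>N. mvge n (s p - L) k" using L(2) by blast
    have "mvge n (L - s p) k" if "p \<ge> N" for p
    proof (rule mvgeI)
      fix i j assume ij: "i < n" "j < n"
      have "vge v ((s p - L) $$ (i,j)) k" using N that mvgeD[OF _ ij] by blast
      moreover have "(L - s p) $$ (i,j) = - ((s p - L) $$ (i,j))" using ij L(1) sc[of p] by simp
      ultimately show "vge v ((L - s p) $$ (i,j)) k" using vge_minus by simp
    qed
    then show ?thesis by blast
  qed
  have coset: "matinv (s m) * L \<in> Kc n m" for m
  proof -
    obtain N where N: "\<forall>p\<ge>N. mvge n (L - s p) (int m + 1 + int b)" using lim by blast
    \<comment> \<open>Beyond m the terms stay in the coset of \<open>s m\<close>, beyond N they are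
      close to L; this index satisfies both.\<close>
    let ?p = "max N m"
    have "matinv (s ?p) * L \<in> Kc n m" by (rule close_in_coset[OF sG L(1), of _ b]) (use b s(1) N in auto)
    moreover have "matinv (s m) * s ?p \<in> Kc n m"
      using near[of m "?p - m"] sG[of m] by (simp add: nb_def inv_GLg)
    ultimately have "(matinv (s m) * s ?p) * (matinv (s ?p) * L) \<in> Kc n m"
      using subgroup.m_closed[OF Kc_subgroup[of n m]] by simp
    moreover have "(matinv (s m) * s ?p) * (matinv (s ?p) * L) = matinv (s m) * L"
    proof -
      note c = GL_carrier(1)[OF GL_matinv(1)[OF sG[of m]]] sc[of ?p] GL_carrier(1)[OF GL_matinv(1)[OF sG[of ?p]]]
      have pL: "matinv (s ?p) * L \<in> carrier_mat n n" using c(3) L(1) by (rule mult_carrier_mat)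
      have "s ?p * (matinv (s ?p) * L) = (s ?p * matinv (s ?p)) * L" using assoc_mult_mat[OF c(2,3) L(1)] by simp
      then have "s ?p * (matinv (s ?p) * L) = L" using GL_matinv(2)[OF sG[of ?p]] L(1) by simp
      then show ?thesis using assoc_mult_mat[OF c(1,2) pL] by simp
    qed
    ultimately show ?thesis by simp
  qed
  have Leq: "L = s m * (matinv (s m) * L)" for m
    using assoc_mult_mat[OF sc GL_carrier(1)[OF GL_matinv(1)[OF sG]] L(1), of m m] GL_matinv(2)[OF sG[of m]] L(1) by simp
  have LG: "L \<in> GL n" using Leq[of 0] GL_mult[OF sG[of 0] Kc_GL[OF coset[of 0]]] by simp
  have "L * x = x * L"
  proof (rule eq_matI)
    note xc = GL_carrier(1)[OF xG]
    obtain c where c: "mvge n x (- int c)" using mvge_bounded by blast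
    fix i j assume "i < dim_row (x * L)" "j < dim_col (x * L)"
    then have ij: "i < n" "j < n" using xc L(1) by auto
    \<comment> \<open>As s_N commutes with x, the difference equals (L - s_N) x - x (L - s_N), whose
      valuation becomes arbitrarily large.\<close>
    have "vge v ((L * x) $$ (i,j) - (x * L) $$ (i,j)) k" for k
    proof -
      obtain N where N: "\<forall>p\<ge>N. mvge n (L - s p) (k + int c)" using lim by blast
      have sx: "s N * x = x * s N" using Kx_T[OF s(1)[of N]] by (simp add: centralizer_def)
      have Ls: "L - s N \<in> carrier_mat n n" by (rule minus_carrier_mat[OF sc])
      have m: "mvge n (L - s N) (k + int c)" using N by simp
      have "mvge n ((L - s N) * x) ((k + int c) + - int c)" "mvge n (x * (L - s N)) (- int c + (k + int c))"
        by (rule mvge_mult[OF Ls xc m c], rule mvge_mult[OF xc Ls c m])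
      then have "mvge n ((L - s N) * x) k" "mvge n (x * (L - s N)) k" by simp_all
      moreover have "(L - s N) * x = L * x - s N * x" by (rule minus_mult_distrib_mat[OF L(1) sc xc])
      moreover have "x * (L - s N) = x * L - s N * x" using mult_minus_distrib_mat[OF xc L(1) sc[of N]] sx by simp
      ultimately have "vge v ((L * x - s N * x) $$ (i,j)) k" "vge v ((x * L - s N * x) $$ (i,j)) k"
        using mvgeD[OF _ ij] by metis+
      then have "vge v ((L * x - s N * x) $$ (i,j) - (x * L - s N * x) $$ (i,j)) k" by (rule vge_diff)
      moreover have "(L * x - s N * x) $$ (i,j) - (x * L - s N * x) $$ (i,j) = (L * x) $$ (i,j) - (x * L) $$ (i,j)"
        using ij sc[of N] xc by simp
      ultimately show ?thesis by (simp only:)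
    qed
    then have "(L * x) $$ (i,j) - (x * L) $$ (i,j) = 0" by (rule vge_all_zero)
    then show "(L * x) $$ (i,j) = (x * L) $$ (i,j)" by simp
  qed (use L(1) GL_carrier(1)[OF xG] in auto)
  then have LT: "L \<in> T" using LG by (simp add: centralizer_def)
  have "matinv (s 0) * L \<in> Kx" using integral_Kx coset[of 0] T_closed(2)[OF T_closed(3)[OF Kx_T[OF s(1)[of 0]]] LT] by blast
  then have "L \<in> Kx" using Kx_closed(2)[OF s(1)[of 0]] Leq[of 0] by metis
  moreover have "L \<in> nb m (s m)" for m using coset[of m] LG sG[of m] by (simp add: nb_def inv_GLg)
  ultimately show ?thesis by blast
qed

text \<open>Total boundedness and completeness: if no finite subfamily covers \<open>Kx\<close>,
  nested cosets of every level fail to be finitely covered. Their limit point lies in some member of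
  the cover, and that open set already contains one of these cosets.\<close>

lemma compactin_Kx: "compactin (GLtop v n) Kx"
  unfolding compactin_def
proof (intro conjI allI impI)
  show "Kx \<subseteq> topspace (GLtop v n)" unfolding topspace_GLtop using T_GL[OF Kx_T] by blast
  fix \<U> assume U: "(\<forall>U\<in>\<U>. openin (GLtop v n) U) \<and> Kx \<subseteq> \<Union>\<U>"
  show "\<exists>\<F>. finite \<F> \<and> \<F> \<subseteq> \<U> \<and> Kx \<subseteq> \<Union>\<F>"
  proof (rule ccontr)
    assume neg: "\<not> ?thesis"
    define bad where "bad S \<longleftrightarrow> \<not> (\<exists>\<F>. finite \<F> \<and> \<F> \<subseteq> \<U> \<and> S \<subseteq> \<Union>\<F>)" for S
    have split: "\<exists>r\<in>R. bad (S \<inter> nb m r)" if R: "finite R" and S: "\<forall>g\<in>S. \<exists>r\<in>R. g \<in> nb m r" and bS: "bad S" for R S m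
    proof (rule ccontr)
      assume "\<not> ?thesis"
      then have "\<forall>r\<in>R. \<exists>\<F>. finite \<F> \<and> \<F> \<subseteq> \<U> \<and> S \<inter> nb m r \<subseteq> \<Union>\<F>" unfolding bad_def by blast
      from bchoice[OF this] obtain F where F: "\<forall>r\<in>R. finite (F r) \<and> F r \<subseteq> \<U> \<and> S \<inter> nb m r \<subseteq> \<Union>(F r)" ..
      have "finite (\<Union>r\<in>R. F r)" "(\<Union>r\<in>R. F r) \<subseteq> \<U>" using R F by auto
      moreover have "S \<subseteq> \<Union>(\<Union>r\<in>R. F r)"
      proof
        fix g assume g: "g \<in> S"
        then obtain r where r: "r \<in> R" "g \<in> nb m r" using S by blast
        then have "g \<in> \<Union>(F r)" using F g by blast
        then show "g \<in> \<Union>(\<Union>r\<in>R. F r)" using r(1) by blast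
      qed
      ultimately show False using bS unfolding bad_def by blast
    qed
    obtain b where b: "\<forall>h\<in>Kx. mvge n h (- int b) \<and> mvge n (matinv h) (- int b)" using Kx_bounded by blast
    have KG: "Kx \<subseteq> GL n" using T_GL[OF Kx_T] by blast
    have cov: "\<exists>R. finite R \<and> R \<subseteq> Kx \<and> (\<forall>g\<in>Kx. \<exists>r\<in>R. g \<in> nb m r)" for m
    proof -
      obtain R where R: "finite R" "R \<subseteq> Kx" "\<forall>g\<in>Kx. \<exists>r\<in>R. matinv r * g \<in> Kc n m"
        using finite_cover_bounded[OF KG, of b m] b by blast
      have "\<exists>r\<in>R. g \<in> nb m r" if g: "g \<in> Kx" for g
      proof -
        obtain r where r: "r \<in> R" "matinv r * g \<in> Kc n m" using R(3) g by blast
        have "r \<in> GL n" "g \<in> GL n" using r(1) R(2) g KG by blast+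
        then have "g \<in> nb m r" using r(2) by (simp add: nb_def inv_GLg)
        then show ?thesis using r(1) by blast
      qed
      then show ?thesis using R by blast
    qed
    let ?P = "\<lambda>m s. s \<in> Kx \<and> bad (Kx \<inter> nb m s)"
    have "\<exists>s. \<forall>m. ?P m (s m) \<and> s (Suc m) \<in> nb m (s m)"
    proof (rule dependent_nat_choice)
      obtain R where R: "finite R" "R \<subseteq> Kx" "\<forall>g\<in>Kx. \<exists>r\<in>R. g \<in> nb 0 r" using cov[of 0] by blast
      have "bad Kx" unfolding bad_def using neg .
      from split[OF R(1,3) this] show "\<exists>s. ?P 0 s" using R(2) by blast
    next
      fix s m assume s: "?P m s"
      obtain R where R: "finite R" "R \<subseteq> Kx" "\<forall>g\<in>Kx. \<exists>r\<in>R. g \<in> nb (Suc m) r" using cov[of "Suc m"] by blast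
      then have R3: "\<forall>g\<in>Kx \<inter> nb m s. \<exists>r\<in>R. g \<in> nb (Suc m) r" by blast
      obtain r where r: "r \<in> R" "bad (Kx \<inter> nb m s \<inter> nb (Suc m) r)" using split[OF R(1) R3] s by blast
      have sg: "s \<in> carrier (GLg n)" and rg: "r \<in> carrier (GLg n)" using s r(1) R(2) KG by auto
      \<comment> \<open>The empty set is finitely covered, so a bad intersection has a point; the
        two cosets share it and are therefore nested.\<close>
      have "Kx \<inter> nb m s \<inter> nb (Suc m) r \<noteq> {}"
      proof
        assume e: "Kx \<inter> nb m s \<inter> nb (Suc m) r = {}"
        have "finite {} \<and> {} \<subseteq> \<U> \<and> Kx \<inter> nb m s \<inter> nb (Suc m) r \<subseteq> \<Union>{}" unfolding e by simp
        then show False using r(2) unfolding bad_def by blast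
      qed
      then obtain y where y: "y \<in> nb m s" "y \<in> nb (Suc m) r" by blast
      have "y \<in> nb m r" using y(2) nb_anti[of m "Suc m" r] by auto
      then have "nb m r = nb m s" using nb_eq[OF sg y(1)] nb_eq[OF rg, of y m] by simp
      then have "nb (Suc m) r \<subseteq> nb m s" "r \<in> nb m s" using nb_anti[of m "Suc m" r] nb_self[OF rg, of m] by auto
      then have "Kx \<inter> nb m s \<inter> nb (Suc m) r = Kx \<inter> nb (Suc m) r" by blast
      then show "\<exists>r. ?P (Suc m) r \<and> r \<in> nb m s" using r R(2) \<open>r \<in> nb m s\<close> by auto
    qed
    then obtain s where s0: "\<forall>m. ?P m (s m) \<and> s (Suc m) \<in> nb m (s m)" by (rule exE)
    have s: "s m \<in> Kx" "bad (Kx \<inter> nb m (s m))" "s (Suc m) \<in> nb m (s m)" for m using spec[OF s0, of m] by auto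
    obtain L where L: "L \<in> Kx" "\<forall>m. L \<in> nb m (s m)" using bexE[OF Kx_complete[of s, OF s(1,3)]] by metis
    obtain V where V: "V \<in> \<U>" "L \<in> V" using U L(1) by blast
    then have "gopen V" using U openin_GLtop[of n V] by blast
    then obtain m where m: "nb m L \<subseteq> V" using V(2) unfolding gopen_def by blast
    have "s m \<in> carrier (GLg n)" using s(1)[of m] KG by auto
    then have "nb m L = nb m (s m)" using nb_eq[of "s m" L m] L(2) by blast
    then have "finite {V} \<and> {V} \<subseteq> \<U> \<and> Kx \<inter> nb m (s m) \<subseteq> \<Union>{V}" using V(1) m by auto
    then show False using s(2)[of m] unfolding bad_def by blast
  qed
qed

text \<open>A compact set has bounded entries, so each \<open>t i\<close> is bounded below on it. In
  a group, powers multiply the value, which rules out negative values, and inverses then rule out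
  positive ones.\<close>

lemma compact_subgroup_le_Kx:
  assumes K': "compact_subgroup v n T K'"
  shows "K' \<subseteq> Kx"
proof
  have KT: "K' \<subseteq> T" and one: "1\<^sub>m n \<in> K'" and mult: "\<And>a b. a \<in> K' \<Longrightarrow> b \<in> K' \<Longrightarrow> a * b \<in> K'"
    and inv: "\<And>a. a \<in> K' \<Longrightarrow> \<exists>b\<in>K'. a * b = 1\<^sub>m n" and cpt: "compactin (GLtop v n) K'"
    using K' by (auto simp: compact_subgroup_def)
  \<comment> \<open>An increasing open cover by entry bounds; a finite subcover yields one bound for
    all of \<open>K'\<close>.\<close>
  let ?O = "\<lambda>b::nat. {g \<in> GL n. mvge n g (- int b)}"
  have op: "openin (GLtop v n) (?O b)" for b
    unfolding openin_GLtop_iff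
  proof (intro conjI ballI)
    show "?O b \<subseteq> GL n" by blast
    fix y assume y: "y \<in> ?O b"
    have "z \<in> ?O b" if z: "z \<in> GL n" "\<forall>i<n. \<forall>j<n. vge v (z $$ (i,j) - y $$ (i,j)) (- int b)" for z
    proof -
      have "mvge n z (- int b)"
      proof (rule mvgeI)
        fix i j assume ij: "i < n" "j < n"
        have "vge v (z $$ (i,j) - y $$ (i,j)) (- int b)" "vge v (y $$ (i,j)) (- int b)" using z(2) y ij mvgeD by auto
        then have "vge v (z $$ (i,j) - y $$ (i,j) + y $$ (i,j)) (- int b)" by (rule vge_add)
        then show "vge v (z $$ (i,j)) (- int b)" by simp
      qed
      then show ?thesis using z(1) by simp
    qed
    then show "\<exists>k::int. \<forall>z\<in>GL n. (\<forall>i<n. \<forall>j<n. vge v (z $$ (i,j) - y $$ (i,j)) k) \<longrightarrow> z \<in> ?O b" by blast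
  qed
  have "K' \<subseteq> \<Union>(range ?O)"
  proof
    fix h assume "h \<in> K'"
    then have hG: "h \<in> GL n" using KT T_GL[of h] by blast
    obtain b where "mvge n h (- int b)" using mvge_bounded[of n h] by blast
    then have "h \<in> ?O b" using hG by simp
    then show "h \<in> \<Union>(range ?O)" by (rule UN_I[OF UNIV_I])
  qed
  moreover have "\<forall>U\<in>range ?O. openin (GLtop v n) U" using op by simp
  ultimately have "\<exists>\<F>. finite \<F> \<and> \<F> \<subseteq> range ?O \<and> K' \<subseteq> \<Union>\<F>"
    using mp[OF spec[OF conjunct2[OF cpt[unfolded compactin_def]], of "range ?O"]] by simp
  then obtain \<F> where F: "finite \<F>" "\<F> \<subseteq> range ?O" "K' \<subseteq> \<Union>\<F>" by (elim exE conjE)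
  obtain Bs where Bs: "finite Bs" "\<F> = ?O ` Bs" using finite_subset_image[OF F(1,2)] by blast
  define b where "b = Max (insert 0 Bs)"
  have bnd: "mvge n h (- int b)" if h: "h \<in> K'" for h
  proof -
    have "h \<in> (\<Union>c\<in>Bs. ?O c)" using F(3) h unfolding Bs(2) by (rule subsetD)
    then obtain c where c: "c \<in> Bs" "mvge n h (- int c)" by blast
    have "c \<le> b" unfolding b_def using c(1) Bs(1) by (intro Max_ge) auto
    then show ?thesis using mvge_mono[OF c(2)] by simp
  qed
  have nonneg: "t i h \<ge> 0" if h: "h \<in> K'" and i: "i < n" for h i
  proof (rule ccontr)
    assume "\<not> t i h \<ge> 0"
    then have neg: "- t i h > 0" by simp
    have "\<exists>y\<in>K'. t i y = real k * t i h" for k :: nat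
    proof (induction k)
      case 0 then show ?case using one t_one[OF i] by auto
    next
      case (Suc k)
      then obtain y where y: "y \<in> K'" "t i y = real k * t i h" by blast
      have "t i (h * y) = real (Suc k) * t i h" using t_mult[of h y i] h y KT i by (auto simp: algebra_simps)
      then show ?case using mult[OF h y(1)] by blast
    qed
    then have pow: "\<exists>y\<in>K'. t i y = real k * t i h" for k :: nat .
    obtain k :: nat where k: "real b < real k * (- t i h)"
      using spec[OF reals_Archimedean3[OF neg], of "real b"] by (rule exE)
    obtain y where y: "y \<in> K'" "t i y = real k * t i h" using pow[of k] by (rule bexE)
    have "t i y \<ge> real_of_int (- int b)" using t_ge[OF _ i bnd[OF y(1)]] y(1) KT by blast
    then show False using k y(2) by simp
  qed
  fix h assume h: "h \<in> K'"
  have hT: "h \<in> T" using h KT by blast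
  obtain h' where h': "h' \<in> K'" "h * h' = 1\<^sub>m n" using inv[OF h] by blast
  have "t i h = 0" if i: "i < n" for i
    using nonneg[OF h i] nonneg[OF h'(1) i] t_mult[OF hT _ i, of h'] h' KT t_one[OF i] by auto
  then show "h \<in> Kx" using hT by (simp add: Kx_def)
qed

text \<open>\<open>is_mu_Gx\<close> assigns volume 1 to whatever satisfies this predicate, so
  establishing it for \<open>Kx\<close> is what fixes the torus measure.\<close>

lemma max_compact_Kx: "max_compact_subgroup v n T Kx"
proof -
  have "\<exists>b\<in>Kx. a * b = 1\<^sub>m n" if "a \<in> Kx" for a
    using Kx_closed(3)[OF that] GL_matinv(2)[OF T_GL[OF Kx_T[OF that]]] by blast
  then have "compact_subgroup v n T Kx"
    unfolding compact_subgroup_def using Kx_T Kx_closed compactin_Kx by blast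
  then show ?thesis unfolding max_compact_subgroup_def using compact_subgroup_le_Kx by blast
qed

text \<open>\<open>Kx\<close> contains the integral elements of the torus, an open subgroup of the
  torus, so it is a union of cosets of that subgroup.\<close>

lemma Kx_open_sets: "haar T MT \<Longrightarrow> Kx \<in> sets MT"
proof (rule open_sets_haar)
  show "Kx \<subseteq> T" using Kx_T by blast
  fix h assume h: "h \<in> Kx"
  have hG: "h \<in> GL n" using T_GL[OF Kx_T[OF h]] .
  have "nb 0 h \<inter> T \<subseteq> Kx"
  proof
    fix y assume y: "y \<in> nb 0 h \<inter> T"
    then have yG: "y \<in> GL n" and "matinv h * y \<in> Kc n 0" using hG by (auto simp: nb_def inv_GLg)
    then have k: "matinv h * y \<in> Kx" using integral_Kx T_closed(2)[OF T_closed(3)[OF Kx_T[OF h]], of y] y by blast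
    have "h * (matinv h * y) = y"
      using mult_inv_cancel_left[of h y] hG yG by (simp add: inv_GLg)
    then show "y \<in> Kx" using Kx_closed(2)[OF h k] by simp
  qed
  then show "\<exists>m. nb m h \<inter> T \<subseteq> Kx" by blast
qed

section \<open>Counting cosets in the torus\<close>

lemma Zc_T: "z \<in> Zc n \<Longrightarrow> z \<in> T"
  using Zc_central[of z n] GL_carrier(1)[OF xG] by (simp add: centralizer_def)

text \<open>From g = z a h = z0 a0 h0 with a, a0 in G_i one gets h = \<zeta> y h0 with \<zeta>
  central and y = a^-1 a0. Both y and its inverse have entries of valuation at least -(n + 1) i, so
  each of the n integers n! t_k(y) takes at most 1 + 2 n! (n + 1) i values.\<close>

lemma torus_cover:
  assumes g: "g \<in> GL n"
  shows "\<exists>R. finite R \<and> R \<subseteq> T \<and> card R \<le> (1 + 2 * (fact n * (n + 1)) * i) ^ n \<and>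
    (\<forall>h\<in>T. g * matinv h \<in> ZG_le v n i \<longrightarrow> (\<exists>r\<in>R. \<exists>z\<in>Zc n. \<exists>c\<in>Kx. h = z * c * r))"
proof (cases "\<exists>h\<in>T. g * matinv h \<in> ZG_le v n i")
  case False
  then show ?thesis by (intro exI[of _ "{}"]) auto
next
  case True
  \<comment> \<open>One element of the set serves as base point, which removes g from the count:
    only quotients matter.\<close>
  then obtain h0 where h0: "h0 \<in> T" "g * matinv h0 \<in> ZG_le v n i" by blast
  then obtain z0 a0 where za0: "z0 \<in> Zc n" "a0 \<in> G_le v n i" "g * matinv h0 = z0 * a0" by (auto simp: ZG_le_def)
  let ?F = "int (fact n * (n + 1) * i)"
  let ?J = "int ((n + 1) * i)"
  define Y where "Y = {y \<in> T. mvge n y (- ?J) \<and> mvge n (matinv y) (- ?J)}"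
  \<comment> \<open>The floor is exact, because n! times a valuation is an integer; it only converts
    the type.\<close>
  define f where "f y = restrict (\<lambda>k. \<lfloor>fact n * t k y\<rfloor>) {..<n}" for y
  have f_eq: "real_of_int (f y k) = fact n * t k y" if "y \<in> T" "k < n" for y k
    using t_int[OF that] that(2) by (simp add: f_def)
  have fY: "f ` Y \<subseteq> PiE {..<n} (\<lambda>_. {- ?F..?F})"
  proof
    fix c assume "c \<in> f ` Y"
    then obtain y where y: "y \<in> T" "mvge n y (- ?J)" "mvge n (matinv y) (- ?J)" "c = f y" by (auto simp: Y_def)
    have "f y k \<in> {- ?F..?F}" if k: "k < n" for k
    proof -
      have "t k y \<ge> real_of_int (- ?J)" "- t k y \<ge> real_of_int (- ?J)"
        using t_ge[OF y(1) k y(2)] t_ge[OF T_closed(3)[OF y(1)] k y(3)] t_inv[OF y(1) k] by auto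
      then have a: "fact n * t k y \<ge> fact n * real_of_int (- ?J)" "fact n * (- t k y) \<ge> fact n * real_of_int (- ?J)"
        by (intro mult_left_mono; simp)+
      have e: "fact n * real_of_int (- ?J) = real_of_int (- ?F)" by (simp add: algebra_simps)
      have "real_of_int (- ?F) \<le> real_of_int (f y k)" using a(1) unfolding e f_eq[OF y(1) k] .
      moreover have "real_of_int (- ?F) \<le> real_of_int (- f y k)"
        using a(2) unfolding e of_int_minus[of "f y k"] f_eq[OF y(1) k] by (simp only: mult_minus_right)
      ultimately have "- ?F \<le> f y k" "- ?F \<le> - f y k" by (simp_all only: of_int_le_iff)
      then show ?thesis by simp
    qed
    then show "c \<in> PiE {..<n} (\<lambda>_. {- ?F..?F})" unfolding y(4) by (auto simp: PiE_def extensional_def f_def)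
  qed
  have finP: "finite (PiE {..<n} (\<lambda>_. {- ?F..?F}))" by (intro finite_PiE) auto
  have "card (f ` Y) \<le> card (PiE {..<n} (\<lambda>_. {- ?F..?F}))" by (rule card_mono[OF finP fY])
  also have "\<dots> = (1 + 2 * (fact n * (n + 1)) * i) ^ n"
  proof -
    have "nat (?F + 1 - - ?F) = 1 + 2 * (fact n * (n + 1)) * i" by (simp only: nat_eq_iff2)
    then show ?thesis by (simp add: card_PiE del: of_nat_mult)
  qed
  finally have card: "card (f ` Y) \<le> (1 + 2 * (fact n * (n + 1)) * i) ^ n" .
  \<comment> \<open>Torus elements with the same valuation vector differ by an element of
    \<open>Kx\<close>, so one choice per fibre of \<open>f\<close> is enough.\<close>
  define \<rho> where "\<rho> c = (SOME y. y \<in> Y \<and> f y = c)" for c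
  have \<rho>: "\<rho> c \<in> Y \<and> f (\<rho> c) = c" if "c \<in> f ` Y" for c
  proof -
    have "\<exists>y. y \<in> Y \<and> f y = c" using that by blast
    then show ?thesis unfolding \<rho>_def by (rule someI_ex)
  qed
  have finf: "finite (f ` Y)" using finite_subset[OF fY finP] .
  let ?R = "(\<lambda>c. \<rho> c * h0) ` (f ` Y)"
  have "\<exists>r\<in>?R. \<exists>z\<in>Zc n. \<exists>c\<in>Kx. h = z * c * r" if h: "h \<in> T" and hg: "g * matinv h \<in> ZG_le v n i" for h
  proof -
    obtain z a where za: "z \<in> Zc n" "a \<in> G_le v n i" "g * matinv h = z * a" using hg by (auto simp: ZG_le_def)
    have A: "a \<in> GL n" "mvge n a (- int i)" "mvge n (matinv a) (- int (n * i))"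
      and A0: "a0 \<in> GL n" "mvge n a0 (- int i)" "mvge n (matinv a0) (- int (n * i))"
      using za(2) za0(2) G_le_matinv[OF _ n] by (auto simp: G_le_iff)
    note Z = Zc_central[OF za(1)] and Z0 = Zc_central[OF za0(1)]
    have iZ: "matinv z \<in> Zc n" using subgroup.m_inv_closed[OF Zc_subgroup za(1)] inv_GLg[OF Z(1)] by simp
    define y where "y = matinv a * a0"
    define \<zeta> where "\<zeta> = matinv z * z0"
    have ca: "a \<in> carrier (GLg n)" "a0 \<in> carrier (GLg n)" "z \<in> carrier (GLg n)" "z0 \<in> carrier (GLg n)" "h \<in> carrier (GLg n)"
      "h0 \<in> carrier (GLg n)" "g \<in> carrier (GLg n)" using A A0 Z Z0 T_GL[OF h] T_GL[OF h0(1)] g by auto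
    note mm = inv_GLg[OF A(1)] inv_GLg[OF Z(1)] inv_GLg[OF T_GL[OF h]] inv_GLg[OF T_GL[OF h0(1)]]
    have as: "p * q * r = p * (q * r)" if "p \<in> GL n" "q \<in> GL n" "r \<in> GL n" for p q r :: "'a mat"
      using assoc_mult_mat[OF GL_carrier(1)[OF that(1)] GL_carrier(1)[OF that(2)] GL_carrier(1)[OF that(3)]] .
    note HG = T_GL[OF h] and H0G = T_GL[OF h0(1)]
    have g1: "g = z * a * h"
    proof -
      have "g = g * (matinv h * h)" using GL_matinv(3)[OF HG] GL_carrier(1)[OF g] by simp
      also have "\<dots> = z * a * h" using as[OF g GL_matinv(1)[OF HG] HG] za(3) by simp
      finally show ?thesis .
    qed
    have g0: "g = z0 * a0 * h0"
    proof -
      have "g = g * (matinv h0 * h0)" using GL_matinv(3)[OF H0G] GL_carrier(1)[OF g] by simp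
      also have "\<dots> = z0 * a0 * h0" using as[OF g GL_matinv(1)[OF H0G] H0G] za0(3) by simp
      finally show ?thesis .
    qed
    have \<zeta>G: "\<zeta> \<in> GL n" unfolding \<zeta>_def using GL_mult[OF GL_matinv(1)[OF Z(1)] Z0(1)] .
    have yG: "y \<in> GL n" unfolding y_def using GL_mult[OF GL_matinv(1)[OF A(1)] A0(1)] .
    have "z * (a * h) = z0 * (a0 * h0)" using g1 g0 as[OF Z(1) A(1) HG] as[OF Z0(1) A0(1) H0G] by simp
    then have "matinv z * (z * (a * h)) = matinv z * (z0 * (a0 * h0))" by simp
    then have ah: "a * h = \<zeta> * (a0 * h0)"
      using as[OF GL_matinv(1)[OF Z(1)] Z(1) GL_mult[OF A(1) HG]] GL_matinv(3)[OF Z(1)] left_mult_one_mat[OF GL_carrier(1)[OF GL_mult[OF A(1) HG]]]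
        as[OF GL_matinv(1)[OF Z(1)] Z0(1) GL_mult[OF A0(1) H0G]] by (simp add: \<zeta>_def)
    have mc: "matinv a \<in> carrier_mat n n" using GL_carrier(1)[OF GL_matinv(1)[OF A(1)]] .
    have \<zeta>c: "p * \<zeta> = \<zeta> * p" if p: "p \<in> GL n" for p
      using Zc_central(2)[OF iZ, of p] Z0(2)[of p] as[OF GL_matinv(1)[OF Z(1)] Z0(1) p] as[OF GL_matinv(1)[OF Z(1)] p Z0(1)] as[OF p GL_matinv(1)[OF Z(1)] Z0(1)]
        GL_carrier(1)[OF p] by (simp add: \<zeta>_def)
    have "h = matinv a * (a * h)" using as[OF GL_matinv(1)[OF A(1)] A(1) HG] GL_matinv(3)[OF A(1)] GL_carrier(1)[OF HG] by simp
    also have "\<dots> = (matinv a * \<zeta>) * (a0 * h0)" unfolding ah using as[OF GL_matinv(1)[OF A(1)] \<zeta>G GL_mult[OF A0(1) H0G]] by simp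
    also have "\<dots> = \<zeta> * (matinv a * (a0 * h0))" unfolding \<zeta>c[OF GL_matinv(1)[OF A(1)]]
      using as[OF \<zeta>G GL_matinv(1)[OF A(1)] GL_mult[OF A0(1) H0G]] by simp
    also have "\<dots> = \<zeta> * (y * h0)" unfolding y_def using as[OF GL_matinv(1)[OF A(1)] A0(1) H0G] by simp
    finally have hy: "h = \<zeta> * (y * h0)" .
    have \<zeta>Z: "\<zeta> \<in> Zc n" unfolding \<zeta>_def using subgroup.m_closed[OF Zc_subgroup iZ za0(1)] by simp
    have \<zeta>T: "\<zeta> \<in> T" by (rule Zc_T[OF \<zeta>Z])
    \<comment> \<open>As a quotient of a0 and a, y is only known to lie in G; it belongs to the
      torus because it equals \<zeta>^-1 h h0^-1.\<close>
    have yT: "y \<in> T"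
    proof -
      have "matinv \<zeta> * h = y * h0" unfolding hy using as[OF GL_matinv(1)[OF \<zeta>G] \<zeta>G GL_mult[OF yG H0G]]
        GL_matinv(3)[OF \<zeta>G] left_mult_one_mat[OF GL_carrier(1)[OF GL_mult[OF yG H0G]]] by simp
      then have "matinv \<zeta> * h * matinv h0 = y" using as[OF yG H0G GL_matinv(1)[OF H0G]] GL_matinv(2)[OF H0G] GL_carrier(1)[OF yG] by simp
      then show ?thesis using T_closed(2)[OF T_closed(2)[OF T_closed(3)[OF \<zeta>T] h] T_closed(3)[OF h0(1)]] by simp
    qed
    have sum: "- int (n * i) + - int i = - ?J" by (simp add: algebra_simps)
    have my: "mvge n y (- ?J)" unfolding y_def sum[symmetric]
      by (rule mvge_mult[OF mc GL_carrier(1)[OF A0(1)] A(3) A0(2)])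
    have "matinv y = matinv a0 * a"
    proof -
      have "inv\<^bsub>GLg n\<^esub> y = inv\<^bsub>GLg n\<^esub> a0 \<otimes>\<^bsub>GLg n\<^esub> inv\<^bsub>GLg n\<^esub> (inv\<^bsub>GLg n\<^esub> a)"
        using inv_mult_group[of "inv\<^bsub>GLg n\<^esub> a" a0] ca GL_matinv(1)[OF A(1)] by (simp add: y_def mm(1))
      then show ?thesis using ca inv_GLg[OF yG] inv_GLg[OF A0(1)] by simp
    qed
    then have miy: "mvge n (matinv y) (- ?J)" unfolding sum[symmetric]
      using mvge_mult[OF GL_carrier(1)[OF GL_matinv(1)[OF A0(1)]] GL_carrier(1)[OF A(1)] A0(3) A(2)] by simp
    have yY: "y \<in> Y" using yT my miy by (simp add: Y_def)
    define r where "r = \<rho> (f y)"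
    have r: "r \<in> T" "f r = f y" using \<rho>[of "f y"] yY by (auto simp: r_def Y_def)
    have c: "matinv r * y \<in> Kx"
    proof -
      have "t k (matinv r * y) = 0" if k: "k < n" for k
      proof -
        have "fact n * t k r = fact n * t k y" using f_eq[OF r(1) k] f_eq[OF yT k] r(2) by simp
        then have "t k r = t k y" by simp
        then show ?thesis using t_mult[OF T_closed(3)[OF r(1)] yT k] t_inv[OF r(1) k] by simp
      qed
      then show ?thesis using T_closed(2)[OF T_closed(3)[OF r(1)] yT] by (simp add: Kx_def)
    qed
    have rG: "r \<in> GL n" using T_GL[OF r(1)] .
    have "\<zeta> * (matinv r * y) * (r * h0) = \<zeta> * ((matinv r * y) * (r * h0))"
      by (rule as[OF \<zeta>G GL_mult[OF GL_matinv(1)[OF rG] yG] GL_mult[OF rG H0G]])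
    also have "(matinv r * y) * (r * h0) = y * matinv r * (r * h0)" using comm[OF T_closed(3)[OF r(1)] yT] by simp
    also have "\<dots> = y * (matinv r * (r * h0))" by (rule as[OF yG GL_matinv(1)[OF rG] GL_mult[OF rG H0G]])
    also have "matinv r * (r * h0) = h0" using as[OF GL_matinv(1)[OF rG] rG H0G] GL_matinv(3)[OF rG] GL_carrier(1)[OF H0G] by simp
    finally have "h = \<zeta> * (matinv r * y) * (r * h0)" using hy by simp
    moreover have "r * h0 \<in> ?R" unfolding r_def using yY by blast
    ultimately show ?thesis using \<zeta>Z c by blast
  qed
  moreover have "finite ?R" using finf by simp
  moreover have "?R \<subseteq> T" using \<rho> T_closed(2)[OF _ h0(1)] by (auto simp: Y_def)
  moreover have "card ?R \<le> (1 + 2 * (fact n * (n + 1)) * i) ^ n" using card card_image_le[OF finf, of "\<lambda>c. \<rho> c * h0"] by simp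
  ultimately show ?thesis by (intro exI[of _ ?R]) blast
qed

end

section \<open>Averages and orbital integrals\<close>

lemma borel_sets_in_eq: "borel_sets_in v n H = sigma_sets H {U \<inter> H | U. filtered_group.gopen (GLg n) (Kc n) U}"
  by (simp add: borel_sets_in_def openin_GLtop)

text \<open>Specialises \<open>averaging_bound\<close> to the centralizer of x, the centre,
  \<open>Kx\<close> and the indicator of Z G_i. What has to be checked is the measurability of these
  data, right invariance, and the counting bound of \<open>torus_cover\<close>.\<close>

lemma averaging_le_orbital:
  fixes muG muZ muT :: "'a mat measure"
  assumes n: "n \<ge> 1" and x: "x \<in> G_rss n"
    and mG: "is_mu_G v n muG" and mZ: "is_mu_Z v n muZ" and mT: "is_mu_Gx v n x muT"
    and m: "smooth_cpt_mod_center v n m"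
    and u: "fibre_weight n muG muZ u" and w: "fibre_weight n muG muT w"
  shows "ennreal (cmod (avg_op v n muG u i m x)) \<le>
    of_nat ((1 + 2 * (fact n * (n + 1)) * i) ^ n) * orbital_integral n muG w (\<lambda>y. cmod (m y)) x"
proof -
  interpret filtered_group "GLg n" "Kc n" by (rule filtered_group_GL)
  obtain t B where tv: "torus_valuation n x t B" using torus_valuation_exists[OF x] by blast
  have xG: "x \<in> GL n" using x by (simp add: G_rss_def)
  let ?T = "centralizer n x"
  let ?K = "Kx n x t"
  note ctx = n x tv
  have hG: "haar (carrier (GLg n)) muG"
    using mG subgroup_self by (simp add: haar_def is_mu_G_def haar_on_def borel_sets_in_eq)
  have hZ: "haar (Zc n) muZ"
    using mZ Zc_subgroup by (simp add: haar_def is_mu_Z_def haar_on_def borel_sets_in_eq)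
  have hT: "haar ?T muT"
    using mT centralizer_subgroup[OF xG] by (simp add: haar_def is_mu_Gx_def borel_sets_in_eq)
  have muG1: "emeasure muG (Kc n 0) = 1" using mG by (simp add: is_mu_G_def haar_on_def Kc_0)
  have muZ1: "emeasure muZ (Zc_O v n) = 1" using mZ by (simp add: is_mu_Z_def haar_on_def)
  have muT1: "emeasure muT ?K = 1" using mT max_compact_Kx[OF ctx] by (simp add: is_mu_Gx_def)
  have Kx_sets: "?K \<in> sets muT" by (rule Kx_open_sets[OF ctx hT])
  have one: "(1\<^sub>m n :: 'a mat) \<in> GL n" by (rule GL_one)
  have ZO_sets: "Zc_O v n \<in> sets muZ" using nb_sets_haar[OF hZ, of "1\<^sub>m n" 0] nb_one[of 0] one by (simp add: Zc_O_eq[OF n])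
  have sG: "sigma_finite_measure muG" by (rule sigma_finite_haar[OF hG K0_sets[OF hG], of 0]) (auto simp: muG1)
  have sZ: "sigma_finite_measure muZ" by (rule sigma_finite_haar[OF hZ ZO_sets, of 0]) (use muZ1 in \<open>auto simp: Zc_O_eq[OF n]\<close>)
  have sT: "sigma_finite_measure muT"
    by (rule sigma_finite_haar[OF hT Kx_sets, of 0]) (use integral_Kx[OF ctx] in \<open>auto simp: muT1\<close>)
  have ZT: "Zc n \<subseteq> ?T" using Zc_T[OF ctx] by blast
  have spG: "space muG = GL n" using haarD(2)[OF hG] by simp
  have uG: "u \<in> borel_measurable muG" "\<And>g. g \<in> GL n \<Longrightarrow> u g \<ge> 0" "\<And>g. g \<in> GL n \<Longrightarrow> (\<integral>\<^sup>+h. ennreal (u (g * h)) \<partial>muZ) = 1"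
    and wG: "w \<in> borel_measurable muG" "\<And>g. g \<in> GL n \<Longrightarrow> (\<integral>\<^sup>+h. ennreal (w (g * h)) \<partial>muT) = 1"
    using u w by (auto simp: fibre_weight_def)
  have conj: "conj_by n g x = g * x * matinv g" if "g \<in> GL n" for g using ginv_matinv[OF that] by (simp add: conj_by_def)
  let ?F = "\<lambda>g. ennreal (cmod (m (conj_by n g x)))"
  \<comment> \<open>m is locally constant and g \<mapsto> g x g^-1 is continuous, so the pullback of
    m is locally constant; measurability of \<open>?F\<close> follows.\<close>
  have F_loc: "\<exists>l. nb l g \<inter> GL n \<subseteq> {y \<in> GL n. m (conj_by n y x) = m (conj_by n g x)}" if g: "g \<in> GL n" for g
  proof -
    let ?c = "g * x * matinv g"
    note iG = GL_matinv(1)[OF g]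
    have gx: "g * x \<in> GL n" using GL_mult[OF g xG] .
    have c: "?c \<in> GL n" using GL_mult[OF gx iG] .
    obtain V where V: "openin (GLtop v n) V" "?c \<in> V" "\<forall>y\<in>V. m y = m ?c"
      using m c unfolding smooth_cpt_mod_center_def by blast
    obtain a where a: "nb a ?c \<subseteq> V" using V(1,2) unfolding openin_GLtop gopen_def by blast
    have cg: "g \<in> carrier (GLg n)" "x \<in> carrier (GLg n)" "g * x \<in> carrier (GLg n)" "matinv g \<in> carrier (GLg n)" using g xG gx iG by auto
    obtain l1 where l1: "\<forall>p\<in>nb l1 (g * x). \<forall>q\<in>nb l1 (matinv g). p * q \<in> nb a ?c"
      using mult_continuous[OF cg(3,4), of a] by auto
    obtain l2 where l2: "\<forall>p\<in>nb l2 g. \<forall>q\<in>nb l2 x. p * q \<in> nb l1 (g * x)"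
      using mult_continuous[OF cg(1,2), of l1] by auto
    obtain l3 where l3: "\<forall>p\<in>nb l3 g. inv\<^bsub>GLg n\<^esub> p \<in> nb l1 (matinv g)"
      using inv_continuous[OF cg(1), of l1] inv_GLg[OF g] by auto
    have "m (conj_by n y x) = m (conj_by n g x)" if y: "y \<in> nb (max l2 l3) g" "y \<in> GL n" for y
    proof -
      have "y \<in> nb l2 g" "y \<in> nb l3 g" using y(1) nb_anti[of l2 "max l2 l3" g] nb_anti[of l3 "max l2 l3" g] by auto
      then have "y * x \<in> nb l1 (g * x)" "matinv y \<in> nb l1 (matinv g)"
        using l2 l3 nb_self[OF cg(2), of l2] inv_GLg[OF y(2)] by auto
      then have "y * x * matinv y \<in> V" using l1 a by blast
      then have "m (y * x * matinv y) = m ?c" using V(3) by blast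
      then show ?thesis unfolding conj[OF y(2)] conj[OF g] .
    qed
    then show ?thesis by blast
  qed
  have Fm: "?F \<in> borel_measurable muG"
  proof (rule measurableI)
    fix A :: "ennreal set" assume "A \<in> sets borel"
    have "{g \<in> GL n. ?F g \<in> A} \<in> sets muG"
    proof (rule open_sets_haar[OF hG])
      show "{g \<in> GL n. ?F g \<in> A} \<subseteq> carrier (GLg n)" by auto
      fix g assume g: "g \<in> {g \<in> GL n. ?F g \<in> A}"
      then obtain l where l: "nb l g \<inter> GL n \<subseteq> {y \<in> GL n. m (conj_by n y x) = m (conj_by n g x)}" using F_loc[of g] by blast
      have "nb l g \<inter> carrier (GLg n) \<subseteq> {g \<in> GL n. ?F g \<in> A}"
      proof
        fix y assume "y \<in> nb l g \<inter> carrier (GLg n)"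
        then have "y \<in> GL n" "m (conj_by n y x) = m (conj_by n g x)" using l by auto
        then show "y \<in> {g \<in> GL n. ?F g \<in> A}" using g by simp
      qed
      then show "\<exists>l. nb l g \<inter> carrier (GLg n) \<subseteq> {g \<in> GL n. ?F g \<in> A}" by blast
    qed
    moreover have "?F -` A \<inter> space muG = {g \<in> GL n. ?F g \<in> A}" unfolding spG by auto
    ultimately show "?F -` A \<inter> space muG \<in> sets muG" by simp
  qed simp
  \<comment> \<open>G_i is stable under right multiplication by \<open>GL_O\<close>, so Z G_i is a
    union of cosets of the level 0 subgroup.\<close>
  have ZGs: "ZG_le v n i \<in> sets muG"
  proof (rule open_sets_haar[OF hG])
    have sub: "z * h \<in> GL n" if "z \<in> Zc n" "h \<in> G_le v n i" for z h :: "'a mat"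
      using GL_mult[OF Zc_central(1)[OF that(1)], of h] that(2) by (simp add: G_le_def)
    show "ZG_le v n i \<subseteq> carrier (GLg n)" using sub by (auto simp: ZG_le_def)
    fix y assume "y \<in> ZG_le v n i"
    then obtain z a where za: "z \<in> Zc n" "a \<in> G_le v n i" "y = z * a" by (auto simp: ZG_le_def)
    have yG: "y \<in> carrier (GLg n)" using sub[OF za(1,2)] za(3) by simp
    have aG: "a \<in> GL n" and am: "mvge n a (- int i)" and ad: "v (det a) \<le> int i" using za(2) by (auto simp: G_le_iff)
    have "nb 0 y \<inter> carrier (GLg n) \<subseteq> ZG_le v n i"
    proof
      fix q assume "q \<in> nb 0 y \<inter> carrier (GLg n)"
      then obtain k where k: "k \<in> Kc n 0" "q = y * k" using nb_iff[OF yG, of q 0] by auto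
      have kO: "k \<in> GL n" "mvge n k 0" "v (det k) = 0" using k(1) by (auto simp: Kc_0 GL_O_iff)
      note ac = GL_carrier[OF aG] and kc = GL_carrier[OF kO(1)]
      have "mvge n (a * k) (- int i + 0)" by (rule mvge_mult[OF ac(1) kc(1) am kO(2)])
      then have "mvge n (a * k) (- int i)" by simp
      moreover have "v (det (a * k)) \<le> int i" using det_mult[OF ac(1) kc(1)] v_mult[OF ac(2) kc(2)] kO(3) ad by simp
      ultimately have "a * k \<in> G_le v n i" using GL_mult[OF aG kO(1)] by (simp add: G_le_iff)
      moreover have "q = z * (a * k)" using k(2) za(3) assoc_mult_mat[OF GL_carrier(1)[OF Zc_central(1)[OF za(1)]] ac(1) kc(1)] by simp
      ultimately show "q \<in> ZG_le v n i" using za(1) by (auto simp: ZG_le_def)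
    qed
    then show "\<exists>m. nb m y \<inter> carrier (GLg n) \<subseteq> ZG_le v n i" by blast
  qed
  have Finv: "?F (g * h) = ?F g" if g: "g \<in> GL n" and h: "h \<in> ?T" for g h
  proof -
    have hG': "h \<in> GL n" and hx: "h * x = x * h" using h by (auto simp: centralizer_def)
    have "inv\<^bsub>GLg n\<^esub> (g \<otimes>\<^bsub>GLg n\<^esub> h) = inv\<^bsub>GLg n\<^esub> h \<otimes>\<^bsub>GLg n\<^esub> inv\<^bsub>GLg n\<^esub> g"
      using g hG' by (intro inv_mult_group) auto
    then have i: "matinv (g * h) = matinv h * matinv g" using inv_GLg[OF g] inv_GLg[OF hG'] inv_GLg[OF GL_mult[OF g hG']] by simp
    note c = GL_carrier(1)[OF g] GL_carrier(1)[OF hG'] GL_carrier(1)[OF xG] GL_carrier(1)[OF GL_matinv(1)[OF g]] GL_carrier(1)[OF GL_matinv(1)[OF hG']]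
    have xh: "x * h \<in> carrier_mat n n" and gx: "g * x \<in> carrier_mat n n" using c by auto
    have hi: "matinv h * matinv g \<in> carrier_mat n n" using c(5,4) by (rule mult_carrier_mat)
    have "g * h * x * (matinv h * matinv g) = g * (x * h) * (matinv h * matinv g)" using assoc_mult_mat[OF c(1,2,3)] hx by simp
    also have "g * (x * h) = g * x * h" using assoc_mult_mat[OF c(1,3,2)] by simp
    also have "g * x * h * (matinv h * matinv g) = g * x * (h * (matinv h * matinv g))" by (rule assoc_mult_mat[OF gx c(2) hi])
    also have "h * (matinv h * matinv g) = matinv g" using assoc_mult_mat[OF c(2,5,4)] GL_matinv(2)[OF hG'] left_mult_one_mat[OF c(4)] by simp
    finally show ?thesis unfolding conj[OF g] conj[OF GL_mult[OF g hG']] i by simp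
  qed
  let ?N = "(1 + 2 * (fact n * (n + 1)) * i) ^ n"
  let ?I = "indicator (ZG_le v n i) :: 'a mat \<Rightarrow> ennreal"
  have bound: "(\<integral>\<^sup>+g. ?I g * ennreal (u g) * ?F g \<partial>muG) \<le> of_nat ?N * (\<integral>\<^sup>+g. ennreal (w g) * ?F g \<partial>muG)"
  proof (rule averaging_bound[OF hG sG hT sT hZ sZ])
    show "(\<integral>\<^sup>+g. f (g \<otimes>\<^bsub>GLg n\<^esub> h) \<partial>muG) = (\<integral>\<^sup>+g. f g \<partial>muG)" if "h \<in> ?T" "f \<in> borel_measurable muG" for h f
      using right_invariant[OF n, of muG h f] hG muG1 that by (simp add: Kc_0 centralizer_def)
    show "a \<otimes>\<^bsub>GLg n\<^esub> b = b \<otimes>\<^bsub>GLg n\<^esub> a" if "a \<in> ?T" "b \<in> ?T" for a b using comm[OF ctx that] by simp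
    show "Zc n \<subseteq> ?T" by (rule ZT)
    show "?I \<in> borel_measurable muG" using ZGs by simp
    show "?I g \<le> 1" for g by (simp add: indicator_def)
    show "(\<lambda>g. ennreal (u g)) \<in> borel_measurable muG" "(\<lambda>g. ennreal (w g)) \<in> borel_measurable muG" using uG(1) wG(1) by simp_all
    show "(\<integral>\<^sup>+z. ennreal (u (g \<otimes>\<^bsub>GLg n\<^esub> z)) \<partial>muZ) = 1" "(\<integral>\<^sup>+z. ennreal (w (g \<otimes>\<^bsub>GLg n\<^esub> z)) \<partial>muT) = 1" if "g \<in> carrier (GLg n)" for g
      using uG(3)[of g] wG(2)[of g] that by simp_all
    show "?F \<in> borel_measurable muG" by (rule Fm)
    show "?F (g \<otimes>\<^bsub>GLg n\<^esub> h) = ?F g" if "g \<in> carrier (GLg n)" "h \<in> ?T" for g h using Finv[of g h] that by simp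
    show "?K \<in> sets muT" "emeasure muT ?K = 1" by (rule Kx_sets muT1)+
    show "Zc_O v n \<in> sets muZ" "emeasure muZ (Zc_O v n) = 1" by (rule ZO_sets muZ1)+
    show "c \<otimes>\<^bsub>GLg n\<^esub> z \<in> ?K" if "c \<in> ?K" "z \<in> Zc_O v n" for c z
    proof -
      have "z \<in> ?K" using that(2) integral_Kx[OF ctx] ZT unfolding Zc_O_eq[OF n] by blast
      then show ?thesis using Kx_closed(2)[OF ctx that(1)] by simp
    qed
    show "\<exists>R. finite R \<and> R \<subseteq> ?T \<and> card R \<le> ?N \<and>
       (\<forall>h\<in>?T. ?I (g \<otimes>\<^bsub>GLg n\<^esub> inv\<^bsub>GLg n\<^esub> h) \<noteq> 0 \<longrightarrow> (\<exists>r\<in>R. \<exists>z\<in>Zc n. \<exists>c\<in>?K. h = z \<otimes>\<^bsub>GLg n\<^esub> c \<otimes>\<^bsub>GLg n\<^esub> r))"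
      if g: "g \<in> carrier (GLg n)" for g
    proof -
      obtain R where R: "finite R" "R \<subseteq> ?T" "card R \<le> ?N"
        "\<forall>h\<in>?T. g * matinv h \<in> ZG_le v n i \<longrightarrow> (\<exists>r\<in>R. \<exists>z\<in>Zc n. \<exists>c\<in>?K. h = z * c * r)"
        using torus_cover[OF ctx, of g i] g by auto
      have "\<exists>r\<in>R. \<exists>z\<in>Zc n. \<exists>c\<in>?K. h = z \<otimes>\<^bsub>GLg n\<^esub> c \<otimes>\<^bsub>GLg n\<^esub> r"
        if h: "h \<in> ?T" and ne: "?I (g \<otimes>\<^bsub>GLg n\<^esub> inv\<^bsub>GLg n\<^esub> h) \<noteq> 0" for h
      proof -
        have hG': "h \<in> GL n" using h by (simp add: centralizer_def)
        have "g * matinv h \<in> ZG_le v n i" using ne inv_GLg[OF hG'] by (simp add: indicator_def split: if_splits)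
        then show ?thesis using R(4) h by simp
      qed
      then show ?thesis using R(1-3) by blast
    qed
  qed
  let ?f = "\<lambda>g. complex_of_real (indicator (ZG_le v n i) g * u g) * m (conj_by n g x)"
  \<comment> \<open>\<open>avg_op\<close> is a Bochner integral with default value 0 for an
    integrand that is not integrable; the bound holds in that case too.\<close>
  have "ennreal (cmod (avg_op v n muG u i m x)) \<le> (\<integral>\<^sup>+g. ennreal (cmod (?f g)) \<partial>muG)"
  proof (cases "integrable muG ?f")
    case True
    then show ?thesis unfolding avg_op_def by (rule integral_norm_bound_ennreal)
  next
    case False
    then show ?thesis unfolding avg_op_def by (simp add: not_integrable_integral_eq)
  qed
  also have "\<dots> = (\<integral>\<^sup>+g. ?I g * ennreal (u g) * ?F g \<partial>muG)"
  proof (rule nn_integral_cong)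
    fix g assume "g \<in> space muG"
    then have "u g \<ge> 0" using uG(2) spG by simp
    then show "ennreal (cmod (?f g)) = ?I g * ennreal (u g) * ?F g"
      by (simp add: norm_mult ennreal_mult indicator_def split: if_splits)
  qed
  also have "\<dots> \<le> of_nat ?N * (\<integral>\<^sup>+g. ennreal (w g) * ?F g \<partial>muG)" by (rule bound)
  finally show ?thesis by (simp add: orbital_integral_def)
qed

end

theorem theoremD:
  fixes v :: "'a::field \<Rightarrow> int" and n :: nat
    and muG :: "'a mat measure" and muZ :: "'a mat measure"
    and muGx :: "'a mat \<Rightarrow> 'a mat measure"
  assumes "nonarch_local_field v"
    and "n \<ge> 1"
    and "is_mu_G v n muG"
    and "is_mu_Z v n muZ"
    and "\<forall>x\<in>G_rss n. is_mu_Gx v n x (muGx x)"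
  shows "\<exists>alpha :: nat poly. \<forall>m :: 'a mat \<Rightarrow> complex. \<forall>x\<in>G_rss n. \<forall>i :: nat.
           \<forall>u w :: 'a mat \<Rightarrow> real.
             smooth_cpt_mod_center v n m \<and> fibre_weight n muG muZ u \<and> fibre_weight n muG (muGx x) w \<longrightarrow>
             ennreal (cmod (avg_op v n muG u i m x))
               \<le> ennreal (real (poly alpha (i + nat (ov_rss v n x))))
                  * orbital_integral n muG w (\<lambda>y. cmod (m y)) x"
proof (intro exI allI ballI impI)
  interpret local_field v by (unfold_locales) (rule assms(1))
  fix m x i u w
  assume x: "x \<in> G_rss n"
    and a: "smooth_cpt_mod_center v n m \<and> fibre_weight n muG muZ u \<and> fibre_weight n muG (muGx x) w"
  \<comment> \<open>The coset count of \<open>torus_cover\<close> read as a polynomial in i; its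
    coefficients depend on n alone.\<close>
  let ?alpha = "[:1, 2 * (fact n * (n + 1)):] ^ n :: nat poly"
  \<comment> \<open>Coefficients in the naturals make evaluation monotone, so enlarging the argument
    from i only increases the value.\<close>
  have "(1 + 2 * (fact n * (n + 1)) * i) ^ n \<le> poly ?alpha (i + nat (ov_rss v n x))"
    by (auto simp: poly_power algebra_simps intro!: power_mono)
  then have "(of_nat ((1 + 2 * (fact n * (n + 1)) * i) ^ n) :: ennreal)
      \<le> ennreal (real (poly ?alpha (i + nat (ov_rss v n x))))"
    unfolding ennreal_of_nat_eq_real_of_nat by (intro ennreal_leI of_nat_mono)
  moreover have "ennreal (cmod (avg_op v n muG u i m x)) \<le>
      of_nat ((1 + 2 * (fact n * (n + 1)) * i) ^ n) * orbital_integral n muG w (\<lambda>y. cmod (m y)) x"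
    using averaging_le_orbital[OF assms(2) x assms(3,4)] assms(5) x a by blast
  ultimately show "ennreal (cmod (avg_op v n muG u i m x))
      \<le> ennreal (real (poly ?alpha (i + nat (ov_rss v n x)))) * orbital_integral n muG w (\<lambda>y. cmod (m y)) x"
    by (meson mult_right_mono order_trans zero_le)
qed

end
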